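(* There exist constants $c_2,c_3>0$ such that the following holds. Let $z^\star=x^\star+iy^\star\in\mathbb{C}^n$ be nonzero ($x^\star,y^\star\in\mathbb{R}^n$), let $a_1,\dots,a_m$ be independent random vectors sampled from the standard complex Gaussian distribution $\mathbb{C}\mathcal{N}(0,I_n)$, let $b_j=|a_j^Hz^\star|$ for $j=1,\dots,m$, and define $f:\mathbb{R}^n\times\mathbb{R}^n\to\mathbb{R}$ by $$f(x,y)=\frac{1}{2m}\sum_{j=1}^m\left(|a_j^H(x+iy)|^2-b_j^2\right)^2 .$$ Let $\mathcal{X}^\star=\{(x^\star\cos\phi-y^\star\sin\phi,\ x^\star\sin\phi+y^\star\cos\phi):\phi\in[0,2\pi)\}$. If $m\ge c_2n\log^3n$, then the following two statements hold with probability at least $1-c_3m^{-1}$. (i) $\mathcal{X}^\star$ equals the set of second-order critical points of $f$. (ii) The following error bound holds: $$\operatorname{dist}\big((x,y),\mathcal{X}^\star\big)\le\frac{4}{\|z^\star\|^2}\|\nabla f(x,y)\|\quad\text{whenever}\quad\operatorname{dist}\big((x,y),\mathcal{X}^\star\big)\le\frac{1}{\sqrt7}\|z^\star\| .$$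
   Context: $a^H$ denotes the Hermitian (conjugate) transpose and $\|z\|=\sqrt{z^Hz}$. A vector distributed as $\mathbb{C}\mathcal{N}(0,I_n)$ has independent entries whose real and imaginary parts are independent real Gaussians with mean $0$ and variance $1/2$ (so $\mathbb{E}[aa^H]=I_n$). $\mathbb{R}^n\times\mathbb{R}^n$ is identified with $\mathbb{R}^{2n}$ with its Euclidean norm and distance. A point $(x,y)$ is a second-order critical point of $f$ if $\nabla f(x,y)=0$ and $\nabla^2f(x,y)\succeq0$ (positive semidefinite). *)

theory Defs
  imports "HOL-Probability.Probability"
begin

text \<open>
  The constants of the theorem must not depend on the dimension, so the dimension is a natural
  number rather than a type: a vector with \<open>d\<close> entries is a function on \<open>nat\<close> that is
  \<open>undefined\<close> outside \<open>{..<d}\<close>. This makes equality of vectors, and hence of sets of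
  vectors, the componentwise one.
\<close>

definition vecs :: "nat \<Rightarrow> (nat \<Rightarrow> 'a) set" where
  "vecs d = {..<d} \<rightarrow>\<^sub>E UNIV"

definition herm :: "nat \<Rightarrow> (nat \<Rightarrow> complex) \<Rightarrow> (nat \<Rightarrow> complex) \<Rightarrow> complex" where
  "herm n a z = (\<Sum>k<n. cnj (a k) * z k)"

definition cnorm :: "nat \<Rightarrow> (nat \<Rightarrow> complex) \<Rightarrow> real" where
  "cnorm n z = sqrt (Re (herm n z z))"

definition stack :: "nat \<Rightarrow> (nat \<Rightarrow> real) \<Rightarrow> (nat \<Rightarrow> real) \<Rightarrow> (nat \<Rightarrow> real)" where
  "stack n x y = (\<lambda>i\<in>{..<2 * n}. if i < n then x i else y (i - n))"

text \<open>The complex vector \<open>x + iy\<close> of a point \<open>w = stack n x y\<close>.\<close>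

definition to_complex :: "nat \<Rightarrow> (nat \<Rightarrow> real) \<Rightarrow> (nat \<Rightarrow> complex)" where
  "to_complex n w = (\<lambda>k\<in>{..<n}. Complex (w k) (w (n + k)))"

definition dist_to_set :: "nat \<Rightarrow> (nat \<Rightarrow> real) \<Rightarrow> (nat \<Rightarrow> real) set \<Rightarrow> real" where
  "dist_to_set d w S = (INF v\<in>S. L2_set (\<lambda>i. w i - v i) {..<d})"

text \<open>
  Gradient and Hessian are assembled from iterated partial derivatives. They are applied to
  polynomials only, so all these derivatives exist.
\<close>

definition partial_deriv ::
    "nat \<Rightarrow> ((nat \<Rightarrow> real) \<Rightarrow> real) \<Rightarrow> (nat \<Rightarrow> real) \<Rightarrow> real" where
  "partial_deriv i f w = deriv (\<lambda>t. f (w(i := t))) (w i)"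

definition grad :: "nat \<Rightarrow> ((nat \<Rightarrow> real) \<Rightarrow> real) \<Rightarrow> (nat \<Rightarrow> real) \<Rightarrow> (nat \<Rightarrow> real)" where
  "grad d f w = (\<lambda>i\<in>{..<d}. partial_deriv i f w)"

definition hess :: "((nat \<Rightarrow> real) \<Rightarrow> real) \<Rightarrow> (nat \<Rightarrow> real) \<Rightarrow> nat \<Rightarrow> nat \<Rightarrow> real" where
  "hess f w i j = partial_deriv i (partial_deriv j f) w"

definition psd :: "nat \<Rightarrow> (nat \<Rightarrow> nat \<Rightarrow> real) \<Rightarrow> bool" where
  "psd d H \<longleftrightarrow> (\<forall>i<d. \<forall>j<d. H i j = H j i) \<and>
     (\<forall>v. (\<Sum>i<d. \<Sum>j<d. v i * H i j * v j) \<ge> 0)"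

definition second_order_critical_points ::
    "nat \<Rightarrow> ((nat \<Rightarrow> real) \<Rightarrow> real) \<Rightarrow> (nat \<Rightarrow> real) set" where
  "second_order_critical_points d f =
     {w \<in> vecs d. (\<forall>i<d. grad d f w i = 0) \<and> psd d (hess f w)}"

definition phase_loss ::
    "nat \<Rightarrow> nat \<Rightarrow> (nat \<Rightarrow> nat \<Rightarrow> complex) \<Rightarrow> (nat \<Rightarrow> real) \<Rightarrow> (nat \<Rightarrow> real) \<Rightarrow> real" where
  "phase_loss n m a b w =
     1 / (2 * real m) * (\<Sum>j<m. ((cmod (herm n (a j) (to_complex n w)))\<^sup>2 - (b j)\<^sup>2)\<^sup>2)"

definition solution_set :: "nat \<Rightarrow> (nat \<Rightarrow> complex) \<Rightarrow> (nat \<Rightarrow> real) set" where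
  "solution_set n z =
     (\<lambda>\<phi>. stack n (\<lambda>k. Re (z k) * cos \<phi> - Im (z k) * sin \<phi>)
                  (\<lambda>k. Re (z k) * sin \<phi> + Im (z k) * cos \<phi>)) ` {0..<2 * pi}"

text \<open>The second argument of \<^const>\<open>normal_density\<close> is the standard deviation.\<close>

definition half_gaussian :: "real measure" where
  "half_gaussian = density lborel (\<lambda>t. ennreal (normal_density 0 (sqrt (1 / 2)) t))"

definition complex_gaussian :: "complex measure" where
  "complex_gaussian = distr (half_gaussian \<Otimes>\<^sub>M half_gaussian) borel (\<lambda>(s, t). Complex s t)"

definition complex_gaussian_vec :: "nat \<Rightarrow> (nat \<Rightarrow> complex) measure" where
  "complex_gaussian_vec n = (\<Pi>\<^sub>M k\<in>{..<n}. complex_gaussian)"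

text \<open>
  The joint law of \<open>m\<close> independent standard complex Gaussian vectors. Independence is the
  product structure; a general sample space would add a type variable on which the constants of
  the theorem could formally depend.
\<close>

definition gaussian_samples :: "nat \<Rightarrow> nat \<Rightarrow> (nat \<Rightarrow> nat \<Rightarrow> complex) measure" where
  "gaussian_samples n m = (\<Pi>\<^sub>M j\<in>{..<m}. complex_gaussian_vec n)"

lemma prob_space_half_gaussian: "prob_space half_gaussian"
  unfolding half_gaussian_def by (rule prob_space_normal_density) simp

lemma sets_half_gaussian [measurable_cong, simp]: "sets half_gaussian = sets borel"
  by (simp add: half_gaussian_def)

lemma prob_space_complex_gaussian: "prob_space complex_gaussian"
proof -
  have "prob_space (half_gaussian \<Otimes>\<^sub>M half_gaussian)"
    by (intro prob_space_pair prob_space_half_gaussian)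
  moreover have "(\<lambda>(s, t). Complex s t) \<in> borel_measurable (half_gaussian \<Otimes>\<^sub>M half_gaussian)"
  proof -
    have "fst \<in> borel_measurable (half_gaussian \<Otimes>\<^sub>M half_gaussian)"
      using measurable_fst[of half_gaussian half_gaussian]
      by (simp only: measurable_cong_sets[OF refl sets_half_gaussian])
    moreover have "snd \<in> borel_measurable (half_gaussian \<Otimes>\<^sub>M half_gaussian)"
      using measurable_snd[of half_gaussian half_gaussian]
      by (simp only: measurable_cong_sets[OF refl sets_half_gaussian])
    ultimately show ?thesis
      by (simp add: borel_measurable_complex_iff case_prod_beta')
  qed
  ultimately show ?thesis
    unfolding complex_gaussian_def by (rule prob_space.prob_space_distr)
qed

lemma prob_space_gaussian_samples: "prob_space (gaussian_samples n m)"
  unfolding gaussian_samples_def complex_gaussian_vec_def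
  by (intro prob_space_PiM prob_space_complex_gaussian)

end

theory Submission
  imports Defs "HOL-Real_Asymp.Real_Asymp"
begin

text \<open>
  The loss is a polynomial of degree four whose gradient and Hessian are built from the empirical
  averages of \<open>(Re (cnj (a\<^sup>Hz) (a\<^sup>Hw)))\<^sup>2\<close>. If these averages equalled their expectation, the
  landscape could be read off by hand. With \<open>m\<close> of order \<open>n log\<^sup>3 n\<close> they cannot be close to the
  expectation from above for all \<open>z, w\<close>: taking unit vectors \<open>z = w\<close> along one of the samples gives an
  average of order at least \<open>n\<^sup>2/m\<close>. The proof rests on the fact that two one-sided statements are
  enough: a lower bound for all pairs \<open>z, w\<close> (\<open>lower_regular\<close>) and an upper bound for
  the pairs whose first vector is the signal \<open>x\<close> (\<open>upper_regular\<close>).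

  \<^bold>\<open>Error bound near the orbit.\<close> Let \<open>x\<close> be the nearest point of the orbit, \<open>z = x + h\<close>, and
  put \<open>p = Re (cnj (a\<^sup>Hx) (a\<^sup>Hh))\<close>, \<open>q = |a\<^sup>Hh|\<^sup>2\<close>. The directional derivative of the loss at \<open>z\<close> along
  \<open>h\<close> is twice the average of
  \<open>2p\<^sup>2 + 3pq + q\<^sup>2 = q |a\<^sup>H(h + 3x/2)|\<^sup>2 + 2p\<^sup>2 - (9/4) |a\<^sup>Hx|\<^sup>2 q\<close>.
  The first two terms have lower bounds, the last one involves \<open>x\<close> and so has an upper bound. Since
  \<open>x\<^sup>Hh\<close> is real, the expectation is at least \<open>(6/7) \<parallel>x\<parallel>\<^sup>2 \<parallel>h\<parallel>\<^sup>2\<close> when \<open>7 \<parallel>h\<parallel>\<^sup>2 \<le> \<parallel>x\<parallel>\<^sup>2\<close>, far above the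
  \<open>(1/8) \<parallel>x\<parallel>\<^sup>2 \<parallel>h\<parallel>\<^sup>2\<close> that the factor \<open>4\<close> in the theorem needs (\<open>local_gradient_bound\<close>).

  \<^bold>\<open>No other critical points.\<close> Let \<open>z\<close> be a second-order critical point, with phase chosen so that
  \<open>x\<^sup>Hz \<ge> 0\<close>. Stationarity in the directions \<open>z\<close> and \<open>x\<close> shows, for \<open>w = z + \<beta>x\<close>, that the average of
  \<open>|a\<^sup>Hz|\<^sup>2 |a\<^sup>Hw|\<^sup>2\<close> equals that of \<open>|a\<^sup>Hx|\<^sup>2 |a\<^sup>Hw|\<^sup>2 + \<beta>\<^sup>2 (|a\<^sup>Hz|\<^sup>2 - |a\<^sup>Hx|\<^sup>2) |a\<^sup>Hx|\<^sup>2\<close>.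
  The left side has a lower and the right side an upper bound, for every \<open>\<beta>\<close>. With nonnegative
  curvature along \<open>x\<close> and \<open>\<i>x\<close> this confines \<open>\<parallel>z\<parallel>\<close> and \<open>x\<^sup>Hz\<close>, and hence \<open>z\<close> is so close to the
  orbit that the error bound applies; the gradient vanishes, so \<open>z\<close> lies on the orbit
  (\<open>population_landscape\<close>, \<open>critical_point_near_solution\<close>, \<open>critical_points_in_orbit\<close>).

  \<^bold>\<open>Probability.\<close> For fixed \<open>z, w\<close> the lower deviation is subgaussian because the summands are
  nonnegative with finite second moment (\<open>lower_tail_ip\<close>). For the upper deviation the summands are
  truncated at \<open>|a\<^sup>Hx| \<le> R\<close> with \<open>R\<^sup>2 = 16 log m\<close>, which costs a factor \<open>R\<^sup>4 \<sim> log\<^sup>2 m\<close> in the exponent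
  (\<open>upper_tail_truncated_ip\<close>). Both bounds are extended to all vectors through a grid of mesh
  \<open>m\<close> to the power \<open>-9\<close>. It is so fine that crude size bounds on the entries of the samples control
  the rounding error, yet it has only \<open>exp (O (n log m))\<close> points. The union bound needs
  \<open>m / log\<^sup>2 m\<close> to dominate \<open>n log m\<close>, and this is where \<open>n log\<^sup>3 n\<close> comes from.

  The event must also be shown to be measurable, as it quantifies over uncountably many points;
  compactness reduces it to countably many conditions (\<open>sets_good_event\<close>).
\<close>

section \<open>Empirical fourth moments and the population landscape\<close>

text \<open>
  Every estimate below is quadratic in each of its vectors, so it is stated with squared norms.
\<close>

definition nsq :: "nat \<Rightarrow> (nat \<Rightarrow> complex) \<Rightarrow> real" where
  "nsq n z = (\<Sum>k<n. (cmod (z k))\<^sup>2)"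

text \<open>
  Half the derivative of \<open>|a\<^sup>Hz|\<^sup>2\<close> in the direction \<open>w\<close>.
\<close>

definition ip :: "nat \<Rightarrow> (nat \<Rightarrow> complex) \<Rightarrow> (nat \<Rightarrow> complex) \<Rightarrow> (nat \<Rightarrow> complex) \<Rightarrow> real" where
  "ip n a z w = Re (cnj (herm n a z) * herm n a w)"

text \<open>
  The expectation of \<open>(ip n a z w)\<^sup>2\<close> for a standard complex Gaussian vector \<open>a\<close>, as shown in
  \<open>ip_square_moment\<close>.
\<close>

definition mom :: "nat \<Rightarrow> (nat \<Rightarrow> complex) \<Rightarrow> (nat \<Rightarrow> complex) \<Rightarrow> real" where
  "mom n z w = nsq n z * nsq n w / 2 + 3 / 2 * (Re (herm n z w))\<^sup>2 - (Im (herm n z w))\<^sup>2 / 2"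

definition avg :: "nat \<Rightarrow> (nat \<Rightarrow> real) \<Rightarrow> real" where
  "avg m g = (\<Sum>j<m. g j) / real m"

text \<open>
  The error terms are proportional to \<open>\<parallel>z\<parallel>\<^sup>2 \<parallel>w\<parallel>\<^sup>2\<close>, so that these conditions are invariant under
  scaling and can be verified on unit vectors.
\<close>

definition lower_regular :: "nat \<Rightarrow> nat \<Rightarrow> (nat \<Rightarrow> nat \<Rightarrow> complex) \<Rightarrow> real \<Rightarrow> bool" where
  "lower_regular n m a \<delta> \<longleftrightarrow>
     (\<forall>z w. mom n z w - \<delta> * nsq n z * nsq n w \<le> avg m (\<lambda>j. (ip n (a j) z w)\<^sup>2))"

definition upper_regular ::
    "nat \<Rightarrow> nat \<Rightarrow> (nat \<Rightarrow> nat \<Rightarrow> complex) \<Rightarrow> (nat \<Rightarrow> complex) \<Rightarrow> real \<Rightarrow> bool" where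
  "upper_regular n m a x \<delta> \<longleftrightarrow>
     (\<forall>h. avg m (\<lambda>j. (ip n (a j) x h)\<^sup>2) \<le> mom n x h + \<delta> * nsq n x * nsq n h)"

lemma avg_add: "avg m (\<lambda>j. f j + g j) = avg m f + avg m g"
  by (simp add: avg_def sum.distrib add_divide_distrib)

lemma avg_diff: "avg m (\<lambda>j. f j - g j) = avg m f - avg m g"
  by (simp add: avg_def sum_subtractf diff_divide_distrib)

lemma avg_cmult: "avg m (\<lambda>j. c * f j) = c * avg m f"
  by (simp add: avg_def sum_distrib_left[symmetric])

lemma herm_add: "herm n a (\<lambda>k. z k + w k) = herm n a z + herm n a w"
  by (simp add: herm_def sum.distrib algebra_simps)

lemma herm_diff: "herm n a (\<lambda>k. z k - w k) = herm n a z - herm n a w"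
  by (simp add: herm_def sum_subtractf algebra_simps)

lemma herm_scale: "herm n a (\<lambda>k. c * z k) = c * herm n a z"
  by (simp add: herm_def sum_distrib_left algebra_simps)

lemma herm_scale_left: "herm n (\<lambda>k. c * a k) z = cnj c * herm n a z"
  by (simp add: herm_def sum_distrib_left algebra_simps)

lemma herm_add_left: "herm n (\<lambda>k. a k + b k) z = herm n a z + herm n b z"
  by (simp add: herm_def sum.distrib algebra_simps)

lemma herm_commute: "herm n z w = cnj (herm n w z)"
  by (simp add: herm_def mult.commute)

lemma herm_self: "herm n z z = complex_of_real (nsq n z)"
  by (simp add: herm_def nsq_def mult.commute[of "cnj _"] complex_norm_square[symmetric] del: of_real_power)

lemma cnorm_eq: "cnorm n z = sqrt (nsq n z)"
  by (simp add: cnorm_def herm_self)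

lemma nsq_nonneg [simp]: "0 \<le> nsq n z"
  by (simp add: nsq_def sum_nonneg)

lemma nsq_scale: "nsq n (\<lambda>k. c * z k) = (cmod c)\<^sup>2 * nsq n z"
  by (simp add: nsq_def norm_mult power_mult_distrib sum_distrib_left)

lemma nsq_add: "nsq n (\<lambda>k. z k + w k) = nsq n z + 2 * Re (herm n z w) + nsq n w"
proof -
  have "complex_of_real (nsq n (\<lambda>k. z k + w k)) = herm n z z + herm n z w + (cnj (herm n z w) + herm n w w)"
    unfolding herm_self[symmetric] herm_add herm_add_left by (simp add: herm_commute[of n w z])
  then show ?thesis unfolding herm_self by (simp add: complex_eq_iff)
qed

lemma nsq_diff: "nsq n (\<lambda>k. z k - w k) = nsq n z - 2 * Re (herm n z w) + nsq n w"
  using nsq_add[of n z "\<lambda>k. (-1) * w k"] herm_scale[of n z "-1" w] nsq_scale[of n "-1" w] by simp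

lemma cmod_herm_le: "(cmod (herm n z w))\<^sup>2 \<le> nsq n z * nsq n w"
proof -
  have "cmod (herm n z w) \<le> (\<Sum>k<n. \<bar>cmod (z k)\<bar> * \<bar>cmod (w k)\<bar>)"
    unfolding herm_def by (rule order_trans[OF norm_sum]) (simp add: norm_mult)
  also have "\<dots> \<le> L2_set (\<lambda>k. cmod (z k)) {..<n} * L2_set (\<lambda>k. cmod (w k)) {..<n}"
    by (rule L2_set_mult_ineq)
  also have "\<dots> = sqrt (nsq n z * nsq n w)"
    by (simp add: L2_set_def nsq_def real_sqrt_mult)
  finally have "(cmod (herm n z w))\<^sup>2 \<le> (sqrt (nsq n z * nsq n w))\<^sup>2"
    by (rule power_mono) simp
  then show ?thesis by simp
qed

text \<open>Rotating the first argument by \<open>\<i>\<close> turns the real part of an inner product into its imaginary part.\<close>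

text \<open>
  Squared real and imaginary part add up to the squared modulus, and multiplying the second vector by
  \<open>\<i>\<close> exchanges them up to sign. This turns bounds on averages of \<open>(ip n a z w)\<^sup>2\<close> into
  bounds on averages of \<open>|a\<^sup>Hz|\<^sup>2 |a\<^sup>Hw|\<^sup>2\<close>.
\<close>

lemma cmod_prod_eq_ip:
  "(cmod (herm n a z))\<^sup>2 * (cmod (herm n a w))\<^sup>2
     = (ip n a z w)\<^sup>2 + (ip n a z (\<lambda>k. \<i> * w k))\<^sup>2"
proof -
  have "(cmod (herm n a z))\<^sup>2 * (cmod (herm n a w))\<^sup>2 = (cmod (cnj (herm n a z) * herm n a w))\<^sup>2"
    by (simp add: norm_mult power_mult_distrib)
  also have "\<dots> = (ip n a z w)\<^sup>2 + (ip n a z (\<lambda>k. \<i> * w k))\<^sup>2"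
    unfolding ip_def herm_scale cmod_power2 by simp algebra
  finally show ?thesis .
qed

lemma mom_rotate_add:
  "mom n z w + mom n z (\<lambda>k. \<i> * w k) = nsq n z * nsq n w + (cmod (herm n z w))\<^sup>2"
  by (simp add: mom_def herm_scale nsq_scale cmod_power2 field_simps)

lemma nsq_rotate: "cmod c = 1 \<Longrightarrow> nsq n (\<lambda>k. c * z k) = nsq n z"
  by (simp add: nsq_scale)

lemma upper_regular_rotate:
  assumes "upper_regular n m a x \<delta>" "cmod c = 1"
  shows "upper_regular n m a (\<lambda>k. c * x k) \<delta>"
  unfolding upper_regular_def
proof
  fix h
  have "avg m (\<lambda>j. (ip n (a j) x (\<lambda>k. cnj c * h k))\<^sup>2)
      \<le> mom n x (\<lambda>k. cnj c * h k) + \<delta> * nsq n x * nsq n (\<lambda>k. cnj c * h k)"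
    using assms(1) by (simp add: upper_regular_def)
  moreover have "ip n (a j) x (\<lambda>k. cnj c * h k) = ip n (a j) (\<lambda>k. c * x k) h" for j
    by (simp add: ip_def herm_scale algebra_simps)
  moreover have "mom n x (\<lambda>k. cnj c * h k) = mom n (\<lambda>k. c * x k) h"
    using assms(2) by (simp add: mom_def herm_scale herm_scale_left nsq_rotate)
  ultimately show "avg m (\<lambda>j. (ip n (a j) (\<lambda>k. c * x k) h)\<^sup>2)
      \<le> mom n (\<lambda>k. c * x k) h + \<delta> * nsq n (\<lambda>k. c * x k) * nsq n h"
    using assms(2) by (simp add: nsq_rotate)
qed

lemma lower_regular_product:
  assumes "lower_regular n m a \<delta>"
  shows "nsq n z * nsq n w + (cmod (herm n z w))\<^sup>2 - 2 * \<delta> * nsq n z * nsq n w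
     \<le> avg m (\<lambda>j. (cmod (herm n (a j) z))\<^sup>2 * (cmod (herm n (a j) w))\<^sup>2)"
proof -
  have "nsq n (\<lambda>k. \<i> * w k) = nsq n w" by (simp add: nsq_rotate)
  moreover have "mom n z v - \<delta> * nsq n z * nsq n v \<le> avg m (\<lambda>j. (ip n (a j) z v)\<^sup>2)" for v
    using assms by (simp add: lower_regular_def)
  note this[of w] this[of "\<lambda>k. \<i> * w k"]
  ultimately show ?thesis
    using mom_rotate_add[of n z w] unfolding cmod_prod_eq_ip avg_add by simp
qed

lemma upper_regular_product:
  assumes "upper_regular n m a x \<delta>"
  shows "avg m (\<lambda>j. (cmod (herm n (a j) x))\<^sup>2 * (cmod (herm n (a j) w))\<^sup>2)
     \<le> nsq n x * nsq n w + (cmod (herm n x w))\<^sup>2 + 2 * \<delta> * nsq n x * nsq n w"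
proof -
  have "nsq n (\<lambda>k. \<i> * w k) = nsq n w" by (simp add: nsq_rotate)
  moreover have "avg m (\<lambda>j. (ip n (a j) x v)\<^sup>2) \<le> mom n x v + \<delta> * nsq n x * nsq n v" for v
    using assms by (simp add: upper_regular_def)
  note this[of w] this[of "\<lambda>k. \<i> * w k"]
  ultimately show ?thesis
    using mom_rotate_add[of n x w] unfolding cmod_prod_eq_ip avg_add by simp
qed

text \<open>
  Completing the square with \<open>h + 3x/2\<close> writes the integrand as nonnegative terms, which only need
  lower bounds, minus a multiple of \<open>|a\<^sup>Hx|\<^sup>2 |a\<^sup>Hh|\<^sup>2\<close>, which is quadratic in \<open>h\<close> and has an upper bound.
  With \<open>s = x\<^sup>Hh\<close>, \<open>X = \<parallel>x\<parallel>\<^sup>2\<close> and \<open>H = \<parallel>h\<parallel>\<^sup>2\<close> the expectation is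
  \<open>XH + 3s\<^sup>2 + 6sH + 2H\<^sup>2 = XH - H\<^sup>2 + 3(s + H)\<^sup>2\<close>.
\<close>

lemma local_gradient_bound:
  assumes low: "lower_regular n m a \<delta>" and up: "upper_regular n m a x \<delta>"
    and \<delta>: "0 \<le> \<delta>" "\<delta> \<le> 1 / 40"
    and real: "Im (herm n x h) = 0" and small: "7 * nsq n h \<le> nsq n x"
  shows "nsq n x * nsq n h / 8
    \<le> avg m (\<lambda>j. ((cmod (herm n (a j) (\<lambda>k. x k + h k)))\<^sup>2 - (cmod (herm n (a j) x))\<^sup>2)
                 * ip n (a j) (\<lambda>k. x k + h k) h)"
proof -
  define s where "s = Re (herm n x h)"
  define X where "X = nsq n x"
  define H where "H = nsq n h"
  let ?v = "\<lambda>k. h k + 3 / 2 * x k"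
  have XH: "X \<ge> 0" "H \<ge> 0" "7 * H \<le> X" using small by (simp_all add: X_def H_def)
  have hx: "herm n h x = complex_of_real s"
    using herm_commute[of n h x] real by (simp add: complex_eq_iff s_def)
  have xh: "herm n x h = complex_of_real s"
    using real by (simp add: complex_eq_iff s_def)
  have s2: "s\<^sup>2 \<le> X * H"
    using cmod_herm_le[of n x h] by (simp add: xh X_def H_def)
  have nv: "nsq n ?v = H + 3 * s + 9 / 4 * X"
    unfolding nsq_add herm_scale hx nsq_scale by (simp add: H_def X_def norm_divide power_divide)
  have hv: "herm n h ?v = complex_of_real (H + 3 / 2 * s)"
    unfolding herm_add herm_scale hx herm_self by (simp add: H_def)
  (* The completed square: 2p^2 + 3pq + q^2 with the coefficient 3/2 chosen to absorb 3pq. *)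
  have id: "((cmod (herm n (a j) (\<lambda>k. x k + h k)))\<^sup>2 - (cmod (herm n (a j) x))\<^sup>2)
                 * ip n (a j) (\<lambda>k. x k + h k) h
      = (cmod (herm n (a j) h))\<^sup>2 * (cmod (herm n (a j) ?v))\<^sup>2 + 2 * (ip n (a j) x h)\<^sup>2
        - 9 / 4 * ((cmod (herm n (a j) x))\<^sup>2 * (cmod (herm n (a j) h))\<^sup>2)" for j
    unfolding ip_def herm_add herm_scale cmod_power2
    by simp algebra
  have 1: "H * (H + 3 * s + 9 / 4 * X) + (H + 3 / 2 * s)\<^sup>2 - 2 * \<delta> * H * (H + 3 * s + 9 / 4 * X)
      \<le> avg m (\<lambda>j. (cmod (herm n (a j) h))\<^sup>2 * (cmod (herm n (a j) ?v))\<^sup>2)"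
    using lower_regular_product[OF low, of h ?v] unfolding nv hv H_def norm_of_real power2_abs .
  have 2: "X * H / 2 + 3 / 2 * s\<^sup>2 - \<delta> * X * H \<le> avg m (\<lambda>j. (ip n (a j) x h)\<^sup>2)"
    using low[unfolded lower_regular_def, rule_format, of x h]
    by (simp add: mom_def xh X_def H_def)
  have 3: "avg m (\<lambda>j. (cmod (herm n (a j) x))\<^sup>2 * (cmod (herm n (a j) h))\<^sup>2)
      \<le> X * H + s\<^sup>2 + 2 * \<delta> * X * H"
    using upper_regular_product[OF up, of h] unfolding xh X_def H_def norm_of_real power2_abs .
  have s_up: "s \<le> X"
  proof -
    have "s\<^sup>2 \<le> X\<^sup>2" using s2 XH mult_left_mono[of H X X] by (simp add: power2_eq_square)
    then show ?thesis using XH(1) power2_le_imp_le by blast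
  qed
  have main: "X * H + 3 * s\<^sup>2 + 6 * s * H + 2 * H\<^sup>2 \<ge> 6 / 7 * (X * H)"
  proof -
    have "3 * (s + H)\<^sup>2 \<ge> 0" by simp
    moreover have "7 * H\<^sup>2 \<le> X * H" using XH mult_right_mono[of "7 * H" X H] by (simp add: power2_eq_square)
    ultimately show ?thesis by (simp add: power2_eq_square algebra_simps)
  qed
  have "H * (H + 3 * s + 9 / 4 * X) \<le> 6 * (X * H)"
    using XH s_up mult_left_mono[of "H + 3 * s + 9 / 4 * X" "6 * X" H] by (simp add: algebra_simps)
  then have e: "2 * \<delta> * H * (H + 3 * s + 9 / 4 * X) + 13 / 2 * \<delta> * X * H \<le> 37 / 2 * \<delta> * (X * H)"
    using \<delta>(1) mult_left_mono[of "H * (H + 3 * s + 9 / 4 * X)" "6 * (X * H)" "2 * \<delta>"]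
    by (simp add: algebra_simps)
  have "37 / 2 * \<delta> * (X * H) \<le> 37 / 2 * (1 / 40) * (X * H)"
    using \<delta> XH by (intro mult_right_mono) auto
  have "X * H / 8 \<le> (H * (H + 3 * s + 9 / 4 * X) + (H + 3 / 2 * s)\<^sup>2 - 2 * \<delta> * H * (H + 3 * s + 9 / 4 * X))
     + 2 * (X * H / 2 + 3 / 2 * s\<^sup>2 - \<delta> * X * H) - 9 / 4 * (X * H + s\<^sup>2 + 2 * \<delta> * X * H)"
    using main e \<open>37 / 2 * \<delta> * (X * H) \<le> _\<close> mult_nonneg_nonneg[OF XH(1,2)]
    by (simp add: power2_eq_square algebra_simps)
  also have "\<dots> \<le> avg m (\<lambda>j. (cmod (herm n (a j) h))\<^sup>2 * (cmod (herm n (a j) ?v))\<^sup>2)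
     + 2 * avg m (\<lambda>j. (ip n (a j) x h)\<^sup>2)
     - 9 / 4 * avg m (\<lambda>j. (cmod (herm n (a j) x))\<^sup>2 * (cmod (herm n (a j) h))\<^sup>2)"
    by (intro diff_mono add_mono mult_left_mono 1 2 3) simp_all
  finally show ?thesis
    unfolding id avg_add avg_diff avg_cmult X_def H_def .
qed

text \<open>
  Here \<open>\<parallel>x\<parallel> = 1\<close>, \<open>Z = \<parallel>z\<parallel>\<^sup>2\<close>, \<open>r = x\<^sup>Hz\<close>, and the conclusion bounds \<open>\<parallel>z - x\<parallel>\<^sup>2\<close>. For \<open>\<delta> = 0\<close> the argument
  is short. The case \<open>\<beta> = 0\<close> gives \<open>r\<^sup>2 \<ge> 2Z\<^sup>2 - Z\<close> and the curvature condition gives \<open>r\<^sup>2 \<ge> 1 - Z\<close>; their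
  sum shows \<open>r\<^sup>2 \<ge> 1/4\<close>, which excludes the saddle points orthogonal to \<open>x\<close>. As \<open>\<beta>\<close> is arbitrary, its
  coefficient \<open>4r(Z - 1)\<close> must vanish, so \<open>Z = 1\<close>, and then \<open>r = 1\<close>. For \<open>\<delta> > 0\<close> it suffices to use
  \<open>\<beta> = \<plusminus>20\<close>.
\<close>

lemma population_landscape:
  fixes Z r :: real
  assumes curv: "2 * (Z + r\<^sup>2) + 4 * \<delta> * Z \<ge> 2 - \<delta>"
    and stat: "\<And>\<beta>. 2 * Z\<^sup>2 - Z - r\<^sup>2 + 4 * \<beta> * r * (Z - 1)
       \<le> \<delta> * (2 * (Z + 1) * (Z + 2 * \<beta> * r + \<beta>\<^sup>2) + \<beta>\<^sup>2 * (2 * Z + 1))"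
    and \<delta>: "\<delta> = 1 / 10000" and r: "0 \<le> r" "r\<^sup>2 \<le> Z"
  shows "Z + 1 - 2 * r \<le> 1 / 7"
proof -
  have Z0: "0 \<le> Z" using r(2) zero_le_power2[of r] by linarith
  have B: "2 * Z\<^sup>2 - Z - r\<^sup>2 \<le> 2 * \<delta> * (Z\<^sup>2 + Z)"
    using stat[of 0] by (simp add: power2_eq_square algebra_simps)
  have Z1: "Z \<le> 101 / 100"
  proof (rule ccontr)
    assume big: "\<not> ?thesis"
    then have "101 / 100 * Z < Z * Z" by (intro mult_strict_right_mono) auto
    moreover have "2 * (Z * Z) - Z - r\<^sup>2 \<le> (Z * Z) / 5000 + Z / 5000"
      using B unfolding \<delta> power2_eq_square[of Z] by (simp add: field_simps)
    ultimately show False using r(2) big by linarith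
  qed
  have ZZ: "Z\<^sup>2 \<le> 103 / 100" using Z0 Z1 power_mono[of Z "101/100" 2] by (simp add: power2_eq_square)
  have A: "r\<^sup>2 \<ge> 1 - Z - 3 * \<delta>" using curv Z1 unfolding \<delta> by argo
  have B': "r\<^sup>2 \<ge> 2 * Z\<^sup>2 - Z - 5 * \<delta>" using B ZZ Z1 unfolding \<delta> by argo
  have sq: "Z\<^sup>2 - Z + 1 / 4 \<ge> 0" "Z\<^sup>2 - 2 * Z + 1 \<ge> 0"
    using zero_le_power2[of "Z - 1/2"] zero_le_power2[of "Z - 1"] by (simp_all add: power2_diff power_divide)
  have "r\<^sup>2 \<ge> 2304 / 10000" using A B' sq unfolding \<delta> by argo
  then have "r\<^sup>2 \<ge> (48 / 100)\<^sup>2" by (simp add: power_divide)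
  then have r48: "r \<ge> 48 / 100" by (rule power2_le_imp_le) (rule r(1))
  have "r\<^sup>2 \<le> 10201 / 10000" using r(2) Z1 by argo
  then have "r\<^sup>2 \<le> (101 / 100)\<^sup>2" by (simp add: power_divide)
  then have r1: "r \<le> 101 / 100" by (rule power2_le_imp_le) simp
  have D: "Z + r\<^sup>2 - 2 * Z\<^sup>2 \<le> 1 / 2"
    using r(2) sq by argo
  have near: "\<bar>4 * 20 * r * (Z - 1)\<bar> \<le> 9 / 10"
  proof -
    have W: "2 * (Z + 1) * (Z + 2 * \<beta> * r + \<beta>\<^sup>2) + \<beta>\<^sup>2 * (2 * Z + 1) \<le> 4000" if "\<bar>\<beta>\<bar> = 20" for \<beta>
    proof -
      have b2: "\<beta>\<^sup>2 = 400" using power2_abs[of \<beta>] unfolding that by simp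
      have "2 * \<beta> * r \<le> 2 * 20 * r" using that r(1) by (intro mult_right_mono) auto
      then have "Z + 2 * \<beta> * r + \<beta>\<^sup>2 \<le> 442" using Z1 r1 b2 by linarith
      then have "2 * (Z + 1) * (Z + 2 * \<beta> * r + \<beta>\<^sup>2) \<le> 2 * (Z + 1) * 442"
        using Z0 by (intro mult_left_mono) auto
      then show ?thesis using Z1 unfolding b2 by simp
    qed
    have key: "4 * \<beta> * (r * (Z - 1)) \<le> 9 / 10" if "\<bar>\<beta>\<bar> = 20" for \<beta>
    proof -
      have "\<delta> * (2 * (Z + 1) * (Z + 2 * \<beta> * r + \<beta>\<^sup>2) + \<beta>\<^sup>2 * (2 * Z + 1)) \<le> \<delta> * 4000"
        using W[OF that] by (intro mult_left_mono) (simp_all add: \<delta>)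
      moreover define q where "q = 4 * \<beta> * r * (Z - 1)"
      ultimately have "2 * Z\<^sup>2 - Z - r\<^sup>2 + q \<le> 4 / 10"
        using stat[of \<beta>] unfolding \<delta> by linarith
      then have "q \<le> 9 / 10" using D by argo
      then show ?thesis unfolding q_def by (simp only: mult.assoc)
    qed
    have "4 * 20 * (r * (Z - 1)) \<le> 9 / 10" "4 * (- 20) * (r * (Z - 1)) \<le> 9 / 10"
      by (rule key, simp)+
    then show ?thesis unfolding mult.assoc abs_le_iff by linarith
  qed
  define e where "e = \<bar>Z - 1\<bar>"
  have "48 / 100 * e \<le> r * e" using r48 by (intro mult_right_mono) (auto simp: e_def)
  moreover have "4 * 20 * (r * e) \<le> 9 / 10" using near r(1) by (simp add: abs_mult mult.assoc e_def)
  ultimately have Zn: "\<bar>Z - 1\<bar> \<le> 3 / 100" unfolding e_def[symmetric] by linarith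
  then have "Z \<ge> 97 / 100" "Z \<le> 103 / 100" by linarith+
  then have "r\<^sup>2 \<ge> 9025 / 10000" using B' sq unfolding \<delta> by argo
  then have "r\<^sup>2 \<ge> (95 / 100)\<^sup>2" by (simp add: power_divide)
  then have "r \<ge> 95 / 100" by (rule power2_le_imp_le) (rule r(1))
  then show ?thesis using Zn by linarith
qed

text \<open>
  The hypotheses on \<open>z\<close> say that the gradient vanishes and that the sum of the second derivatives along
  \<open>x\<close> and \<open>\<i>x\<close> is nonnegative. Summing over these two directions replaces the square of a real part by
  that of a modulus. Dividing by powers of \<open>\<parallel>x\<parallel>\<^sup>2\<close> leads to \<open>population_landscape\<close>.
\<close>

lemma critical_point_near_solution:
  assumes low: "lower_regular n m a \<delta>" and up: "upper_regular n m a x \<delta>"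
    and \<delta>: "\<delta> = 1 / 10000"
    and real: "Im (herm n x z) = 0" "0 \<le> Re (herm n x z)" and pos: "0 < nsq n x"
    and stat: "\<And>v. avg m (\<lambda>j. ((cmod (herm n (a j) z))\<^sup>2 - (cmod (herm n (a j) x))\<^sup>2) * ip n (a j) z v) = 0"
    and curv: "avg m (\<lambda>j. (2 * (cmod (herm n (a j) z))\<^sup>2 - (cmod (herm n (a j) x))\<^sup>2) * (cmod (herm n (a j) x))\<^sup>2) \<ge> 0"
  shows "nsq n z + nsq n x - 2 * Re (herm n x z) \<le> nsq n x / 7"
proof -
  define X where "X = nsq n x"
  define Z where "Z = nsq n z / X"
  define r where "r = Re (herm n x z) / X"
  have X: "X > 0" using pos by (simp add: X_def)
  have nz: "nsq n z = X * Z" using X by (simp add: Z_def)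
  have xz: "herm n x z = complex_of_real (X * r)"
    using real X by (simp add: complex_eq_iff r_def)
  have zx: "herm n z x = complex_of_real (X * r)"
    using herm_commute[of n z x] by (simp add: xz)
  have r2: "r\<^sup>2 \<le> Z"
  proof -
    have "X\<^sup>2 * r\<^sup>2 \<le> X\<^sup>2 * Z"
      using cmod_herm_le[of n x z] unfolding xz norm_of_real power2_abs nz X_def[symmetric]
      by (simp add: power2_eq_square algebra_simps)
    then show ?thesis using X by simp
  qed
  define Ax Az where "Ax = (\<lambda>j. (cmod (herm n (a j) x))\<^sup>2)" and "Az = (\<lambda>j. (cmod (herm n (a j) z))\<^sup>2)"
  have xx: "avg m (\<lambda>j. Ax j * Ax j) \<ge> X\<^sup>2 * (2 - \<delta>)"
  proof -
    have "Ax j = ip n (a j) x x" for j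
      by (simp add: Ax_def ip_def cmod_power2 power2_eq_square[of "Re _"] power2_eq_square[of "Im _"])
    then have "Ax j * Ax j = (ip n (a j) x x)\<^sup>2" for j
      by (simp add: power2_eq_square)
    then show ?thesis
      using low[unfolded lower_regular_def, rule_format, of x x]
      by (simp add: mom_def herm_self X_def[symmetric] power2_eq_square algebra_simps)
  qed
  have xzu: "avg m (\<lambda>j. Ax j * Az j) \<le> X\<^sup>2 * (Z + r\<^sup>2 + 2 * \<delta> * Z)"
    using upper_regular_product[OF up, of z]
    unfolding xz norm_of_real power2_abs nz X_def[symmetric] Ax_def Az_def
    by (simp add: power2_eq_square algebra_simps)
  have curv': "avg m (\<lambda>j. Ax j * Ax j) \<le> 2 * avg m (\<lambda>j. Ax j * Az j)"
  proof -
    have "(2 * (cmod (herm n (a j) z))\<^sup>2 - (cmod (herm n (a j) x))\<^sup>2) * (cmod (herm n (a j) x))\<^sup>2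
       = 2 * (Ax j * Az j) - Ax j * Ax j" for j
      by (simp add: Ax_def Az_def algebra_simps)
    then show ?thesis using curv by (simp add: avg_diff avg_cmult)
  qed
  have "X\<^sup>2 * (2 - \<delta>) \<le> X\<^sup>2 * (2 * (Z + r\<^sup>2) + 4 * \<delta> * Z)"
    using xx curv' xzu by (simp add: algebra_simps)
  then have curv1: "2 * (Z + r\<^sup>2) + 4 * \<delta> * Z \<ge> 2 - \<delta>" using X by simp
  have stat1: "2 * Z\<^sup>2 - Z - r\<^sup>2 + 4 * \<beta> * r * (Z - 1)
       \<le> \<delta> * (2 * (Z + 1) * (Z + 2 * \<beta> * r + \<beta>\<^sup>2) + \<beta>\<^sup>2 * (2 * Z + 1))" for \<beta>
  proof -
    let ?w = "\<lambda>k. z k + of_real \<beta> * x k"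
    define W where "W = Z + 2 * \<beta> * r + \<beta>\<^sup>2"
    have nw: "nsq n ?w = X * W"
      unfolding nsq_add nsq_scale herm_scale zx nz by (simp add: W_def X_def algebra_simps)
    have zw: "herm n z ?w = complex_of_real (X * (Z + \<beta> * r))"
      unfolding herm_add herm_scale zx herm_self nz by (simp add: algebra_simps)
    have xw: "herm n x ?w = complex_of_real (X * (r + \<beta>))"
      unfolding herm_add herm_scale xz herm_self X_def[symmetric] by (simp add: algebra_simps)
    define Aw where "Aw = (\<lambda>j. (cmod (herm n (a j) ?w))\<^sup>2)"
    have lo: "X\<^sup>2 * (Z * W + (Z + \<beta> * r)\<^sup>2 - 2 * \<delta> * Z * W) \<le> avg m (\<lambda>j. Az j * Aw j)"
      using lower_regular_product[OF low, of z ?w]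
      unfolding zw norm_of_real power2_abs nz nw Aw_def Az_def
      by (simp add: power2_eq_square algebra_simps)
    have hi: "avg m (\<lambda>j. Ax j * Aw j) \<le> X\<^sup>2 * (W + (r + \<beta>)\<^sup>2 + 2 * \<delta> * W)"
      using upper_regular_product[OF up, of ?w]
      unfolding xw norm_of_real power2_abs nw X_def[symmetric] Aw_def Ax_def
      by (simp add: power2_eq_square algebra_simps)
    (* Expanding |a w|^2 exhibits the terms that stationarity in the directions z and x removes. *)
    have split: "Az j * Aw j - Ax j * Aw j
        = (Az j - Ax j) * ip n (a j) z z + 2 * \<beta> * ((Az j - Ax j) * ip n (a j) z x)
          + \<beta>\<^sup>2 * (Ax j * Az j - Ax j * Ax j)" for j
      unfolding Aw_def Ax_def Az_def ip_def herm_add herm_scale cmod_power2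
      by simp algebra
    have stat': "avg m (\<lambda>j. (Az j - Ax j) * ip n (a j) z v) = 0" for v
      using stat[of v] by (simp add: Ax_def Az_def)
    have "avg m (\<lambda>j. Az j * Aw j) - avg m (\<lambda>j. Ax j * Aw j)
      = avg m (\<lambda>j. Az j * Aw j - Ax j * Aw j)" by (rule avg_diff[symmetric])
    also have "\<dots> = \<beta>\<^sup>2 * (avg m (\<lambda>j. Ax j * Az j) - avg m (\<lambda>j. Ax j * Ax j))"
      unfolding split avg_add avg_cmult stat' avg_diff[of m "\<lambda>j. Ax j * Az j"] by simp
    also have "\<dots> \<le> \<beta>\<^sup>2 * (X\<^sup>2 * (Z + r\<^sup>2 + 2 * \<delta> * Z) - X\<^sup>2 * (2 - \<delta>))"
      using xzu xx by (intro mult_left_mono) auto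
    finally have "X\<^sup>2 * (Z * W + (Z + \<beta> * r)\<^sup>2 - 2 * \<delta> * Z * W)
       \<le> X\<^sup>2 * (W + (r + \<beta>)\<^sup>2 + 2 * \<delta> * W)
         + \<beta>\<^sup>2 * (X\<^sup>2 * (Z + r\<^sup>2 + 2 * \<delta> * Z) - X\<^sup>2 * (2 - \<delta>))"
      using lo hi by argo
    also have "\<dots> = X\<^sup>2 * (W + (r + \<beta>)\<^sup>2 + 2 * \<delta> * W + \<beta>\<^sup>2 * ((Z + r\<^sup>2 + 2 * \<delta> * Z) - (2 - \<delta>)))"
      by (simp add: ring_distribs)
    finally have "Z * W + (Z + \<beta> * r)\<^sup>2 - 2 * \<delta> * Z * W
       \<le> W + (r + \<beta>)\<^sup>2 + 2 * \<delta> * W + \<beta>\<^sup>2 * ((Z + r\<^sup>2 + 2 * \<delta> * Z) - (2 - \<delta>))"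
      using X by (simp only: mult_le_cancel_left_pos zero_less_power)
    moreover have "\<delta> * (2 * (Z + 1) * W + \<beta>\<^sup>2 * (2 * Z + 1)) - (2 * Z\<^sup>2 - Z - r\<^sup>2 + 4 * \<beta> * r * (Z - 1))
      = (W + (r + \<beta>)\<^sup>2 + 2 * \<delta> * W + \<beta>\<^sup>2 * ((Z + r\<^sup>2 + 2 * \<delta> * Z) - (2 - \<delta>)))
        - (Z * W + (Z + \<beta> * r)\<^sup>2 - 2 * \<delta> * Z * W)"
      unfolding W_def by algebra
    ultimately show ?thesis unfolding W_def[symmetric] by argo
  qed
  have "Z + 1 - 2 * r \<le> 1 / 7"
    using population_landscape[OF curv1 stat1 \<delta> _ r2] real X by (simp add: r_def)
  then have "X * (Z + 1 - 2 * r) \<le> X * (1 / 7)" using X by (intro mult_left_mono) auto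
  then show ?thesis unfolding nz xz X_def[symmetric] by (simp add: algebra_simps)
qed

section \<open>Derivatives of the loss and the deterministic theorem\<close>

text \<open>
  The image of the \<open>i\<close>-th unit vector of the real parameter space under \<open>(x, y) \<mapsto> a\<^sup>H(x + \<i>y)\<close>.
\<close>

definition coord_row :: "nat \<Rightarrow> (nat \<Rightarrow> complex) \<Rightarrow> nat \<Rightarrow> complex" where
  "coord_row n a i = (if i < n then cnj (a i) else \<i> * cnj (a (i - n)))"

lemma sum_lessThan_double:
  "(\<Sum>i<2 * n. f i) = (\<Sum>i<n. f i) + (\<Sum>i<n. f (n + i))" for f :: "nat \<Rightarrow> 'a::comm_monoid_add"
proof -
  have "(\<Sum>i<n + k. f i) = (\<Sum>i<n. f i) + (\<Sum>i<k. f (n + i))" for k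
    by (induction k) (simp_all add: add.assoc)
  from this[of n] show ?thesis by (simp add: mult_2)
qed

lemma herm_to_complex:
  "herm n a (to_complex n w) = (\<Sum>i<2 * n. of_real (w i) * coord_row n a i)"
  unfolding sum_lessThan_double herm_def sum.distrib[symmetric]
  by (intro sum.cong refl) (simp add: to_complex_def coord_row_def complex_eq_iff algebra_simps)

text \<open>
  Moving one real coordinate moves \<open>a\<^sup>Hz\<close> along a line, so the loss is an explicit polynomial in that
  coordinate.
\<close>

lemma herm_to_complex_upd:
  assumes "i < 2 * n"
  shows "herm n a (to_complex n (w(i := t)))
    = herm n a (to_complex n w) + of_real (t - w i) * coord_row n a i"
proof -
  have "(\<Sum>k<2 * n. of_real ((w(i := t)) k) * coord_row n a k)
      = (\<Sum>k<2 * n. of_real (w k) * coord_row n a k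
           + (if k = i then of_real (t - w i) * coord_row n a i else 0))"
    by (intro sum.cong) (auto simp: algebra_simps)
  then show ?thesis using assms by (simp add: herm_to_complex sum.distrib)
qed

lemma partial_deriv_phase_loss:
  assumes "i < 2 * n"
  shows "partial_deriv i (phase_loss n m a b) w
    = 2 * avg m (\<lambda>j. ((cmod (herm n (a j) (to_complex n w)))\<^sup>2 - (b j)\<^sup>2)
          * Re (cnj (herm n (a j) (to_complex n w)) * coord_row n (a j) i))"
proof -
  define u where "u j = herm n (a j) (to_complex n w)" for j
  define \<kappa> where "\<kappa> j = coord_row n (a j) i" for j
  have eq: "(\<lambda>t. phase_loss n m a b (w(i := t)))
      = (\<lambda>t. 1 / (2 * real m) * (\<Sum>j<m. ((Re (u j) + (t - w i) * Re (\<kappa> j))\<^sup>2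
            + (Im (u j) + (t - w i) * Im (\<kappa> j))\<^sup>2 - (b j)\<^sup>2)\<^sup>2))"
    unfolding phase_loss_def herm_to_complex_upd[OF assms] u_def[symmetric] \<kappa>_def[symmetric]
    by (simp add: cmod_power2)
  have "((\<lambda>t. ((Re (u j) + (t - w i) * Re (\<kappa> j))\<^sup>2
            + (Im (u j) + (t - w i) * Im (\<kappa> j))\<^sup>2 - (b j)\<^sup>2)\<^sup>2) has_real_derivative
        4 * (((cmod (u j))\<^sup>2 - (b j)\<^sup>2) * Re (cnj (u j) * \<kappa> j))) (at (w i))" for j
    by (auto intro!: derivative_eq_intros simp: cmod_power2 algebra_simps)
  then have "((\<lambda>t. phase_loss n m a b (w(i := t))) has_real_derivative
      1 / (2 * real m) * (\<Sum>j<m. 4 * (((cmod (u j))\<^sup>2 - (b j)\<^sup>2) * Re (cnj (u j) * \<kappa> j)))) (at (w i))"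
    unfolding eq by (intro DERIV_cmult DERIV_sum)
  then have "partial_deriv i (phase_loss n m a b) w
     = 1 / (2 * real m) * (\<Sum>j<m. 4 * (((cmod (u j))\<^sup>2 - (b j)\<^sup>2) * Re (cnj (u j) * \<kappa> j)))"
    unfolding partial_deriv_def by (rule DERIV_imp_deriv)
  also have "\<dots> = 2 * avg m (\<lambda>j. ((cmod (u j))\<^sup>2 - (b j)\<^sup>2) * Re (cnj (u j) * \<kappa> j))"
    by (simp add: avg_def sum_distrib_left[symmetric])
  finally show ?thesis by (simp add: u_def \<kappa>_def)
qed

lemma hess_phase_loss:
  assumes "i < 2 * n" "k < 2 * n"
  shows "hess (phase_loss n m a b) w i k
    = 2 * avg m (\<lambda>j. 2 * (Re (cnj (herm n (a j) (to_complex n w)) * coord_row n (a j) i)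
            * Re (cnj (herm n (a j) (to_complex n w)) * coord_row n (a j) k))
          + ((cmod (herm n (a j) (to_complex n w)))\<^sup>2 - (b j)\<^sup>2)
            * Re (cnj (coord_row n (a j) i) * coord_row n (a j) k))"
proof -
  define u where "u j = herm n (a j) (to_complex n w)" for j
  define \<kappa> where "\<kappa> j = coord_row n (a j)" for j
  have "partial_deriv k (phase_loss n m a b)
    = (\<lambda>w. 2 * avg m (\<lambda>j. ((cmod (herm n (a j) (to_complex n w)))\<^sup>2 - (b j)\<^sup>2)
          * Re (cnj (herm n (a j) (to_complex n w)) * coord_row n (a j) k)))"
    using assms(2) by (intro ext partial_deriv_phase_loss)
  then have eq: "(\<lambda>t. partial_deriv k (phase_loss n m a b) (w(i := t)))
      = (\<lambda>t. 2 / real m * (\<Sum>j<m. ((Re (u j) + (t - w i) * Re (\<kappa> j i))\<^sup>2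
            + (Im (u j) + (t - w i) * Im (\<kappa> j i))\<^sup>2 - (b j)\<^sup>2)
          * ((Re (u j) + (t - w i) * Re (\<kappa> j i)) * Re (\<kappa> j k)
            + (Im (u j) + (t - w i) * Im (\<kappa> j i)) * Im (\<kappa> j k))))"
    unfolding avg_def herm_to_complex_upd[OF assms(1)] u_def[symmetric] \<kappa>_def[symmetric]
    by (simp add: cmod_power2 herm_to_complex_upd[OF assms(1)] u_def[symmetric] \<kappa>_def[symmetric])
  have "((\<lambda>t. ((Re (u j) + (t - w i) * Re (\<kappa> j i))\<^sup>2
            + (Im (u j) + (t - w i) * Im (\<kappa> j i))\<^sup>2 - (b j)\<^sup>2)
          * ((Re (u j) + (t - w i) * Re (\<kappa> j i)) * Re (\<kappa> j k)
            + (Im (u j) + (t - w i) * Im (\<kappa> j i)) * Im (\<kappa> j k))) has_real_derivative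
        2 * (Re (cnj (u j) * \<kappa> j i) * Re (cnj (u j) * \<kappa> j k))
          + ((cmod (u j))\<^sup>2 - (b j)\<^sup>2) * Re (cnj (\<kappa> j i) * \<kappa> j k)) (at (w i))" for j
    by (auto intro!: derivative_eq_intros simp: cmod_power2 algebra_simps)
  then have "((\<lambda>t. partial_deriv k (phase_loss n m a b) (w(i := t))) has_real_derivative
      2 / real m * (\<Sum>j<m. 2 * (Re (cnj (u j) * \<kappa> j i) * Re (cnj (u j) * \<kappa> j k))
          + ((cmod (u j))\<^sup>2 - (b j)\<^sup>2) * Re (cnj (\<kappa> j i) * \<kappa> j k))) (at (w i))"
    unfolding eq by (intro DERIV_cmult DERIV_sum)
  then have "hess (phase_loss n m a b) w i k
     = 2 / real m * (\<Sum>j<m. 2 * (Re (cnj (u j) * \<kappa> j i) * Re (cnj (u j) * \<kappa> j k))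
          + ((cmod (u j))\<^sup>2 - (b j)\<^sup>2) * Re (cnj (\<kappa> j i) * \<kappa> j k))"
    unfolding hess_def partial_deriv_def[of i] by (rule DERIV_imp_deriv)
  then show ?thesis by (simp add: avg_def u_def \<kappa>_def)
qed

lemma sum_avg: "(\<Sum>i\<in>I. avg m (g i)) = avg m (\<lambda>j. \<Sum>i\<in>I. g i j)"
  unfolding avg_def sum_divide_distrib[symmetric] by (simp add: sum.swap[of _ I])

lemma ip_to_complex:
  "ip n a z (to_complex n v) = (\<Sum>i<2 * n. v i * Re (cnj (herm n a z) * coord_row n a i))"
  unfolding ip_def herm_to_complex sum_distrib_left Re_sum
  by (intro sum.cong) (simp_all add: algebra_simps)

lemma directional_derivative:
  "(\<Sum>i<2 * n. v i * grad (2 * n) (phase_loss n m a b) w i)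
    = 2 * avg m (\<lambda>j. ((cmod (herm n (a j) (to_complex n w)))\<^sup>2 - (b j)\<^sup>2)
         * ip n (a j) (to_complex n w) (to_complex n v))"
proof -
  have "(\<Sum>i<2 * n. v i * grad (2 * n) (phase_loss n m a b) w i)
    = (\<Sum>i<2 * n. 2 * avg m (\<lambda>j. v i * (((cmod (herm n (a j) (to_complex n w)))\<^sup>2 - (b j)\<^sup>2)
         * Re (cnj (herm n (a j) (to_complex n w)) * coord_row n (a j) i))))"
    by (intro sum.cong) (simp_all add: grad_def partial_deriv_phase_loss avg_cmult del: times_complex.sel)
  also have "\<dots> = 2 * avg m (\<lambda>j. \<Sum>i<2 * n. v i * (((cmod (herm n (a j) (to_complex n w)))\<^sup>2 - (b j)\<^sup>2)
         * Re (cnj (herm n (a j) (to_complex n w)) * coord_row n (a j) i)))"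
    unfolding sum_distrib_left[symmetric] sum_avg ..
  also have "(\<lambda>j. \<Sum>i<2 * n. v i * (((cmod (herm n (a j) (to_complex n w)))\<^sup>2 - (b j)\<^sup>2)
         * Re (cnj (herm n (a j) (to_complex n w)) * coord_row n (a j) i)))
    = (\<lambda>j. ((cmod (herm n (a j) (to_complex n w)))\<^sup>2 - (b j)\<^sup>2)
         * ip n (a j) (to_complex n w) (to_complex n v))"
    unfolding ip_to_complex sum_distrib_left by (simp only: mult.left_commute)
  finally show ?thesis .
qed

text \<open>
  The Hessian contributes a square and a term weighted by the residual. At points of the orbit the
  residuals vanish and only the square remains.
\<close>

lemma hessian_form:
  "(\<Sum>i<2 * n. \<Sum>k<2 * n. v i * hess (phase_loss n m a b) w i k * v k)
    = 2 * avg m (\<lambda>j. 2 * (ip n (a j) (to_complex n w) (to_complex n v))\<^sup>2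
         + ((cmod (herm n (a j) (to_complex n w)))\<^sup>2 - (b j)\<^sup>2)
           * (cmod (herm n (a j) (to_complex n v)))\<^sup>2)"
proof -
  define u where "u j = herm n (a j) (to_complex n w)" for j
  define p where "p j i = Re (cnj (u j) * coord_row n (a j) i)" for j i
  define c where "c j = (cmod (u j))\<^sup>2 - (b j)\<^sup>2" for j
  have "(\<Sum>i<2 * n. \<Sum>k<2 * n. v i * hess (phase_loss n m a b) w i k * v k)
    = (\<Sum>i<2 * n. \<Sum>k<2 * n. 2 * avg m (\<lambda>j. v i * v k * (2 * (p j i * p j k)
          + c j * Re (cnj (coord_row n (a j) i) * coord_row n (a j) k))))"
    unfolding avg_cmult
    by (intro sum.cong) (simp_all add: hess_phase_loss u_def p_def c_def del: times_complex.sel)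
  also have "\<dots> = 2 * avg m (\<lambda>j. \<Sum>i<2 * n. \<Sum>k<2 * n. v i * v k * (2 * (p j i * p j k)
          + c j * Re (cnj (coord_row n (a j) i) * coord_row n (a j) k)))"
    unfolding sum_distrib_left[symmetric] sum_avg ..
  also have "(\<lambda>j. \<Sum>i<2 * n. \<Sum>k<2 * n. v i * v k * (2 * (p j i * p j k)
          + c j * Re (cnj (coord_row n (a j) i) * coord_row n (a j) k)))
    = (\<lambda>j. 2 * (ip n (a j) (to_complex n w) (to_complex n v))\<^sup>2
         + c j * (cmod (herm n (a j) (to_complex n v)))\<^sup>2)"
  proof
    fix j
    have 1: "(ip n (a j) (to_complex n w) (to_complex n v))\<^sup>2
       = (\<Sum>i<2 * n. \<Sum>k<2 * n. v i * v k * (p j i * p j k))"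
      unfolding ip_to_complex power2_eq_square sum_product u_def[symmetric] p_def[symmetric]
      by (simp add: algebra_simps)
    have "(cmod (herm n (a j) (to_complex n v)))\<^sup>2
       = Re (cnj (herm n (a j) (to_complex n v)) * herm n (a j) (to_complex n v))"
      by (simp add: cmod_power2 power2_eq_square[of "Re _"] power2_eq_square[of "Im _"])
    also have "\<dots> = (\<Sum>i<2 * n. \<Sum>k<2 * n. v i * v k * Re (cnj (coord_row n (a j) i) * coord_row n (a j) k))"
      unfolding herm_to_complex cnj_sum sum_product Re_sum
      by (intro sum.cong) (simp_all add: algebra_simps)
    finally have 2: "(cmod (herm n (a j) (to_complex n v)))\<^sup>2
      = (\<Sum>i<2 * n. \<Sum>k<2 * n. v i * v k * Re (cnj (coord_row n (a j) i) * coord_row n (a j) k))" .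
    show "(\<Sum>i<2 * n. \<Sum>k<2 * n. v i * v k * (2 * (p j i * p j k)
          + c j * Re (cnj (coord_row n (a j) i) * coord_row n (a j) k)))
       = 2 * (ip n (a j) (to_complex n w) (to_complex n v))\<^sup>2
         + c j * (cmod (herm n (a j) (to_complex n v)))\<^sup>2"
      unfolding 1 2 sum_distrib_left sum.distrib[symmetric]
      by (intro sum.cong refl) (simp only: ring_distribs ac_simps)
  qed
  finally show ?thesis by (simp add: c_def u_def)
qed

lemma hess_phase_loss_sym:
  "i < 2 * n \<Longrightarrow> k < 2 * n \<Longrightarrow> hess (phase_loss n m a b) w i k = hess (phase_loss n m a b) w k i"
  by (simp add: hess_phase_loss mult.commute)

lemma herm_cong: "(\<And>k. k < n \<Longrightarrow> z k = w k) \<Longrightarrow> herm n a z = herm n a w"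
  by (simp add: herm_def)

lemma nsq_cong: "(\<And>k. k < n \<Longrightarrow> z k = w k) \<Longrightarrow> nsq n z = nsq n w"
  by (simp add: nsq_def)

lemma to_complex_stack:
  "k < n \<Longrightarrow> to_complex n (stack n x y) k = Complex (x k) (y k)"
  by (simp add: to_complex_def stack_def)

lemma L2_set_to_complex: "(L2_set v {..<2 * n})\<^sup>2 = nsq n (to_complex n v)"
proof -
  have "(L2_set v {..<2 * n})\<^sup>2 = (\<Sum>i<2 * n. (v i)\<^sup>2)"
    by (simp add: L2_set_def sum_nonneg)
  then show ?thesis
    unfolding sum_lessThan_double nsq_def sum.distrib[symmetric]
    by (auto simp: to_complex_def cmod_power2 intro!: sum.cong)
qed

definition orbit_point :: "nat \<Rightarrow> (nat \<Rightarrow> complex) \<Rightarrow> real \<Rightarrow> (nat \<Rightarrow> real)" where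
  "orbit_point n z \<phi> = stack n (\<lambda>k. Re (z k) * cos \<phi> - Im (z k) * sin \<phi>)
                  (\<lambda>k. Re (z k) * sin \<phi> + Im (z k) * cos \<phi>)"

lemma solution_set_eq: "solution_set n z = orbit_point n z ` {0..<2 * pi}"
  by (simp add: solution_set_def orbit_point_def)

lemma to_complex_orbit_point: "k < n \<Longrightarrow> to_complex n (orbit_point n z \<phi>) k = cis \<phi> * z k"
  by (simp add: orbit_point_def to_complex_stack complex_eq_iff algebra_simps)

lemma dist_orbit_point:
  "L2_set (\<lambda>i. w i - orbit_point n x \<phi> i) {..<2 * n}
     = sqrt (nsq n (\<lambda>k. to_complex n w k - cis \<phi> * x k))"
proof -
  have "nsq n (to_complex n (\<lambda>i. w i - orbit_point n x \<phi> i))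
     = nsq n (\<lambda>k. to_complex n w k - to_complex n (orbit_point n x \<phi>) k)"
    by (rule nsq_cong) (simp add: to_complex_def complex_eq_iff)
  also have "\<dots> = nsq n (\<lambda>k. to_complex n w k - cis \<phi> * x k)"
    by (rule nsq_cong) (simp add: to_complex_orbit_point)
  finally show ?thesis
    by (metis L2_set_to_complex L2_set_nonneg real_sqrt_unique)
qed

text \<open>
  The squared distance from \<open>z\<close> to \<open>e\<^sup>i\<^sup>\<phi>x\<close> is \<open>\<parallel>z\<parallel>\<^sup>2 + \<parallel>x\<parallel>\<^sup>2\<close> minus twice the real part of
  \<open>cnj (e\<^sup>i\<^sup>\<phi>) x\<^sup>Hz\<close>. It is smallest when \<open>\<phi>\<close> is the argument of \<open>x\<^sup>Hz\<close>, and then the Hermitian product with the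
  nearest point is real and nonnegative.
\<close>

lemma nearest_orbit_point:
  obtains \<phi> where "\<phi> \<in> {0..<2 * pi}"
    "herm n (\<lambda>k. cis \<phi> * x k) z = complex_of_real (cmod (herm n x z))"
    "\<And>w. to_complex n w = z \<Longrightarrow> dist_to_set (2 * n) w (solution_set n x)
        = sqrt (nsq n (\<lambda>k. z k - cis \<phi> * x k))"
proof -
  define c where "c = herm n x z"
  define \<phi> where "\<phi> = Arg2pi c"
  have \<phi>: "\<phi> \<in> {0..<2 * pi}" using Arg2pi[of c] by (simp add: \<phi>_def)
  have c: "c = of_real (cmod c) * cis \<phi>"
    using Arg2pi[of c] by (simp add: \<phi>_def cis_conv_exp is_Arg_def)
  have her: "herm n (\<lambda>k. cis \<phi> * x k) z = complex_of_real (cmod c)"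
    unfolding herm_scale_left c_def[symmetric] by (subst c) (simp add: cis_cnj cis_mult)
  have d: "nsq n (\<lambda>k. z k - cis \<psi> * x k) = nsq n z + nsq n x - 2 * Re (cnj (cis \<psi>) * c)" for \<psi>
    using herm_commute[of n z "\<lambda>k. cis \<psi> * x k"]
    by (simp add: nsq_diff nsq_rotate herm_scale_left c_def)
  have le: "nsq n (\<lambda>k. z k - cis \<phi> * x k) \<le> nsq n (\<lambda>k. z k - cis \<psi> * x k)" for \<psi>
  proof -
    have "Re (cnj (cis \<psi>) * c) \<le> cmod (cnj (cis \<psi>) * c)" by (rule complex_Re_le_cmod)
    also have "\<dots> = Re (cnj (cis \<phi>) * c)"
      using her by (simp add: norm_mult herm_scale_left c_def)
    finally show ?thesis unfolding d by simp
  qed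
  have "dist_to_set (2 * n) w (solution_set n x) = sqrt (nsq n (\<lambda>k. z k - cis \<phi> * x k))"
    if "to_complex n w = z" for w
    unfolding dist_to_set_def solution_set_eq image_image dist_orbit_point that
    using \<phi> le by (intro cInf_eq_minimum) auto
  with \<phi> her show thesis by (intro that[of \<phi>]) (simp_all add: c_def)
qed

lemma orbit_point_in_vecs: "orbit_point n z \<phi> \<in> vecs (2 * n)"
  by (auto simp: orbit_point_def stack_def vecs_def)

lemma ext_vecs: "v \<in> vecs d \<Longrightarrow> w \<in> vecs d \<Longrightarrow> (\<And>i. i < d \<Longrightarrow> v i = w i) \<Longrightarrow> v = w"
  unfolding vecs_def by (rule PiE_ext) auto

text \<open>
  All residuals vanish on the orbit, hence so does the gradient, and the Hessian is a sum of squares.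
\<close>

lemma orbit_points_are_critical:
  "solution_set n x \<subseteq> second_order_critical_points (2 * n)
      (phase_loss n m a (\<lambda>j. cmod (herm n (a j) x)))"
proof
  fix w assume "w \<in> solution_set n x"
  then obtain \<phi> where w: "w = orbit_point n x \<phi>" by (auto simp: solution_set_eq)
  have fit: "(cmod (herm n a (to_complex n w)))\<^sup>2 - (cmod (herm n a x))\<^sup>2 = 0" for a
    using herm_cong[of n "to_complex n w" "\<lambda>k. cis \<phi> * x k" a]
    by (simp add: w to_complex_orbit_point herm_scale norm_mult)
  let ?f = "phase_loss n m a (\<lambda>j. cmod (herm n (a j) x))"
  have "grad (2 * n) ?f w i = 0" if "i < 2 * n" for i
    using that by (simp add: grad_def partial_deriv_phase_loss fit avg_def)
  moreover have "psd (2 * n) (hess ?f w)"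
    unfolding psd_def hessian_form fit
    by (auto simp: hess_phase_loss_sym avg_def intro!: divide_nonneg_nonneg sum_nonneg)
  ultimately show "w \<in> second_order_critical_points (2 * n) ?f"
    by (simp add: second_order_critical_points_def w orbit_point_in_vecs)
qed

text \<open>
  By Cauchy-Schwarz the norm of the gradient is at least the directional derivative along \<open>h\<close> divided
  by \<open>\<parallel>h\<parallel>\<close>, where \<open>h\<close> is the difference to the nearest point of the orbit. The condition that \<open>x\<^sup>Hh\<close> is
  real is what the choice of the nearest point provides.
\<close>

lemma error_bound_near_orbit:
  assumes low: "lower_regular n m a \<delta>" and up: "upper_regular n m a x \<delta>"
    and \<delta>: "0 \<le> \<delta>" "\<delta> \<le> 1 / 40" and x: "0 < nsq n x"
    and near: "dist_to_set (2 * n) w (solution_set n x) \<le> 1 / sqrt 7 * cnorm n x"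
  shows "dist_to_set (2 * n) w (solution_set n x)
     \<le> 4 / (cnorm n x)\<^sup>2 * L2_set (grad (2 * n) (phase_loss n m a (\<lambda>j. cmod (herm n (a j) x))) w) {..<2 * n}"
proof -
  define z where "z = to_complex n w"
  obtain \<phi> where \<phi>: "herm n (\<lambda>k. cis \<phi> * x k) z = complex_of_real (cmod (herm n x z))"
    and dist: "dist_to_set (2 * n) w (solution_set n x) = sqrt (nsq n (\<lambda>k. z k - cis \<phi> * x k))"
    by (rule nearest_orbit_point[of n x z]) (auto simp: z_def)
  let ?f = "phase_loss n m a (\<lambda>j. cmod (herm n (a j) x))"
  let ?x = "\<lambda>k. cis \<phi> * x k"
  define h where "h = (\<lambda>k. z k - cis \<phi> * x k)"
  define X where "X = nsq n x"
  define D where "D = sqrt (nsq n h)"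
  define G where "G = L2_set (grad (2 * n) ?f w) {..<2 * n}"
  have X: "X > 0" "nsq n ?x = X" using x by (simp_all add: X_def nsq_rotate)
  have DD: "dist_to_set (2 * n) w (solution_set n x) = D" using dist by (simp add: D_def h_def)
  have D2: "nsq n h = D\<^sup>2" by (simp add: D_def)
  have D0: "D \<ge> 0" by (simp add: D_def)
  have small: "7 * nsq n h \<le> X"
  proof -
    have "D\<^sup>2 \<le> (1 / sqrt 7 * cnorm n x)\<^sup>2" using near DD D0 by (intro power_mono) auto
    then show ?thesis unfolding D2 by (simp add: power_mult_distrib power_divide cnorm_eq X_def)
  qed
  have real: "Im (herm n ?x h) = 0"
    unfolding h_def herm_diff \<phi> herm_self by simp
  have zh: "(\<lambda>k. cis \<phi> * x k + h k) = z" by (simp add: h_def fun_eq_iff)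
  have xcm: "cmod (herm n (a j) ?x) = cmod (herm n (a j) x)" for j
    by (simp add: herm_scale norm_mult)
  have lb: "X * D\<^sup>2 / 8 \<le> avg m (\<lambda>j. ((cmod (herm n (a j) z))\<^sup>2 - (cmod (herm n (a j) x))\<^sup>2) * ip n (a j) z h)"
    using local_gradient_bound[OF low upper_regular_rotate[OF up, of "cis \<phi>"] \<delta> real]
      small unfolding zh xcm X D2 by simp
  define v where "v i = w i - orbit_point n x \<phi> i" for i
  have tv: "herm n a (to_complex n v) = herm n a h" for a
    by (rule herm_cong) (simp add: v_def h_def z_def to_complex_orbit_point[symmetric],
        simp add: to_complex_def complex_eq_iff v_def)
  have "2 * (X * D\<^sup>2 / 8) \<le> (\<Sum>i<2 * n. v i * grad (2 * n) ?f w i)"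
    using lb unfolding directional_derivative z_def[symmetric] ip_def tv by simp
  also have "\<dots> \<le> (\<Sum>i<2 * n. \<bar>v i\<bar> * \<bar>grad (2 * n) ?f w i\<bar>)"
    by (intro sum_mono) (metis abs_ge_self abs_mult)
  also have "\<dots> \<le> L2_set v {..<2 * n} * G" unfolding G_def by (rule L2_set_mult_ineq)
  also have "L2_set v {..<2 * n} = D"
    unfolding v_def dist_orbit_point D_def h_def z_def ..
  finally have fin: "X * D\<^sup>2 / 4 \<le> D * G" by simp
  have "D \<le> 4 / X * G"
  proof (cases "D = 0")
    case True
    then show ?thesis using X by (simp add: G_def L2_set_nonneg)
  next
    case False
    then have "D > 0" using D0 by simp
    have "D * (X * D) \<le> D * (4 * G)" using fin by (simp add: power2_eq_square algebra_simps)
    then have "X * D \<le> 4 * G" using \<open>D > 0\<close> by simp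
    then show ?thesis using X by (simp add: field_simps)
  qed
  then show ?thesis unfolding DD G_def[symmetric] by (simp add: cnorm_eq X_def)
qed

lemma dist_zero_imp_in_solution_set:
  assumes "w \<in> vecs (2 * n)" "dist_to_set (2 * n) w (solution_set n x) \<le> 0"
  shows "w \<in> solution_set n x"
proof -
  obtain \<phi> where \<phi>: "\<phi> \<in> {0..<2 * pi}"
    and dist: "dist_to_set (2 * n) w (solution_set n x) = sqrt (nsq n (\<lambda>k. to_complex n w k - cis \<phi> * x k))"
    by (rule nearest_orbit_point[of n x "to_complex n w"]) auto
  have "L2_set (\<lambda>i. w i - orbit_point n x \<phi> i) {..<2 * n} = 0"
    using assms(2) L2_set_nonneg unfolding dist dist_orbit_point[symmetric] by (rule order_antisym)
  then have "w = orbit_point n x \<phi>"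
    by (intro ext_vecs[OF assms(1) orbit_point_in_vecs]) (simp add: L2_set_eq_0_iff)
  then show ?thesis using \<phi> by (simp add: solution_set_eq)
qed

text \<open>
  Such a point is first localised within \<open>\<parallel>x\<parallel>/\<surd>7\<close> of the orbit; there the error bound with zero gradient
  shows that its distance to the orbit is zero.
\<close>

lemma critical_points_in_orbit:
  assumes low: "lower_regular n m a \<delta>" and up: "upper_regular n m a x \<delta>"
    and \<delta>: "\<delta> = 1 / 10000" and x: "0 < nsq n x"
    and w: "w \<in> second_order_critical_points (2 * n) (phase_loss n m a (\<lambda>j. cmod (herm n (a j) x)))"
  shows "w \<in> solution_set n x"
proof -
  define z where "z = to_complex n w"
  obtain \<phi> where \<phi>: "herm n (\<lambda>k. cis \<phi> * x k) z = complex_of_real (cmod (herm n x z))"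
    and dist: "dist_to_set (2 * n) w (solution_set n x) = sqrt (nsq n (\<lambda>k. z k - cis \<phi> * x k))"
    by (rule nearest_orbit_point[of n x z]) (auto simp: z_def)
  let ?f = "phase_loss n m a (\<lambda>j. cmod (herm n (a j) x))"
  let ?x = "\<lambda>k. cis \<phi> * x k"
  have grad0: "grad (2 * n) ?f w i = 0" if "i < 2 * n" for i
    using w that by (simp add: second_order_critical_points_def)
  have psd: "psd (2 * n) (hess ?f w)" and wv: "w \<in> vecs (2 * n)"
    using w by (simp_all add: second_order_critical_points_def)
  have xcm: "cmod (herm n (a j) ?x) = cmod (herm n (a j) x)" for j
    by (simp add: herm_scale norm_mult)
  have real_vec: "\<exists>v. \<forall>a. herm n a (to_complex n v) = herm n a y" for y
    by (rule exI[of _ "stack n (\<lambda>k. Re (y k)) (\<lambda>k. Im (y k))"])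
      (auto intro!: herm_cong simp: to_complex_stack)
  have stat: "avg m (\<lambda>j. ((cmod (herm n (a j) z))\<^sup>2 - (cmod (herm n (a j) ?x))\<^sup>2) * ip n (a j) z y) = 0" for y
  proof -
    obtain v where v: "\<And>a. herm n a (to_complex n v) = herm n a y" using real_vec by blast
    show ?thesis
      using directional_derivative[of v n m a "\<lambda>j. cmod (herm n (a j) x)" w] grad0
      by (simp add: ip_def v z_def xcm del: times_complex.sel)
  qed
  have form: "avg m (\<lambda>j. 2 * (ip n (a j) z y)\<^sup>2
         + ((cmod (herm n (a j) z))\<^sup>2 - (cmod (herm n (a j) x))\<^sup>2) * (cmod (herm n (a j) y))\<^sup>2) \<ge> 0" for y
  proof -
    obtain v where v: "\<And>a. herm n a (to_complex n v) = herm n a y" using real_vec by blast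
    have "(\<Sum>i<2 * n. \<Sum>k<2 * n. v i * hess ?f w i k * v k) \<ge> 0"
      using psd by (simp add: psd_def)
    then show ?thesis unfolding hessian_form ip_def v z_def by simp
  qed
  have curv: "avg m (\<lambda>j. (2 * (cmod (herm n (a j) z))\<^sup>2 - (cmod (herm n (a j) ?x))\<^sup>2) * (cmod (herm n (a j) ?x))\<^sup>2) \<ge> 0"
  proof -
    let ?Q = "\<lambda>y j. 2 * (ip n (a j) z y)\<^sup>2
         + ((cmod (herm n (a j) z))\<^sup>2 - (cmod (herm n (a j) x))\<^sup>2) * (cmod (herm n (a j) y))\<^sup>2"
    have "?Q ?x j + ?Q (\<lambda>k. \<i> * ?x k) j
       = 2 * ((2 * (cmod (herm n (a j) z))\<^sup>2 - (cmod (herm n (a j) ?x))\<^sup>2) * (cmod (herm n (a j) ?x))\<^sup>2)" for j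
    proof -
      have "cmod (herm n (a j) (\<lambda>k. \<i> * ?x k)) = cmod (herm n (a j) x)"
        unfolding herm_scale by (simp add: norm_mult)
      then show ?thesis
        using cmod_prod_eq_ip[of n "a j" z ?x] unfolding xcm by (simp add: algebra_simps)
    qed
    then have "avg m (?Q ?x) + avg m (?Q (\<lambda>k. \<i> * ?x k))
       = 2 * avg m (\<lambda>j. (2 * (cmod (herm n (a j) z))\<^sup>2 - (cmod (herm n (a j) ?x))\<^sup>2) * (cmod (herm n (a j) ?x))\<^sup>2)"
      unfolding avg_add[symmetric] avg_cmult[symmetric] by simp
    then show ?thesis using form[of ?x] form[of "\<lambda>k. \<i> * ?x k"] by linarith
  qed
  have nx: "nsq n ?x = nsq n x" by (simp add: nsq_rotate)
  have hz: "Im (herm n ?x z) = 0" "0 \<le> Re (herm n ?x z)" unfolding \<phi> by simp_all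
  have "nsq n z + nsq n ?x - 2 * Re (herm n ?x z) \<le> nsq n ?x / 7"
    by (rule critical_point_near_solution[OF low upper_regular_rotate[OF up] \<delta> hz _ stat curv])
      (use x nx in simp_all)
  then have close: "nsq n (\<lambda>k. z k - cis \<phi> * x k) \<le> nsq n x / 7"
    using herm_commute[of n z ?x] unfolding nsq_diff nx by simp
  have "dist_to_set (2 * n) w (solution_set n x) \<le> 1 / sqrt 7 * cnorm n x"
    using real_sqrt_le_mono[OF close] unfolding dist by (simp add: cnorm_eq real_sqrt_divide)
  then have "dist_to_set (2 * n) w (solution_set n x)
     \<le> 4 / (cnorm n x)\<^sup>2 * L2_set (grad (2 * n) ?f w) {..<2 * n}"
    using x by (intro error_bound_near_orbit[OF low up]) (auto simp: \<delta>)
  also have "L2_set (grad (2 * n) ?f w) {..<2 * n} = 0"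
    by (simp add: L2_set_eq_0_iff grad0)
  finally have "dist_to_set (2 * n) w (solution_set n x) \<le> 0" by simp
  with wv show ?thesis by (rule dist_zero_imp_in_solution_set)
qed

section \<open>Measurability of the event\<close>

text \<open>
  The set is a projection, which in general need not be measurable. Compactness saves it: if for every
  \<open>k\<close> some \<open>w\<close> satisfies the first \<open>k\<close> inequalities up to \<open>1/k\<close>, a limit point of these \<open>w\<close> satisfies all of
  them exactly, and by continuity the approximate solutions may be taken from a countable dense set.
\<close>

lemma sets_ex_compact:
  fixes G :: "nat \<Rightarrow> 'a \<Rightarrow> 'b::{metric_space, second_countable_topology} \<Rightarrow> real"
  assumes K: "compact K"
    and meas: "\<And>i w. w \<in> K \<Longrightarrow> (\<lambda>a. G i a w) \<in> borel_measurable M"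
    and cont: "\<And>i a. a \<in> space M \<Longrightarrow> continuous_on K (G i a)"
  shows "{a \<in> space M. \<exists>w\<in>K. \<forall>i. G i a w \<le> 0} \<in> sets M"
proof -
  obtain D where D: "countable D" "D \<subseteq> K" "K \<subseteq> closure D"
    using separable[of K] by blast
  have eq: "(\<exists>w\<in>K. \<forall>i. G i a w \<le> 0) \<longleftrightarrow> (\<forall>k. \<exists>w\<in>D. \<forall>i\<le>k. G i a w < 1 / real (Suc k))"
    if a: "a \<in> space M" for a
  proof
    assume "\<exists>w\<in>K. \<forall>i. G i a w \<le> 0"
    then obtain w where w: "w \<in> K" "\<And>i. G i a w \<le> 0" by blast
    have "\<exists>X. (\<forall>k. X k \<in> D) \<and> X \<longlonglongrightarrow> w"
      using subsetD[OF D(3) w(1)] by (simp only: closure_sequential)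
    then obtain X where X: "\<And>k. X k \<in> D" "X \<longlonglongrightarrow> w" by blast
    show "\<forall>k. \<exists>w\<in>D. \<forall>i\<le>k. G i a w < 1 / real (Suc k)"
    proof
      fix k
      have "\<forall>\<^sub>F l in sequentially. G i a (X l) < 1 / real (Suc k)" for i
      proof (rule order_tendstoD(2))
        show "(\<lambda>l. G i a (X l)) \<longlonglongrightarrow> G i a w"
          using X(1) D(2) by (intro continuous_on_tendsto_compose[OF cont[OF a] X(2) w(1)] always_eventually) blast
        show "G i a w < 1 / real (Suc k)" using w(2)[of i] by (simp add: order.strict_trans1)
      qed
      then have "\<forall>\<^sub>F l in sequentially. \<forall>i\<in>{..k}. G i a (X l) < 1 / real (Suc k)"
        by (intro eventually_ball_finite) auto
      then obtain l where "\<forall>i\<in>{..k}. G i a (X l) < 1 / real (Suc k)"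
        using eventually_happens'[OF sequentially_bot] by blast
      then show "\<exists>w\<in>D. \<forall>i\<le>k. G i a w < 1 / real (Suc k)" using X(1) by blast
    qed
  next
    assume "\<forall>k. \<exists>w\<in>D. \<forall>i\<le>k. G i a w < 1 / real (Suc k)"
    then obtain X where X: "\<And>k. X k \<in> D" "\<And>k i. i \<le> k \<Longrightarrow> G i a (X k) < 1 / real (Suc k)"
      by metis
    have "seq_compact K" using K by (simp only: compact_eq_seq_compact_metric)
    moreover have XK: "\<forall>k. X k \<in> K" using X(1) D(2) by blast
    ultimately obtain l r where l: "l \<in> K" "strict_mono r" "(X \<circ> r) \<longlonglongrightarrow> l"
      by (rule seq_compactE)
    have "G i a l \<le> 0" for i
    proof (rule LIMSEQ_le)
      show "(\<lambda>k. G i a ((X \<circ> r) k)) \<longlonglongrightarrow> G i a l"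
        using XK by (intro continuous_on_tendsto_compose[OF cont[OF a] l(3) l(1)] always_eventually) simp
      show "(\<lambda>k. 1 / real (Suc (r k))) \<longlonglongrightarrow> 0"
        using LIMSEQ_subseq_LIMSEQ[OF LIMSEQ_Suc[OF lim_1_over_n] l(2)] by (simp add: o_def)
      show "\<exists>N. \<forall>k\<ge>N. G i a ((X \<circ> r) k) \<le> 1 / real (Suc (r k))"
      proof (intro exI[of _ i] allI impI)
        fix k assume "i \<le> k"
        then have "i \<le> r k" using seq_suble[OF l(2), of k] by simp
        then show "G i a ((X \<circ> r) k) \<le> 1 / real (Suc (r k))" using X(2) by (simp add: less_imp_le)
      qed
    qed
    then show "\<exists>w\<in>K. \<forall>i. G i a w \<le> 0" using l(1) by blast
  qed
  have "{a \<in> space M. \<exists>w\<in>K. \<forall>i. G i a w \<le> 0}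
     = {a \<in> space M. \<forall>k. \<exists>w\<in>D. \<forall>i\<le>k. G i a w < 1 / real (Suc k)}"
    using eq by blast
  also have "\<dots> \<in> sets M"
  proof -
    have [measurable]: "(\<lambda>a. G i a w) \<in> borel_measurable M" if "w \<in> D" for i w
      using meas that D(2) by blast
    have "{a \<in> space M. \<exists>w\<in>D. \<forall>i\<le>k. G i a w < 1 / real (Suc k)}
        = (\<Union>w\<in>D. \<Inter>i\<in>{..k}. {a \<in> space M. G i a w < 1 / real (Suc k)})" for k
      by auto
    moreover have "\<dots> k \<in> sets M" for k
      by (intro sets.countable_UN' D(1) sets.finite_INT) auto
    ultimately show ?thesis
      by (intro sets.sets_Collect_countable_All) simp
  qed
  finally show ?thesis .
qed

lemma compact_bounded_vecs: "compact {w \<in> vecs d. \<forall>i<d. w i \<in> {- real k..real k}}"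
proof -
  have "{w \<in> vecs d. \<forall>i<d. w i \<in> {- real k..real k}}
     = PiE UNIV (\<lambda>i. if i < d then {- real k..real k} else {undefined})"
    by (auto simp: vecs_def PiE_iff extensional_def split: if_splits)
  also have "compact \<dots>"
    unfolding compactin_euclidean_iff[symmetric] euclidean_product_topology[symmetric] compactin_PiE
    by auto
  finally show ?thesis .
qed

lemma continuous_on_coord: "continuous_on S (\<lambda>w. (w :: nat \<Rightarrow> real) i)"
  by (rule continuous_on_subset[OF continuous_on_product_coordinates subset_UNIV])

text \<open>
  Continuity refers to the product topology on functions from the natural numbers, in which
  the coordinates are continuous.
\<close>

lemma continuous_on_herm_to_complex: "continuous_on S (\<lambda>w. herm n a (to_complex n w))"
  unfolding herm_to_complex
  by (intro continuous_on_sum continuous_on_mult continuous_on_of_real continuous_on_const continuous_on_coord)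

lemma dist_to_solution_set:
  "dist_to_set (2 * n) w (solution_set n x)
    = sqrt (nsq n (to_complex n w) + nsq n x - 2 * cmod (herm n x (to_complex n w)))"
proof -
  obtain \<phi> where \<phi>: "herm n (\<lambda>k. cis \<phi> * x k) (to_complex n w) = complex_of_real (cmod (herm n x (to_complex n w)))"
    and dist: "dist_to_set (2 * n) w (solution_set n x) = sqrt (nsq n (\<lambda>k. to_complex n w k - cis \<phi> * x k))"
    by (rule nearest_orbit_point[of n x "to_complex n w"]) auto
  show ?thesis
    using \<phi> herm_commute[of n "to_complex n w" "\<lambda>k. cis \<phi> * x k"]
    unfolding dist by (simp add: nsq_diff nsq_rotate)
qed

lemma dist_zero_on_solution_set:
  assumes "w \<in> solution_set n x"
  shows "dist_to_set (2 * n) w (solution_set n x) \<le> 0"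
  unfolding dist_to_set_def
  by (rule cINF_lower2[OF _ assms])
    (auto intro!: bdd_belowI[of _ 0] L2_set_nonneg simp: L2_set_eq_0_iff[THEN iffD2])

lemma continuous_on_dist: "continuous_on S (\<lambda>w. dist_to_set (2 * n) w (solution_set n x))"
  unfolding dist_to_solution_set L2_set_to_complex[symmetric] L2_set_def
  by (intro continuous_on_real_sqrt continuous_on_add continuous_on_diff continuous_on_mult
      continuous_on_norm continuous_on_power continuous_on_sum continuous_on_const
      continuous_on_herm_to_complex continuous_on_coord)

lemma continuous_on_partial_deriv:
  assumes "i < 2 * n"
  shows "continuous_on S (partial_deriv i (phase_loss n m a b))"
proof -
  have "partial_deriv i (phase_loss n m a b)
    = (\<lambda>w. 2 * ((\<Sum>j<m. ((cmod (herm n (a j) (to_complex n w)))\<^sup>2 - (b j)\<^sup>2)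
          * Re (cnj (herm n (a j) (to_complex n w)) * coord_row n (a j) i)) / real m))"
    unfolding avg_def[symmetric] using assms by (intro ext partial_deriv_phase_loss)
  moreover have "continuous_on S \<dots>"
    unfolding divide_inverse
    by (intro continuous_on_add continuous_on_diff continuous_on_mult continuous_on_Re continuous_on_cnj
      continuous_on_norm continuous_on_power continuous_on_sum continuous_on_const
      continuous_on_herm_to_complex)
  ultimately show ?thesis by (simp only:)
qed

lemma borel_measurable_cnj: "cnj \<in> borel_measurable borel"
  by (intro borel_measurable_continuous_onI continuous_on_cnj continuous_on_id)

lemma measurable_herm_const:
  assumes "\<And>k. k < n \<Longrightarrow> (\<lambda>a. f a k) \<in> borel_measurable M"
  shows "(\<lambda>a. herm n (f a) z) \<in> borel_measurable M"
proof -
  have "(\<lambda>a. cnj (f a k) * z k) \<in> borel_measurable M" if "k < n" for k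
    by (intro borel_measurable_times borel_measurable_const
        measurable_compose[OF assms[OF that] borel_measurable_cnj])
  then show ?thesis unfolding herm_def by (intro borel_measurable_sum) auto
qed

lemma Collect_not_not_eq_Diff_Un:
  assumes "\<And>a. a \<in> S \<Longrightarrow> a \<in> A \<longleftrightarrow> P a" "\<And>a. a \<in> S \<Longrightarrow> a \<in> B \<longleftrightarrow> Q a"
  shows "{a \<in> S. \<not> P a \<and> \<not> Q a} = S - (A \<union> B)"
  using assms by blast

text \<open>
  As the error bound forces every critical point within distance \<open>r\<close> onto the orbit, the complement
  of the event consists of the \<open>a\<close> for which there is a critical point farther than \<open>r\<close> from the
  orbit, or a violation of the error bound. Strict inequalities are written as countable unions of
  non-strict ones, and the parameter space as a countable union of compact boxes, so that
  \<open>sets_ex_compact\<close> applies. Positive semidefiniteness is tested on a countable dense set of vectors.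
\<close>

lemma sets_good_event:
  fixes M :: "(nat \<Rightarrow> nat \<Rightarrow> complex) measure" and x :: "nat \<Rightarrow> complex" and r c :: real
  assumes coord: "\<And>j k. j < m \<Longrightarrow> k < n \<Longrightarrow> (\<lambda>a. a j k) \<in> borel_measurable M"
    and r: "0 \<le> r"
  defines "f \<equiv> (\<lambda>a. phase_loss n m a (\<lambda>j. cmod (herm n (a j) x)))"
  shows "{a \<in> space M. solution_set n x = second_order_critical_points (2 * n) (f a) \<and>
     (\<forall>w \<in> vecs (2 * n). dist_to_set (2 * n) w (solution_set n x) \<le> r \<longrightarrow>
         dist_to_set (2 * n) w (solution_set n x) \<le> c * L2_set (grad (2 * n) (f a) w) {..<2 * n})} \<in> sets M"
proof -
  define d where "d w = dist_to_set (2 * n) w (solution_set n x)" for w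
  define g where "g a w = L2_set (grad (2 * n) (f a) w) {..<2 * n}" for a w
  define q where "q a w v = (\<Sum>i<2 * n. \<Sum>k<2 * n. v i * hess (f a) w i k * v k)" for a w and v :: "nat \<Rightarrow> real"
  define K where "K k = {w \<in> vecs (2 * n). \<forall>i<2 * n. w i \<in> {- real k..real k}}" for k
  have K: "compact (K k)" for k unfolding K_def by (rule compact_bounded_vecs)
  have K_cover: "\<exists>k. w \<in> K k" if "w \<in> vecs (2 * n)" for w
  proof -
    obtain k where "(\<Sum>i<2 * n. \<bar>w i\<bar>) \<le> real k" using real_arch_simple by blast
    then have "w i \<in> {- real k..real k}" if "i < 2 * n" for i
      using member_le_sum[of i "{..<2 * n}" "\<lambda>i. \<bar>w i\<bar>"] that by (auto simp: abs_le_iff)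
    then show ?thesis using that unfolding K_def by blast
  qed
  have K_vecs: "K k \<subseteq> vecs (2 * n)" for k by (auto simp: K_def)
  have herm_meas: "(\<lambda>a. herm n (a j) z) \<in> borel_measurable M" if "j < m" for j z
    using coord[OF that] by (rule measurable_herm_const)
  have coord_row_meas: "(\<lambda>a. coord_row n (a j) i) \<in> borel_measurable M" if "j < m" "i < 2 * n" for j i
  proof -
    have cnj: "(\<lambda>a. cnj (a j k)) \<in> borel_measurable M" if "k < n" for k
      by (rule measurable_compose[OF coord[OF \<open>j < m\<close> that] borel_measurable_cnj])
    show ?thesis
      unfolding coord_row_def using cnj[of i] cnj[of "i - n"] that by (cases "i < n") auto
  qed
  have pd: "partial_deriv i (f a) w
    = 2 * avg m (\<lambda>j. ((cmod (herm n (a j) (to_complex n w)))\<^sup>2 - (cmod (herm n (a j) x))\<^sup>2)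
          * (Re (herm n (a j) (to_complex n w)) * Re (coord_row n (a j) i)
           + Im (herm n (a j) (to_complex n w)) * Im (coord_row n (a j) i)))" if "i < 2 * n" for a w i
    unfolding f_def using that by (simp add: partial_deriv_phase_loss)
  have pd_meas: "(\<lambda>a. partial_deriv i (f a) w) \<in> borel_measurable M" if i: "i < 2 * n" for i w
    unfolding pd[OF i] avg_def using herm_meas coord_row_meas[OF _ i]
    by (intro borel_measurable_times borel_measurable_divide borel_measurable_sum borel_measurable_diff
        borel_measurable_add borel_measurable_power borel_measurable_const
        measurable_compose[OF _ borel_measurable_Re] measurable_compose[OF _ borel_measurable_Im]
        measurable_compose[OF _ borel_measurable_norm]) auto
  have g_meas: "(\<lambda>a. g a w) \<in> borel_measurable M" for w
    unfolding g_def L2_set_def using pd_meas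
    by (intro measurable_compose[OF _ borel_measurable_sqrt] borel_measurable_sum borel_measurable_power)
      (simp add: grad_def)
  have q_eq: "q a w v = 2 * avg m (\<lambda>j. 2 * (Re (herm n (a j) (to_complex n w)) * Re (herm n (a j) (to_complex n v))
           + Im (herm n (a j) (to_complex n w)) * Im (herm n (a j) (to_complex n v)))\<^sup>2
         + ((cmod (herm n (a j) (to_complex n w)))\<^sup>2 - (cmod (herm n (a j) x))\<^sup>2)
           * (cmod (herm n (a j) (to_complex n v)))\<^sup>2)" for a w v
    unfolding q_def f_def hessian_form by (simp add: ip_def)
  have q_meas: "(\<lambda>a. q a w v) \<in> borel_measurable M" for w v
    unfolding q_eq avg_def using herm_meas
    by (intro borel_measurable_times borel_measurable_divide borel_measurable_sum borel_measurable_diff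
        borel_measurable_add borel_measurable_power borel_measurable_const
        measurable_compose[OF _ borel_measurable_Re] measurable_compose[OF _ borel_measurable_Im]
        measurable_compose[OF _ borel_measurable_norm]) auto
  have d_cont: "continuous_on S d" for S unfolding d_def by (rule continuous_on_dist)
  have g_cont: "continuous_on S (g a)" for S a
  proof -
    have "g a = (\<lambda>w. sqrt (\<Sum>i<2 * n. (partial_deriv i (f a) w)\<^sup>2))"
      by (simp add: g_def L2_set_def grad_def fun_eq_iff)
    moreover have "continuous_on S (\<lambda>w. sqrt (\<Sum>i<2 * n. (partial_deriv i (f a) w)\<^sup>2))"
      unfolding f_def
      by (intro continuous_on_real_sqrt continuous_on_sum continuous_on_power continuous_on_partial_deriv) simp
    ultimately show ?thesis by (simp only:)
  qed
  have q_cont: "continuous_on S (\<lambda>w. q a w v)" "continuous_on S (q a w)" for S a w v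
    unfolding q_eq avg_def divide_inverse
    by (intro continuous_on_add continuous_on_diff continuous_on_mult continuous_on_Re continuous_on_Im
      continuous_on_norm continuous_on_power continuous_on_sum continuous_on_const
      continuous_on_herm_to_complex)+
  obtain V :: "nat \<Rightarrow> nat \<Rightarrow> real" where V: "UNIV \<subseteq> closure (range V)"
  proof -
    obtain T :: "(nat \<Rightarrow> real) set" where T: "countable T" "UNIV \<subseteq> closure T"
      by (rule separable[of UNIV])
    have "T \<noteq> {}"
    proof
      assume "T = {}"
      then show False using T(2) by (simp only: closure_empty subset_empty UNIV_not_empty)
    qed
    then have "range (from_nat_into T) = T" using T(1) by (rule range_from_nat_into)
    then have "UNIV \<subseteq> closure (range (from_nat_into T))" using T(2) by (simp only:)
    then show thesis by (rule that)
  qed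
  have psd_iff: "psd (2 * n) (hess (f a) w) \<longleftrightarrow> (\<forall>l. 0 \<le> q a w (V l))" for a w
  proof
    assume "\<forall>l. 0 \<le> q a w (V l)"
    then have "range V \<subseteq> {v. 0 \<le> q a w v}" by auto
    moreover have "closed {v. 0 \<le> q a w v}"
      by (intro closed_Collect_le continuous_on_const q_cont(2))
    ultimately have "closure (range V) \<subseteq> {v. 0 \<le> q a w v}" by (rule closure_minimal)
    then have "0 \<le> q a w v" for v using V by blast
    then show "psd (2 * n) (hess (f a) w)"
      by (auto simp: psd_def q_def f_def hess_phase_loss_sym)
  qed (simp add: psd_def q_def)
  have critical_iff: "w \<in> second_order_critical_points (2 * n) (f a)
      \<longleftrightarrow> w \<in> vecs (2 * n) \<and> g a w \<le> 0 \<and> (\<forall>l. 0 \<le> q a w (V l))" for a w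
  proof -
    have "g a w \<le> 0 \<longleftrightarrow> (\<forall>i<2 * n. grad (2 * n) (f a) w i = 0)"
      unfolding g_def using L2_set_nonneg[of "grad (2 * n) (f a) w" "{..<2 * n}"]
      by (auto simp: order_antisym_conv L2_set_eq_0_iff)
    then show ?thesis by (simp add: second_order_critical_points_def psd_iff)
  qed
  define B1 where "B1 k l = {a \<in> space M. \<exists>w\<in>K k. \<forall>i. (case i of 0 \<Rightarrow> g a w
      | Suc 0 \<Rightarrow> r + 1 / real (Suc l) - d w | Suc (Suc i) \<Rightarrow> - q a w (V i)) \<le> 0}" for k l
  define B2 where "B2 k l = {a \<in> space M. \<exists>w\<in>K k. \<forall>i. (case i of 0 \<Rightarrow> d w - r
      | Suc i \<Rightarrow> c * g a w + 1 / real (Suc l) - d w) \<le> 0}" for k l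
  have B1: "B1 k l \<in> sets M" for k l
    unfolding B1_def
  proof (rule sets_ex_compact[OF K])
    fix i w
    show "(\<lambda>a. case i of 0 \<Rightarrow> g a w | Suc 0 \<Rightarrow> r + 1 / real (Suc l) - d w
        | Suc (Suc i) \<Rightarrow> - q a w (V i)) \<in> borel_measurable M"
      by (cases i; cases "i - 1") (simp_all add: g_meas q_meas)
  next
    fix i a
    show "continuous_on (K k) (\<lambda>w. case i of 0 \<Rightarrow> g a w | Suc 0 \<Rightarrow> r + 1 / real (Suc l) - d w
        | Suc (Suc i) \<Rightarrow> - q a w (V i))"
      by (cases i; cases "i - 1")
        (simp_all add: g_cont continuous_on_diff continuous_on_minus d_cont q_cont(1))
  qed
  have B2: "B2 k l \<in> sets M" for k l
    unfolding B2_def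
  proof (rule sets_ex_compact[OF K])
    fix i w
    show "(\<lambda>a. case i of 0 \<Rightarrow> d w - r | Suc i \<Rightarrow> c * g a w + 1 / real (Suc l) - d w)
        \<in> borel_measurable M"
      by (cases i) (simp_all add: g_meas borel_measurable_diff borel_measurable_add borel_measurable_times)
  next
    fix i a
    show "continuous_on (K k) (\<lambda>w. case i of 0 \<Rightarrow> d w - r | Suc i \<Rightarrow> c * g a w + 1 / real (Suc l) - d w)"
      by (cases i)
        (simp_all add: g_cont continuous_on_diff continuous_on_add continuous_on_mult d_cont)
  qed
  have all_nat: "(\<forall>i. P i) \<longleftrightarrow> P 0 \<and> (\<forall>i. P (Suc i))" for P :: "nat \<Rightarrow> bool"
  proof (intro iffI allI)
    fix i assume "P 0 \<and> (\<forall>i. P (Suc i))"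
    then show "P i" by (cases i) simp_all
  qed simp
  have below: "(\<exists>l. s + 1 / real (Suc l) - t \<le> 0) \<longleftrightarrow> s < t" for s t :: real
  proof
    assume "s < t"
    then have "0 < t - s" by simp
    then obtain l where "inverse (real (Suc l)) < t - s" using reals_Archimedean by blast
    then have "s + 1 / real (Suc l) - t \<le> 0" unfolding inverse_eq_divide by linarith
    then show "\<exists>l. s + 1 / real (Suc l) - t \<le> 0" by (rule exI)
  next
    assume "\<exists>l. s + 1 / real (Suc l) - t \<le> 0"
    then obtain l where "s + 1 / real (Suc l) - t \<le> 0" by (rule exE)
    moreover have "0 < 1 / real (Suc l)" by simp
    ultimately show "s < t" by linarith
  qed
  have inB1: "a \<in> (\<Union>k l. B1 k l) \<longleftrightarrow> (\<exists>w\<in>second_order_critical_points (2 * n) (f a). r < d w)"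
    if "a \<in> space M" for a
  proof -
    have "a \<in> B1 k l \<longleftrightarrow> (\<exists>w\<in>K k. g a w \<le> 0 \<and> r + 1 / real (Suc l) - d w \<le> 0 \<and> (\<forall>i. 0 \<le> q a w (V i)))" for k l
      unfolding B1_def using that by (subst all_nat, subst all_nat) simp
    then have "a \<in> (\<Union>k l. B1 k l) \<longleftrightarrow> (\<exists>k. \<exists>w\<in>K k. g a w \<le> 0
        \<and> (\<exists>l. r + 1 / real (Suc l) - d w \<le> 0) \<and> (\<forall>i. 0 \<le> q a w (V i)))"
      unfolding UN_iff by blast
    also have "\<dots> \<longleftrightarrow> (\<exists>w\<in>second_order_critical_points (2 * n) (f a). r < d w)"
      unfolding below Bex_def critical_iff using K_cover K_vecs by blast
    finally show ?thesis .
  qed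
  have inB2: "a \<in> (\<Union>k l. B2 k l) \<longleftrightarrow> (\<exists>w\<in>vecs (2 * n). d w \<le> r \<and> c * g a w < d w)"
    if "a \<in> space M" for a
  proof -
    have "a \<in> B2 k l \<longleftrightarrow> (\<exists>w\<in>K k. d w - r \<le> 0 \<and> c * g a w + 1 / real (Suc l) - d w \<le> 0)" for k l
      unfolding B2_def using that by (subst all_nat) (simp only: mem_Collect_eq nat.case simp_thms)
    then have "a \<in> (\<Union>k l. B2 k l) \<longleftrightarrow> (\<exists>k. \<exists>w\<in>K k. d w - r \<le> 0
        \<and> (\<exists>l. c * g a w + 1 / real (Suc l) - d w \<le> 0))"
      unfolding UN_iff by blast
    also have "\<dots> \<longleftrightarrow> (\<exists>w\<in>vecs (2 * n). d w \<le> r \<and> c * g a w < d w)"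
      unfolding below unfolding diff_le_0_iff_le using K_cover K_vecs by blast
    finally show ?thesis .
  qed
  have char: "solution_set n x = second_order_critical_points (2 * n) (f a) \<and>
     (\<forall>w \<in> vecs (2 * n). d w \<le> r \<longrightarrow> d w \<le> c * g a w)
     \<longleftrightarrow> \<not> (\<exists>w\<in>second_order_critical_points (2 * n) (f a). r < d w)
       \<and> \<not> (\<exists>w\<in>vecs (2 * n). d w \<le> r \<and> c * g a w < d w)" (is "?L \<longleftrightarrow> ?R") for a
  proof
    assume L: ?L
    have "d w \<le> r" if "w \<in> solution_set n x" for w
      using dist_zero_on_solution_set[OF that] r by (simp add: d_def)
    then show ?R using L unfolding not_less[symmetric] by blast
  next
    assume R: ?R
    have "w \<in> solution_set n x" if w: "w \<in> second_order_critical_points (2 * n) (f a)" for w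
    proof -
      have wv: "w \<in> vecs (2 * n)" and "g a w \<le> 0" using w by (simp_all add: critical_iff)
      moreover have "0 \<le> g a w" by (simp add: g_def)
      ultimately have g0: "g a w = 0" by simp
      have "\<not> r < d w" using R w by blast
      then have "\<not> c * g a w < d w" using R wv by (meson not_less)
      then have "d w \<le> 0" by (simp add: g0)
      then show ?thesis
        using dist_zero_imp_in_solution_set[OF wv] by (simp add: d_def)
    qed
    moreover have "solution_set n x \<subseteq> second_order_critical_points (2 * n) (f a)"
      unfolding f_def by (rule orbit_points_are_critical)
    ultimately show ?L using R unfolding not_less[symmetric] by blast
  qed
  have "{a \<in> space M. solution_set n x = second_order_critical_points (2 * n) (f a) \<and>
     (\<forall>w \<in> vecs (2 * n). d w \<le> r \<longrightarrow> d w \<le> c * g a w)}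
    = space M - ((\<Union>k l. B1 k l) \<union> (\<Union>k l. B2 k l))"
    unfolding char by (rule Collect_not_not_eq_Diff_Un[OF inB1 inB2])
  moreover have "\<dots> \<in> sets M"
    by (intro sets.Diff sets.top sets.Un sets.countable_UN) (auto simp: B1 B2)
  ultimately show ?thesis unfolding d_def g_def by (simp only:)
qed

section \<open>Gaussian moments\<close>

lemma sets_complex_gaussian [measurable_cong, simp]: "sets complex_gaussian = sets borel"
  by (simp add: complex_gaussian_def)

lemma prob_space_complex_gaussian_vec: "prob_space (complex_gaussian_vec n)"
  unfolding complex_gaussian_vec_def by (intro prob_space_PiM prob_space_complex_gaussian)

text \<open>
  This transfers the known characteristic function of the standard normal distribution.
\<close>

lemma half_gaussian_eq_scaled_normal:
  "half_gaussian = distr std_normal_distribution borel (\<lambda>x. sqrt (1 / 2) * x)"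
proof -
  interpret N: prob_space std_normal_distribution
    by (rule prob_space_normal_density) simp
  have "distributed std_normal_distribution lborel (\<lambda>x. x) std_normal_density"
    unfolding distributed_def by (auto simp: distr_id2)
  from N.normal_density_affine[OF this, of "sqrt (1 / 2)" 0]
  have "distributed std_normal_distribution lborel (\<lambda>x. sqrt (1 / 2) * x) (normal_density 0 (sqrt (1 / 2)))"
    by simp
  from distributed_distr_eq_density[OF this]
  have "distr std_normal_distribution lborel (\<lambda>x. sqrt (1 / 2) * x) = half_gaussian"
    by (simp add: half_gaussian_def)
  then show ?thesis
    using distr_cong[of std_normal_distribution std_normal_distribution lborel borel
        "\<lambda>x. sqrt (1 / 2) * x" "\<lambda>x. sqrt (1 / 2) * x"] by (simp only: sets_lborel)
qed

lemma char_half_gaussian: "char half_gaussian t = complex_of_real (exp (- t\<^sup>2 / 4))"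
proof -
  have "char half_gaussian t = (CLINT x|std_normal_distribution. iexp (t * (sqrt (1 / 2) * x)))"
    unfolding char_def half_gaussian_eq_scaled_normal
    by (subst integral_distr) (auto intro!: borel_measurable_continuous_onI continuous_intros)
  also have "\<dots> = char std_normal_distribution (t * sqrt (1 / 2))"
    by (simp add: char_def mult.assoc)
  also have "\<dots> = complex_of_real (exp (- (t * sqrt (1 / 2))\<^sup>2 / 2))"
    by (simp only: char_std_normal_distribution)
  also have "- (t * sqrt (1 / 2))\<^sup>2 / 2 = - t\<^sup>2 / 4"
    by (simp only: power_mult_distrib) simp
  finally show ?thesis .
qed

lemma measurable_Complex: "(\<lambda>(s, t). Complex s t) \<in> borel_measurable (half_gaussian \<Otimes>\<^sub>M half_gaussian)"
proof -
  have "fst \<in> borel_measurable (half_gaussian \<Otimes>\<^sub>M half_gaussian)"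
    using measurable_fst[of half_gaussian half_gaussian]
    by (simp only: measurable_cong_sets[OF refl sets_half_gaussian])
  moreover have "snd \<in> borel_measurable (half_gaussian \<Otimes>\<^sub>M half_gaussian)"
    using measurable_snd[of half_gaussian half_gaussian]
    by (simp only: measurable_cong_sets[OF refl sets_half_gaussian])
  ultimately show ?thesis
    by (simp add: borel_measurable_complex_iff case_prod_beta')
qed

lemma iexp_measurable: "(\<lambda>x::real. iexp x) \<in> borel_measurable borel"
  by (intro borel_measurable_continuous_onI continuous_on_exp continuous_on_mult
      continuous_on_const continuous_on_of_real continuous_on_id)

lemma char_complex_gaussian_linear:
  "(CLINT c|complex_gaussian. iexp (t * Re (cnj c * h))) = complex_of_real (exp (- (t\<^sup>2 * (cmod h)\<^sup>2) / 4))"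
proof -
  interpret H: prob_space half_gaussian by (rule prob_space_half_gaussian)
  interpret P: pair_prob_space half_gaussian half_gaussian ..
  have lin: "(\<lambda>c::complex. t * Re (cnj c * h)) \<in> borel_measurable borel"
    by (intro borel_measurable_continuous_onI continuous_on_mult continuous_on_const
        continuous_on_Re continuous_on_cnj continuous_on_id)
  have m: "(\<lambda>c::complex. iexp (t * Re (cnj c * h))) \<in> borel_measurable borel"
    by (rule measurable_compose[OF lin iexp_measurable])
  have "(CLINT c|complex_gaussian. iexp (t * Re (cnj c * h)))
     = (CLINT p|half_gaussian \<Otimes>\<^sub>M half_gaussian. iexp (t * Re (cnj (case p of (x, y) \<Rightarrow> Complex x y) * h)))"
    unfolding complex_gaussian_def by (rule integral_distr[OF measurable_Complex m])
  also have "\<dots> = (CLINT x|half_gaussian. CLINT y|half_gaussian. iexp (t * Re (cnj (Complex x y) * h)))"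
  proof -
    have "integrable (half_gaussian \<Otimes>\<^sub>M half_gaussian)
        (\<lambda>p. iexp (t * Re (cnj (case p of (x, y) \<Rightarrow> Complex x y) * h)))"
      by (rule P.P.integrable_const_bound[where B = 1, OF _ measurable_compose[OF measurable_Complex m]])
        (simp only: norm_exp_i_times order_refl AE_I2)
    from P.integral_fst'[OF this, symmetric] show ?thesis by (simp only: case_prod_conv)
  qed
  also have "\<dots> = (CLINT x|half_gaussian. CLINT y|half_gaussian. iexp (t * Re h * x) * iexp (t * Im h * y))"
  proof -
    have "iexp (t * Re (cnj (Complex x y) * h)) = iexp (t * Re h * x) * iexp (t * Im h * y)" for x y
      unfolding exp_add[symmetric] by (rule arg_cong[of _ _ exp]) (simp add: complex_eq_iff algebra_simps)
    then show ?thesis by (simp only:)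
  qed
  also have "\<dots> = char half_gaussian (t * Re h) * char half_gaussian (t * Im h)"
    unfolding char_def by simp
  also have "\<dots> = complex_of_real (exp (- (t * Re h)\<^sup>2 / 4 + - (t * Im h)\<^sup>2 / 4))"
    unfolding char_half_gaussian by (simp only: exp_add of_real_mult)
  also have "- (t * Re h)\<^sup>2 / 4 + - (t * Im h)\<^sup>2 / 4 = - (t\<^sup>2 * (cmod h)\<^sup>2) / 4"
    unfolding cmod_power2 power_mult_distrib by (simp add: field_simps)
  finally show ?thesis .
qed

lemma char_herm:
  "(CLINT a|complex_gaussian_vec n. iexp (t * Re (herm n a h))) = complex_of_real (exp (- (t\<^sup>2 * nsq n h) / 4))"
proof -
  interpret C: prob_space complex_gaussian by (rule prob_space_complex_gaussian)
  interpret P: product_sigma_finite "\<lambda>_. complex_gaussian" ..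
  have int: "integrable complex_gaussian (\<lambda>c. iexp (t * Re (cnj c * z)))" for z
  proof (rule C.integrable_const_bound[where B = 1])
    have "(\<lambda>c::complex. t * Re (cnj c * z)) \<in> borel_measurable borel"
      by (intro borel_measurable_continuous_onI continuous_on_mult continuous_on_const
          continuous_on_Re continuous_on_cnj continuous_on_id)
    then show "(\<lambda>c. iexp (t * Re (cnj c * z))) \<in> borel_measurable complex_gaussian"
      unfolding measurable_cong_sets[OF sets_complex_gaussian refl]
      by (rule measurable_compose[OF _ iexp_measurable])
  qed (simp add: norm_exp_i_times)
  have "iexp (t * Re (herm n a h)) = (\<Prod>k<n. iexp (t * Re (cnj (a k) * h k)))" for a
    unfolding exp_sum[OF finite_lessThan, symmetric] herm_def Re_sum of_real_sum sum_distrib_left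
      of_real_mult by (simp only: sum_distrib_left)
  then have "(CLINT a|complex_gaussian_vec n. iexp (t * Re (herm n a h)))
     = (CLINT a|Pi\<^sub>M {..<n} (\<lambda>_. complex_gaussian). \<Prod>k<n. iexp (t * Re (cnj (a k) * h k)))"
    unfolding complex_gaussian_vec_def by (simp only:)
  also have "\<dots> = (\<Prod>k<n. CLINT c|complex_gaussian. iexp (t * Re (cnj c * h k)))"
    by (rule P.product_integral_prod[OF finite_lessThan int])
  also have "\<dots> = complex_of_real (exp (\<Sum>k<n. - (t\<^sup>2 * (cmod (h k))\<^sup>2) / 4))"
    unfolding char_complex_gaussian_linear exp_sum[OF finite_lessThan] of_real_prod ..
  also have "(\<Sum>k<n. - (t\<^sup>2 * (cmod (h k))\<^sup>2) / 4) = - (t\<^sup>2 * nsq n h) / 4"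
    by (simp add: nsq_def sum_distrib_left sum_divide_distrib sum_negf)
  finally show ?thesis .
qed

lemma measurable_herm [measurable]: "(\<lambda>a. herm n a h) \<in> borel_measurable (complex_gaussian_vec n)"
proof (rule measurable_herm_const)
  fix k assume "k < n"
  then have "(\<lambda>a. a k) \<in> measurable (complex_gaussian_vec n) complex_gaussian"
    unfolding complex_gaussian_vec_def by (intro measurable_component_singleton) simp
  then show "(\<lambda>a. a k) \<in> borel_measurable (complex_gaussian_vec n)"
    by (simp only: measurable_cong_sets[OF refl sets_complex_gaussian])
qed

text \<open>
  Every moment used below is obtained from this one-dimensional law: quartic expressions in the
  sample are polarised into fourth powers of real parts, and exponentials of squared moduli are
  bounded by exponentials of squared real parts. Comparing characteristic functions covers the case
  of a degenerate law, when \<open>h\<close> vanishes.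
\<close>

lemma law_Re_herm:
  "distr (complex_gaussian_vec n) borel (\<lambda>a. Re (herm n a h))
     = distr half_gaussian borel (\<lambda>s. sqrt (nsq n h) * s)"
proof (rule Levy_uniqueness)
  interpret V: prob_space "complex_gaussian_vec n" by (rule prob_space_complex_gaussian_vec)
  interpret H: prob_space half_gaussian by (rule prob_space_half_gaussian)
  have m: "(\<lambda>a. Re (herm n a h)) \<in> borel_measurable (complex_gaussian_vec n)" by measurable
  have m': "(\<lambda>s. sqrt (nsq n h) * s) \<in> borel_measurable half_gaussian" by simp
  have i: "(\<lambda>x::real. iexp (t * x)) \<in> borel_measurable borel" for t
    by (intro borel_measurable_continuous_onI continuous_on_exp continuous_on_mult
      continuous_on_const continuous_on_of_real continuous_on_id)
  show "real_distribution (distr (complex_gaussian_vec n) borel (\<lambda>a. Re (herm n a h)))"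
    using m by (rule V.real_distribution_distr)
  show "real_distribution (distr half_gaussian borel (\<lambda>s. sqrt (nsq n h) * s))"
    using m' by (rule H.real_distribution_distr)
  show "char (distr (complex_gaussian_vec n) borel (\<lambda>a. Re (herm n a h)))
      = char (distr half_gaussian borel (\<lambda>s. sqrt (nsq n h) * s))"
  proof
    fix t
    have "char (distr half_gaussian borel (\<lambda>s. sqrt (nsq n h) * s)) t = char half_gaussian (t * sqrt (nsq n h))"
      unfolding char_def integral_distr[OF m' i] by (simp only: mult.assoc)
    also have "\<dots> = complex_of_real (exp (- (t\<^sup>2 * nsq n h) / 4))"
      unfolding char_half_gaussian power_mult_distrib by simp
    also have "\<dots> = char (distr (complex_gaussian_vec n) borel (\<lambda>a. Re (herm n a h))) t"
      unfolding char_def integral_distr[OF m i] char_herm ..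
    finally show "char (distr (complex_gaussian_vec n) borel (\<lambda>a. Re (herm n a h))) t
      = char (distr half_gaussian borel (\<lambda>s. sqrt (nsq n h) * s)) t" by (rule sym)
  qed
qed

lemma half_gaussian_fourth_moment:
  "integrable half_gaussian (\<lambda>s. s ^ 4)" "(LINT s|half_gaussian. s ^ 4) = 3 / 4"
proof -
  have sq: "(sqrt (1 / 2))\<^sup>2 = (1 / 2 :: real)" by (rule real_sqrt_pow2) simp
  have "has_bochner_integral lborel (\<lambda>x. normal_density 0 (sqrt (1 / 2)) x *\<^sub>R x ^ 4) (3 / 4)"
  proof -
    have "has_bochner_integral lborel (\<lambda>x. normal_density 0 (sqrt (1 / 2)) x * (x - 0) ^ (2 * 2))
        (fact (2 * 2) / ((2 / (1 / 2)) ^ 2 * fact 2))"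
      using normal_moment_even[of "sqrt (1 / 2)" 0 2] unfolding sq by simp
    moreover have "fact (2 * 2) / ((2 / (1 / 2)) ^ 2 * fact 2) = (3 / 4 :: real)"
      by (simp add: fact_numeral)
    moreover have "(\<lambda>x. normal_density 0 (sqrt (1 / 2)) x * (x - 0) ^ (2 * 2))
        = (\<lambda>x. normal_density 0 (sqrt (1 / 2)) x *\<^sub>R x ^ 4)" by simp
    ultimately show ?thesis by (simp only:)
  qed
  then have "has_bochner_integral half_gaussian (\<lambda>x. x ^ 4) (3 / 4)"
    unfolding half_gaussian_def by (intro has_bochner_integral_density) auto
  then show "integrable half_gaussian (\<lambda>s. s ^ 4)" "(LINT s|half_gaussian. s ^ 4) = 3 / 4"
    by (auto simp: has_bochner_integral_iff)
qed

lemma half_gaussian_exp_square: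
  "integrable half_gaussian (\<lambda>s. exp (s\<^sup>2 / 2))" "(LINT s|half_gaussian. exp (s\<^sup>2 / 2)) \<le> 2"
proof -
  have eq: "normal_density 0 (sqrt (1 / 2)) x *\<^sub>R exp (x\<^sup>2 / 2) = sqrt 2 * std_normal_density x" for x
  proof -
    have "exp (- x\<^sup>2) * exp (x\<^sup>2 / 2) = exp (- x\<^sup>2 / 2)"
      by (simp add: exp_add[symmetric])
    then show ?thesis
      by (simp add: normal_density_def real_sqrt_mult field_simps)
  qed
  have "has_bochner_integral lborel std_normal_density 1"
    using std_normal_moment_even[of 0] by simp
  then have "has_bochner_integral lborel (\<lambda>x. sqrt 2 * std_normal_density x) (sqrt 2 * 1)"
    by (rule has_bochner_integral_mult_right)
  then have "has_bochner_integral half_gaussian (\<lambda>x. exp (x\<^sup>2 / 2)) (sqrt 2)"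
    unfolding half_gaussian_def eq[symmetric] by (intro has_bochner_integral_density) auto
  moreover have "sqrt 2 \<le> (2::real)" using sqrt2_less_2 by simp
  ultimately show "integrable half_gaussian (\<lambda>s. exp (s\<^sup>2 / 2))" "(LINT s|half_gaussian. exp (s\<^sup>2 / 2)) \<le> 2"
    by (auto simp: has_bochner_integral_iff)
qed


lemma integral_law_Re_herm:
  fixes \<phi> :: "real \<Rightarrow> real"
  assumes "\<phi> \<in> borel_measurable borel" "integrable half_gaussian (\<lambda>s. \<phi> (sqrt (nsq n h) * s))"
  shows "integrable (complex_gaussian_vec n) (\<lambda>a. \<phi> (Re (herm n a h)))"
    "(LINT a|complex_gaussian_vec n. \<phi> (Re (herm n a h))) = (LINT s|half_gaussian. \<phi> (sqrt (nsq n h) * s))"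
proof -
  have m: "(\<lambda>a. Re (herm n a h)) \<in> borel_measurable (complex_gaussian_vec n)" by measurable
  have m': "(\<lambda>s. sqrt (nsq n h) * s) \<in> borel_measurable half_gaussian" by simp
  show "integrable (complex_gaussian_vec n) (\<lambda>a. \<phi> (Re (herm n a h)))"
    using assms unfolding integrable_distr_eq[OF m assms(1), symmetric] law_Re_herm
    by (simp only: integrable_distr_eq[OF m' assms(1)])
  show "(LINT a|complex_gaussian_vec n. \<phi> (Re (herm n a h))) = (LINT s|half_gaussian. \<phi> (sqrt (nsq n h) * s))"
    unfolding integral_distr[OF m assms(1), symmetric] law_Re_herm
    by (rule integral_distr[OF m' assms(1)])
qed

lemma Re_herm_fourth_moment:
  "integrable (complex_gaussian_vec n) (\<lambda>a. (Re (herm n a h)) ^ 4)"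
  "(LINT a|complex_gaussian_vec n. (Re (herm n a h)) ^ 4) = 3 / 4 * (nsq n h)\<^sup>2"
proof -
  have m: "(\<lambda>s::real. s ^ 4) \<in> borel_measurable borel" by measurable
  have e: "(\<lambda>s. (sqrt (nsq n h) * s) ^ 4) = (\<lambda>s. (nsq n h)\<^sup>2 * s ^ 4)"
  proof
    fix s
    have "(sqrt (nsq n h)) ^ 4 = ((sqrt (nsq n h))\<^sup>2)\<^sup>2" by (simp only: power_mult[symmetric]) simp
    then show "(sqrt (nsq n h) * s) ^ 4 = (nsq n h)\<^sup>2 * s ^ 4" by (simp add: power_mult_distrib)
  qed
  have i: "integrable half_gaussian (\<lambda>s. (sqrt (nsq n h) * s) ^ 4)"
    unfolding e using half_gaussian_fourth_moment(1) by simp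
  show "integrable (complex_gaussian_vec n) (\<lambda>a. (Re (herm n a h)) ^ 4)"
    by (rule integral_law_Re_herm(1)[OF m i])
  show "(LINT a|complex_gaussian_vec n. (Re (herm n a h)) ^ 4) = 3 / 4 * (nsq n h)\<^sup>2"
    unfolding integral_law_Re_herm(2)[OF m i] unfolding e
    by (simp add: half_gaussian_fourth_moment(2))
qed

lemma cmod_power4: "(cmod u) ^ 4 = ((Re u)\<^sup>2 + (Im u)\<^sup>2)\<^sup>2"
proof -
  have "(cmod u) ^ 4 = ((cmod u)\<^sup>2)\<^sup>2" by (simp only: power_mult[symmetric]) simp
  then show ?thesis by (simp only: cmod_power2)
qed

text \<open>
  The average of \<open>cos\<^sup>4\<close> over the four angles \<open>k\<pi>/4\<close>, shifted by any amount, is \<open>3/8\<close>. So \<open>|u|\<^sup>4\<close> is a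
  combination of fourth powers of the real parts of \<open>u\<close> times \<open>1\<close>, \<open>\<i>\<close> and \<open>1 \<plusminus> \<i>\<close>.
\<close>

lemma cmod_herm_fourth_moment:
  "integrable (complex_gaussian_vec n) (\<lambda>a. (cmod (herm n a h)) ^ 4)"
  "(LINT a|complex_gaussian_vec n. (cmod (herm n a h)) ^ 4) = 2 * (nsq n h)\<^sup>2"
proof -
  let ?g = "\<lambda>c a. (Re (herm n a (\<lambda>k. c * h k))) ^ 4"
  have e: "(cmod (herm n a h)) ^ 4
    = 2 / 3 * (?g 1 a + ?g \<i> a + (?g (1 + \<i>) a + ?g (1 - \<i>) a) / 4)" for a
  proof -
    have "6 * (r\<^sup>2 + i\<^sup>2)\<^sup>2 = 4 * (r ^ 4 + i ^ 4) + ((r - i) ^ 4 + (r + i) ^ 4)" for r i :: real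
      by algebra
    from this[of "Re (herm n a h)" "Im (herm n a h)"] show ?thesis
      unfolding cmod_power4 herm_scale by (simp add: add.commute, argo)
  qed
  have n: "nsq n (\<lambda>k. c * h k) = (cmod c)\<^sup>2 * nsq n h" for c by (rule nsq_scale)
  have c: "(cmod (1 + \<i>))\<^sup>2 = 2" "(cmod (1 - \<i>))\<^sup>2 = 2" by (simp_all add: cmod_power2)
  show "integrable (complex_gaussian_vec n) (\<lambda>a. (cmod (herm n a h)) ^ 4)"
    unfolding e by (intro Bochner_Integration.integrable_add integrable_mult_right integrable_divide Re_herm_fourth_moment(1))
  show "(LINT a|complex_gaussian_vec n. (cmod (herm n a h)) ^ 4) = 2 * (nsq n h)\<^sup>2"
    unfolding e
    by (simp only: Bochner_Integration.integral_add integral_mult_right_zero integral_divide_zero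
        Bochner_Integration.integrable_add integrable_divide_zero Re_herm_fourth_moment n c norm_one norm_ii simp_thms)
      (simp add: power_mult_distrib)
qed

text \<open>
  Polarisation: the square of \<open>Re (cnj u v)\<close> is a combination of fourth powers of the moduli of
  \<open>u\<close>, \<open>v\<close>, \<open>u \<plusminus> v\<close> and \<open>u \<plusminus> \<i>v\<close>.
\<close>

lemma ip_square_moment:
  "integrable (complex_gaussian_vec n) (\<lambda>a. (ip n a z w)\<^sup>2)"
  "(LINT a|complex_gaussian_vec n. (ip n a z w)\<^sup>2) = mom n z w"
proof -
  let ?u = "\<lambda>c d a. (cmod (herm n a (\<lambda>k. c * z k + d * w k))) ^ 4"
  have e: "(ip n a z w)\<^sup>2 = 1 / 16 * (3 / 2 * (?u 1 1 a + ?u 1 (-1) a) - 2 * ?u 1 0 a - 2 * ?u 0 1 a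
      - 1 / 2 * (?u 1 \<i> a + ?u 1 (-\<i>) a))" for a
  proof -
    have "32 * (r * x + i * y)\<^sup>2
      = 3 * (((r + x)\<^sup>2 + (i + y)\<^sup>2)\<^sup>2 + ((r - x)\<^sup>2 + (i - y)\<^sup>2)\<^sup>2) - 4 * (r\<^sup>2 + i\<^sup>2)\<^sup>2 - 4 * (x\<^sup>2 + y\<^sup>2)\<^sup>2
        - (((r - y)\<^sup>2 + (i + x)\<^sup>2)\<^sup>2 + ((r + y)\<^sup>2 + (i - x)\<^sup>2)\<^sup>2)" for r i x y :: real
      by algebra
    from this[of "Re (herm n a z)" "Re (herm n a w)" "Im (herm n a z)" "Im (herm n a w)"] show ?thesis
      unfolding ip_def cmod_power4 herm_add herm_scale by (simp, argo)
  qed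
  have n: "nsq n (\<lambda>k. c * z k + d * w k)
     = (cmod c)\<^sup>2 * nsq n z + 2 * Re (cnj c * d * herm n z w) + (cmod d)\<^sup>2 * nsq n w" for c d
    unfolding nsq_add nsq_scale herm_scale herm_scale_left by (simp only: mult.commute mult.left_commute mult.assoc)
  show "integrable (complex_gaussian_vec n) (\<lambda>a. (ip n a z w)\<^sup>2)"
    unfolding e
    by (intro Bochner_Integration.integrable_add Bochner_Integration.integrable_diff integrable_mult_right cmod_herm_fourth_moment(1))
  show "(LINT a|complex_gaussian_vec n. (ip n a z w)\<^sup>2) = mom n z w"
    unfolding e
    apply (simp only: Bochner_Integration.integral_add Bochner_Integration.integral_diff integral_mult_right_zero
        Bochner_Integration.integrable_add Bochner_Integration.integrable_diff integrable_mult_right cmod_herm_fourth_moment n simp_thms)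
    unfolding mom_def
    by (simp add: power2_eq_square algebra_simps)
qed

text \<open>
  By convexity the exponential is at most the mean of two exponentials of squared real Gaussians, of
  variance at most \<open>1/2\<close>, whose exponential moments are at most \<open>\<surd>2\<close>.
\<close>

lemma cmod_herm_exp_moment:
  assumes "nsq n h \<le> 1"
  shows "integrable (complex_gaussian_vec n) (\<lambda>a. exp ((cmod (herm n a h))\<^sup>2 / 4))"
    "(LINT a|complex_gaussian_vec n. exp ((cmod (herm n a h))\<^sup>2 / 4)) \<le> 2"
proof -
  have m: "(\<lambda>s::real. exp (s\<^sup>2 / 2)) \<in> borel_measurable borel" by measurable
  have R: "integrable (complex_gaussian_vec n) (\<lambda>a. exp ((Re (herm n a g))\<^sup>2 / 2))
     \<and> (LINT a|complex_gaussian_vec n. exp ((Re (herm n a g))\<^sup>2 / 2)) \<le> 2" if "nsq n g \<le> 1" for g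
  proof -
    have b: "exp ((sqrt (nsq n g) * s)\<^sup>2 / 2) \<le> exp (s\<^sup>2 / 2)" for s
      using that mult_right_mono[of "nsq n g" 1 "s\<^sup>2"] by (simp add: power_mult_distrib)
    have i: "integrable half_gaussian (\<lambda>s. exp ((sqrt (nsq n g) * s)\<^sup>2 / 2))"
      by (rule Bochner_Integration.integrable_bound[OF half_gaussian_exp_square(1)]) (use b in \<open>auto intro!: AE_I2\<close>)
    have "(LINT s|half_gaussian. exp ((sqrt (nsq n g) * s)\<^sup>2 / 2)) \<le> (LINT s|half_gaussian. exp (s\<^sup>2 / 2))"
      by (rule integral_mono[OF i half_gaussian_exp_square(1) b])
    then show ?thesis
      using integral_law_Re_herm[OF m i] half_gaussian_exp_square(2) by simp
  qed
  let ?F = "\<lambda>a. (exp ((Re (herm n a h))\<^sup>2 / 2) + exp ((Re (herm n a (\<lambda>k. - \<i> * h k)))\<^sup>2 / 2)) / 2"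
  have n: "nsq n (\<lambda>k. - \<i> * h k) \<le> 1" unfolding nsq_scale using assms by simp
  have iF: "integrable (complex_gaussian_vec n) ?F"
    using R[OF assms] R[OF n] by (intro integrable_divide Bochner_Integration.integrable_add) auto
  have b: "exp ((cmod (herm n a h))\<^sup>2 / 4) \<le> ?F a" for a
  proof -
    have amgm: "exp ((x + y) / 4) \<le> (exp (x / 2) + exp (y / 2)) / 2" for x y :: real
    proof -
      have sq: "exp (t / 2) = (exp (t / 4))\<^sup>2" for t :: real
        by (simp add: exp_double[symmetric])
      have "0 \<le> (exp (x / 4) - exp (y / 4))\<^sup>2" by simp
      then show ?thesis
        unfolding sq add_divide_distrib exp_add by (simp add: power2_diff)
    qed
    show ?thesis unfolding cmod_power2 herm_scale
      using amgm[of "(Re (herm n a h))\<^sup>2" "(Im (herm n a h))\<^sup>2"] by simp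
  qed
  have mm: "(\<lambda>a. exp ((cmod (herm n a h))\<^sup>2 / 4)) \<in> borel_measurable (complex_gaussian_vec n)" by measurable
  show i: "integrable (complex_gaussian_vec n) (\<lambda>a. exp ((cmod (herm n a h))\<^sup>2 / 4))"
    by (rule Bochner_Integration.integrable_bound[OF iF mm], rule AE_I2)
      (use b in \<open>simp add: order_trans[OF _ abs_ge_self]\<close>)
  have "(LINT a|complex_gaussian_vec n. exp ((cmod (herm n a h))\<^sup>2 / 4)) \<le> (LINT a|complex_gaussian_vec n. ?F a)"
    by (rule integral_mono[OF i iF b])
  also have "\<dots> = ((LINT a|complex_gaussian_vec n. exp ((Re (herm n a h))\<^sup>2 / 2))
      + (LINT a|complex_gaussian_vec n. exp ((Re (herm n a (\<lambda>k. - \<i> * h k)))\<^sup>2 / 2))) / 2"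
    using R[OF assms] R[OF n] by simp
  also have "\<dots> \<le> 2" using R[OF assms] R[OF n] by simp
  finally show "(LINT a|complex_gaussian_vec n. exp ((cmod (herm n a h))\<^sup>2 / 4)) \<le> 2" .
qed

section \<open>Tail bounds for a fixed pair of vectors\<close>

lemma exp_minus_le:
  fixes x :: real
  assumes "0 \<le> x"
  shows "exp (- x) \<le> 1 - x + x\<^sup>2"
proof -
  have "1 \<le> 1 + x ^ 3" using assms by simp
  also have "1 + x ^ 3 = (1 - x + x\<^sup>2) * (1 + x)"
    by (simp add: power2_eq_square power3_eq_cube algebra_simps)
  also have "\<dots> \<le> (1 - x + x\<^sup>2) * exp x"
  proof (rule mult_left_mono[OF exp_ge_add_one_self])
    have "0 \<le> (1 - x / 2)\<^sup>2" by simp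
    then show "0 \<le> 1 - x + x\<^sup>2" by (simp add: power2_diff power_divide)
      (use zero_le_power2[of x] in linarith)
  qed
  finally have "exp (- x) * 1 \<le> exp (- x) * ((1 - x + x\<^sup>2) * exp x)"
    by (rule mult_left_mono) simp
  then show ?thesis by (simp add: exp_minus field_simps)
qed

lemma exp_le_second_order:
  fixes y :: real
  assumes "0 \<le> y"
  shows "exp y \<le> 1 + y + y\<^sup>2 * exp y"
proof -
  have "(1 + y) * (1 - y) \<le> (1 + y) * exp (- y)"
    using exp_ge_add_one_self[of "- y"] assms by (intro mult_left_mono) auto
  then have "exp y * ((1 + y) * (1 - y)) \<le> exp y * ((1 + y) * exp (- y))"
    by (rule mult_left_mono) simp
  also have "\<dots> = 1 + y" by (simp add: exp_minus)
  finally show ?thesis by (simp add: power2_eq_square algebra_simps)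
qed

lemma chernoff_iid:
  fixes W :: "'a \<Rightarrow> real"
  assumes P: "prob_space P" and W: "W \<in> borel_measurable P"
    and int: "integrable P (\<lambda>x. exp (W x))" and le: "(LINT x|P. exp (W x)) \<le> exp c"
  shows "measure (Pi\<^sub>M {..<m} (\<lambda>_. P)) {a \<in> space (Pi\<^sub>M {..<m} (\<lambda>_. P)). real m * s \<le> (\<Sum>j<m. W (a j))}
    \<le> exp (real m * (c - s))"
proof -
  interpret P: prob_space P by (rule P)
  interpret product_sigma_finite "\<lambda>_. P" ..
  let ?M = "Pi\<^sub>M {..<m} (\<lambda>_. P)"
  have eq: "exp (\<Sum>j<m. W (a j)) = (\<Prod>j<m. exp (W (a j)))" for a by (simp add: exp_sum)
  have i: "integrable ?M (\<lambda>a. exp (\<Sum>j<m. W (a j)))"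
    unfolding eq by (rule product_integrable_prod[OF finite_lessThan int])
  have "(LINT a|?M. exp (\<Sum>j<m. W (a j))) = (\<Prod>j<m. LINT x|P. exp (W x))"
    unfolding eq by (rule product_integral_prod[OF finite_lessThan int])
  also have "\<dots> = (LINT x|P. exp (W x)) ^ m" by simp
  also have "\<dots> \<le> exp c ^ m" using le by (intro power_mono) auto
  also have "\<dots> = exp (real m * c)" by (simp add: exp_of_nat_mult)
  finally have E: "(LINT a|?M. exp (\<Sum>j<m. W (a j))) \<le> exp (real m * c)" .
  have "measure ?M {a \<in> space ?M. real m * s \<le> (\<Sum>j<m. W (a j))}
      = measure ?M {a \<in> space ?M. exp (real m * s) \<le> exp (\<Sum>j<m. W (a j))}"
    by simp
  also have "\<dots> \<le> (LINT a|?M. exp (\<Sum>j<m. W (a j))) / exp (real m * s)"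
    by (rule integral_Markov_inequality_measure[OF i sets.empty_sets]) auto
  also have "\<dots> \<le> exp (real m * c) / exp (real m * s)"
    using E by (intro divide_right_mono) auto
  also have "\<dots> = exp (real m * (c - s))" by (simp add: exp_diff right_diff_distrib)
  finally show ?thesis .
qed

text \<open>
  For nonnegative variables \<open>exp (- \<lambda>U) \<le> 1 - \<lambda>U + \<lambda>\<^sup>2U\<^sup>2\<close>, so a second moment already gives a
  subgaussian lower tail, however heavy the upper tail may be.
\<close>

lemma lower_tail_nonneg:
  fixes U :: "'a \<Rightarrow> real"
  assumes P: "prob_space P" and U: "\<And>x. 0 \<le> U x" "integrable P U"
    and U2: "integrable P (\<lambda>x. (U x)\<^sup>2)" "(LINT x|P. (U x)\<^sup>2) \<le> V" and V: "0 < V" and t: "0 \<le> t"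
  shows "measure (Pi\<^sub>M {..<m} (\<lambda>_. P))
      {a \<in> space (Pi\<^sub>M {..<m} (\<lambda>_. P)). (\<Sum>j<m. U (a j)) \<le> real m * ((LINT x|P. U x) - t)}
    \<le> exp (- (real m * t\<^sup>2 / (4 * V)))"
proof -
  interpret P: prob_space P by (rule P)
  define E where "E = (LINT x|P. U x)"
  (* This l minimises the Chernoff exponent - l t + l^2 V. *)
  define l where "l = t / (2 * V)"
  have l: "0 \<le> l" using t V by (simp add: l_def)
  have [measurable]: "U \<in> borel_measurable P" using U(2) by (rule borel_measurable_integrable)
  have m: "(\<lambda>x. - l * U x) \<in> borel_measurable P" by measurable
  have i: "integrable P (\<lambda>x. exp (- l * U x))"
    using l U(1) by (intro P.integrable_const_bound[where B = 1]) (auto simp: mult_nonneg_nonneg)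
  have i2: "integrable P (\<lambda>x. 1 - l * U x + l\<^sup>2 * (U x)\<^sup>2)"
    using U(2) U2(1) by (intro Bochner_Integration.integrable_add Bochner_Integration.integrable_diff integrable_mult_right P.integrable_const)
  have "(LINT x|P. exp (- l * U x)) \<le> (LINT x|P. 1 - l * U x + l\<^sup>2 * (U x)\<^sup>2)"
  proof (rule integral_mono[OF i i2])
    fix x
    have "0 \<le> l * U x" using l U(1) by simp
    from exp_minus_le[OF this] show "exp (- l * U x) \<le> 1 - l * U x + l\<^sup>2 * (U x)\<^sup>2"
      by (simp add: power_mult_distrib)
  qed
  also have "\<dots> = 1 - l * E + l\<^sup>2 * (LINT x|P. (U x)\<^sup>2)"
    using U(2) U2(1) by (simp add: E_def P.prob_space)
  also have "\<dots> \<le> 1 + (- l * E + l\<^sup>2 * V)"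
    using mult_left_mono[OF U2(2), of "l\<^sup>2"] by simp
  also have "\<dots> \<le> exp (- l * E + l\<^sup>2 * V)" by (rule exp_ge_add_one_self)
  finally have c: "(LINT x|P. exp (- l * U x)) \<le> exp (- l * E + l\<^sup>2 * V)" .
  have "measure (Pi\<^sub>M {..<m} (\<lambda>_. P))
      {a \<in> space (Pi\<^sub>M {..<m} (\<lambda>_. P)). real m * (- l * (E - t)) \<le> (\<Sum>j<m. - l * U (a j))}
    \<le> exp (real m * ((- l * E + l\<^sup>2 * V) - (- l * (E - t))))"
    by (rule chernoff_iid[OF P m i c])
  also have "(- l * E + l\<^sup>2 * V) - (- l * (E - t)) = - (t\<^sup>2 / (4 * V))"
    using V by (simp add: l_def power2_eq_square field_simps)
  finally have b: "measure (Pi\<^sub>M {..<m} (\<lambda>_. P))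
      {a \<in> space (Pi\<^sub>M {..<m} (\<lambda>_. P)). real m * (- l * (E - t)) \<le> (\<Sum>j<m. - l * U (a j))}
    \<le> exp (- (real m * t\<^sup>2 / (4 * V)))" by simp
  show ?thesis
  proof (rule order_trans[OF finite_measure.finite_measure_mono b])
    show "finite_measure (Pi\<^sub>M {..<m} (\<lambda>_. P))"
      by (intro prob_space.finite_measure prob_space_PiM P)
    show "{a \<in> space (Pi\<^sub>M {..<m} (\<lambda>_. P)). (\<Sum>j<m. U (a j)) \<le> real m * ((LINT x|P. U x) - t)}
      \<subseteq> {a \<in> space (Pi\<^sub>M {..<m} (\<lambda>_. P)). real m * (- l * (E - t)) \<le> (\<Sum>j<m. - l * U (a j))}"
    proof safe
      fix a assume "(\<Sum>j<m. U (a j)) \<le> real m * ((LINT x|P. U x) - t)"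
      then have "l * (\<Sum>j<m. U (a j)) \<le> l * (real m * (E - t))"
        using l unfolding E_def by (rule mult_left_mono)
      then show "real m * (- l * (E - t)) \<le> (\<Sum>j<m. - l * U (a j))"
        unfolding sum_distrib_left[symmetric] by (simp add: mult.left_commute)
    qed
    show "{a \<in> space (Pi\<^sub>M {..<m} (\<lambda>_. P)). real m * (- l * (E - t)) \<le> (\<Sum>j<m. - l * U (a j))}
        \<in> sets (Pi\<^sub>M {..<m} (\<lambda>_. P))"
      by measurable
  qed
qed

lemma fourth_power_le_exp:
  fixes q :: real
  assumes "0 \<le> q"
  shows "q ^ 4 \<le> 65536 * exp (q / 4)" "q\<^sup>2 \<le> 256 * exp (q / 8)"
proof -
  have b: "q / 16 \<le> exp (q / 16)" using exp_ge_add_one_self[of "q / 16"] by linarith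
  have "(q / 16) ^ 4 \<le> exp (q / 16) ^ 4" using b assms by (intro power_mono) auto
  also have "\<dots> = exp (q / 4)" by (simp add: exp_of_nat_mult[symmetric])
  finally show "q ^ 4 \<le> 65536 * exp (q / 4)" by (simp add: power_divide)
  have "(q / 16)\<^sup>2 \<le> (exp (q / 16))\<^sup>2" using b assms by (intro power_mono) auto
  also have "\<dots> = exp (q / 8)" by (simp add: exp_of_nat_mult[symmetric])
  finally show "q\<^sup>2 \<le> 256 * exp (q / 8)" by (simp add: power_divide)
qed

lemma ip_square_le: "(ip n a z w)\<^sup>2 \<le> (cmod (herm n a z))\<^sup>2 * (cmod (herm n a w))\<^sup>2"
  unfolding cmod_prod_eq_ip by simp

lemma measurable_ip [measurable]: "(\<lambda>a. ip n a z w) \<in> borel_measurable (complex_gaussian_vec n)"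
proof -
  have "(\<lambda>a. Re (herm n a z) * Re (herm n a w) + Im (herm n a z) * Im (herm n a w))
      \<in> borel_measurable (complex_gaussian_vec n)" by measurable
  then show ?thesis by (simp add: ip_def)
qed

text \<open>
  The fourth power of \<open>q = |a\<^sup>Hz|\<^sup>2\<close> is at most \<open>2\<^sup>1\<^sup>6 exp (q/4)\<close>, whose expectation is at
  most \<open>2\<^sup>1\<^sup>7 = 131072\<close>.
\<close>

lemma ip_fourth_moment:
  assumes "nsq n z \<le> 1" "nsq n w \<le> 1"
  shows "integrable (complex_gaussian_vec n) (\<lambda>a. ((ip n a z w)\<^sup>2)\<^sup>2)"
    "(LINT a|complex_gaussian_vec n. ((ip n a z w)\<^sup>2)\<^sup>2) \<le> 131072"
proof -
  let ?F = "\<lambda>a. 32768 * (exp ((cmod (herm n a z))\<^sup>2 / 4) + exp ((cmod (herm n a w))\<^sup>2 / 4))"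
  have i: "integrable (complex_gaussian_vec n) ?F"
    by (intro integrable_mult_right Bochner_Integration.integrable_add cmod_herm_exp_moment(1) assms)
  have b: "((ip n a z w)\<^sup>2)\<^sup>2 \<le> ?F a" for a
  proof -
    define u v where "u = (cmod (herm n a z))\<^sup>2" and "v = (cmod (herm n a w))\<^sup>2"
    have uv: "0 \<le> u" "0 \<le> v" by (simp_all add: u_def v_def)
    have "((ip n a z w)\<^sup>2)\<^sup>2 \<le> (u * v)\<^sup>2"
      unfolding u_def v_def by (intro power_mono ip_square_le) simp
    also have "\<dots> \<le> (u ^ 4 + v ^ 4) / 2"
    proof -
      have "0 \<le> (u\<^sup>2 - v\<^sup>2)\<^sup>2" by simp
      also have "(u\<^sup>2 - v\<^sup>2)\<^sup>2 = u ^ 4 + v ^ 4 - 2 * (u * v)\<^sup>2" by algebra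
      finally show ?thesis by simp
    qed
    also have "\<dots> \<le> 32768 * (exp (u / 4) + exp (v / 4))"
      using fourth_power_le_exp(1)[OF uv(1)] fourth_power_le_exp(1)[OF uv(2)] by simp
    finally show ?thesis unfolding u_def v_def .
  qed
  show j: "integrable (complex_gaussian_vec n) (\<lambda>a. ((ip n a z w)\<^sup>2)\<^sup>2)"
    by (rule Bochner_Integration.integrable_bound[OF i]; (rule AE_I2)?)
      (measurable, use b in \<open>simp add: order_trans[OF _ abs_ge_self]\<close>)
  have "(LINT a|complex_gaussian_vec n. ((ip n a z w)\<^sup>2)\<^sup>2) \<le> (LINT a|complex_gaussian_vec n. ?F a)"
    by (rule integral_mono[OF j i b])
  also have "\<dots> = 32768 * ((LINT a|complex_gaussian_vec n. exp ((cmod (herm n a z))\<^sup>2 / 4))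
      + (LINT a|complex_gaussian_vec n. exp ((cmod (herm n a w))\<^sup>2 / 4)))"
    using cmod_herm_exp_moment(1)[OF assms(1)] cmod_herm_exp_moment(1)[OF assms(2)] by simp
  also have "\<dots> \<le> 131072"
    using cmod_herm_exp_moment(2)[OF assms(1)] cmod_herm_exp_moment(2)[OF assms(2)] by simp
  finally show "(LINT a|complex_gaussian_vec n. ((ip n a z w)\<^sup>2)\<^sup>2) \<le> 131072" .
qed

lemma lower_tail_ip:
  assumes "nsq n z \<le> 1" "nsq n w \<le> 1" "0 \<le> t"
  shows "measure (gaussian_samples n m) {a \<in> space (gaussian_samples n m).
        (\<Sum>j<m. (ip n (a j) z w)\<^sup>2) \<le> real m * (mom n z w - t)}
     \<le> exp (- (real m * t\<^sup>2 / 524288))"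
proof -
  have "measure (Pi\<^sub>M {..<m} (\<lambda>_. complex_gaussian_vec n)) {a \<in> space (Pi\<^sub>M {..<m} (\<lambda>_. complex_gaussian_vec n)).
        (\<Sum>j<m. (ip n (a j) z w)\<^sup>2) \<le> real m * ((LINT a|complex_gaussian_vec n. (ip n a z w)\<^sup>2) - t)}
     \<le> exp (- (real m * t\<^sup>2 / (4 * 131072)))"
    by (rule lower_tail_nonneg[OF prob_space_complex_gaussian_vec zero_le_power2 ip_square_moment(1)
      ip_fourth_moment[OF assms(1,2)] _ assms(3)]) simp
  then show ?thesis unfolding ip_square_moment(2) gaussian_samples_def by simp
qed

text \<open>
  After truncation the summand is at most \<open>R\<^sup>2 |a\<^sup>Hw|\<^sup>2\<close>, an exponential variable of scale at most \<open>R\<^sup>2\<close>,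
  and has an exponential moment. Truncation only lowers the mean, which is therefore still at most
  \<open>mom n z w\<close>.
\<close>

lemma upper_tail_truncated_ip:
  assumes z: "nsq n z \<le> 1" and w: "nsq n w \<le> 1" and R: "1 \<le> R" and t: "0 \<le> t" "t \<le> 1"
  shows "measure (gaussian_samples n m) {a \<in> space (gaussian_samples n m).
        real m * (mom n z w + t) \<le> (\<Sum>j<m. if cmod (herm n (a j) z) \<le> R then (ip n (a j) z w)\<^sup>2 else 0)}
     \<le> exp (- (real m * t\<^sup>2 / (2048 * R ^ 4)))"
proof -
  interpret C: prob_space "complex_gaussian_vec n" by (rule prob_space_complex_gaussian_vec)
  define U where "U a = (if cmod (herm n a z) \<le> R then (ip n a z w)\<^sup>2 else 0)" for a
  (* This l minimises the Chernoff exponent 512 l^2 R^4 - l t. *)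
  define l where "l = t / (1024 * R ^ 4)"
  define q where "q a = (cmod (herm n a w))\<^sup>2" for a
  have R0: "0 < R ^ 4" using R by simp
  have l: "0 \<le> l" using t(1) R by (simp add: l_def)
  have "R\<^sup>2 \<le> R ^ 4" using R by (intro power_increasing) auto
  then have "l * R\<^sup>2 \<le> l * R ^ 4" using l by (rule mult_left_mono)
  also have "l * R ^ 4 = t / 1024" using R0 by (simp add: l_def)
  finally have lR: "l * R\<^sup>2 \<le> 1 / 8" using t(2) by simp
  have [measurable]: "U \<in> borel_measurable (complex_gaussian_vec n)" unfolding U_def by measurable
  have Um: "(\<lambda>a. l * U a) \<in> borel_measurable (complex_gaussian_vec n)" by measurable
  have U0: "0 \<le> U a" for a by (simp add: U_def)
  have Uq: "U a \<le> R\<^sup>2 * q a" for a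
  proof (cases "cmod (herm n a z) \<le> R")
    case True
    then have "(cmod (herm n a z))\<^sup>2 \<le> R\<^sup>2" by (intro power_mono) auto
    then have "(cmod (herm n a z))\<^sup>2 * q a \<le> R\<^sup>2 * q a" by (intro mult_right_mono) (auto simp: q_def)
    then show ?thesis using True ip_square_le[of n a z w] by (simp add: U_def q_def)
  qed (simp add: U_def q_def)
  have bound: "exp (l * U a) \<le> 1 + l * (ip n a z w)\<^sup>2 + 256 * l\<^sup>2 * R ^ 4 * exp (q a / 4)" for a
  proof -
    have lU: "0 \<le> l * U a" using l U0 by simp
    have lq: "l * U a \<le> l * R\<^sup>2 * q a" using Uq[of a] l by (simp add: mult_left_mono mult.assoc)
    also have "\<dots> \<le> 1 / 8 * q a" using lR by (intro mult_right_mono) (auto simp: q_def)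
    finally have e: "exp (l * U a) \<le> exp (q a / 8)" by simp
    have "(l * U a)\<^sup>2 \<le> (l * R\<^sup>2 * q a)\<^sup>2" using lq lU by (rule power_mono)
    also have "\<dots> = l\<^sup>2 * R ^ 4 * (q a)\<^sup>2" by (simp add: power_mult_distrib power_mult[symmetric])
    also have "\<dots> \<le> l\<^sup>2 * R ^ 4 * (256 * exp (q a / 8))"
      using R0 by (intro mult_left_mono fourth_power_le_exp(2)) (auto simp: q_def)
    finally have "(l * U a)\<^sup>2 * exp (l * U a) \<le> l\<^sup>2 * R ^ 4 * (256 * exp (q a / 8)) * exp (q a / 8)"
      using e R0 by (intro mult_mono) auto
    also have "\<dots> = 256 * l\<^sup>2 * R ^ 4 * exp (q a / 4)"
      by (simp add: exp_add[symmetric])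
    finally have "exp (l * U a) \<le> 1 + l * U a + 256 * l\<^sup>2 * R ^ 4 * exp (q a / 4)"
      using exp_le_second_order[OF lU] by simp
    moreover have "l * U a \<le> l * (ip n a z w)\<^sup>2" using l by (intro mult_left_mono) (auto simp: U_def)
    ultimately show ?thesis by simp
  qed
  have iF: "integrable (complex_gaussian_vec n)
      (\<lambda>a. 1 + l * (ip n a z w)\<^sup>2 + 256 * l\<^sup>2 * R ^ 4 * exp (q a / 4))"
    unfolding q_def
    by (intro integrable_mult_right Bochner_Integration.integrable_add cmod_herm_exp_moment(1)
        ip_square_moment(1) C.integrable_const w)
  have i: "integrable (complex_gaussian_vec n) (\<lambda>a. exp (l * U a))"
  proof (rule Bochner_Integration.integrable_bound[OF iF])
    show "(\<lambda>a. exp (l * U a)) \<in> borel_measurable (complex_gaussian_vec n)" by measurable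
    show "AE a in complex_gaussian_vec n. norm (exp (l * U a))
        \<le> norm (1 + l * (ip n a z w)\<^sup>2 + 256 * l\<^sup>2 * R ^ 4 * exp (q a / 4))"
    proof (rule AE_I2)
      fix a
      show "norm (exp (l * U a)) \<le> norm (1 + l * (ip n a z w)\<^sup>2 + 256 * l\<^sup>2 * R ^ 4 * exp (q a / 4))"
        unfolding real_norm_def abs_exp_cancel using bound[of a] by (rule order_trans) (rule abs_ge_self)
    qed
  qed
  define c where "c = l * mom n z w + 512 * l\<^sup>2 * R ^ 4"
  have "(LINT a|complex_gaussian_vec n. exp (l * U a))
      \<le> (LINT a|complex_gaussian_vec n. 1 + l * (ip n a z w)\<^sup>2 + 256 * l\<^sup>2 * R ^ 4 * exp (q a / 4))"
    by (rule integral_mono[OF i iF bound])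
  also have "\<dots> = 1 + l * mom n z w + 256 * l\<^sup>2 * R ^ 4 * (LINT a|complex_gaussian_vec n. exp (q a / 4))"
    using ip_square_moment[of n z w] cmod_herm_exp_moment(1)[OF w] by (simp add: q_def C.prob_space)
  also have "\<dots> \<le> 1 + l * mom n z w + 256 * l\<^sup>2 * R ^ 4 * 2"
    using cmod_herm_exp_moment(2)[OF w] R0 unfolding q_def by (intro add_left_mono mult_left_mono) auto
  also have "\<dots> = 1 + c" by (simp add: c_def)
  also have "\<dots> \<le> exp c" by (rule exp_ge_add_one_self)
  finally have E: "(LINT a|complex_gaussian_vec n. exp (l * U a)) \<le> exp c" .
  have "measure (gaussian_samples n m) {a \<in> space (gaussian_samples n m).
        real m * (l * (mom n z w + t)) \<le> (\<Sum>j<m. l * U (a j))} \<le> exp (real m * (c - l * (mom n z w + t)))"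
    unfolding gaussian_samples_def by (rule chernoff_iid[OF C.prob_space_axioms Um i E])
  also have "c - l * (mom n z w + t) = - (t\<^sup>2 / (2048 * R ^ 4))"
  proof -
    have "512 * l\<^sup>2 * R ^ 4 = 512 * l * (l * R ^ 4)" by (simp add: power2_eq_square)
    also have "\<dots> = l * t / 2" unfolding \<open>l * R ^ 4 = t / 1024\<close> by simp
    finally have "c - l * (mom n z w + t) = - (l * t / 2)" by (simp add: c_def algebra_simps)
    then show ?thesis by (simp add: l_def power2_eq_square)
  qed
  finally have b: "measure (gaussian_samples n m) {a \<in> space (gaussian_samples n m).
        real m * (l * (mom n z w + t)) \<le> (\<Sum>j<m. l * U (a j))} \<le> exp (- (real m * t\<^sup>2 / (2048 * R ^ 4)))"
    by simp
  show ?thesis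
  proof (rule order_trans[OF finite_measure.finite_measure_mono b])
    show "finite_measure (gaussian_samples n m)"
      by (intro prob_space.finite_measure prob_space_gaussian_samples)
    show "{a \<in> space (gaussian_samples n m). real m * (l * (mom n z w + t)) \<le> (\<Sum>j<m. l * U (a j))}
        \<in> sets (gaussian_samples n m)"
      unfolding gaussian_samples_def by measurable
    show "{a \<in> space (gaussian_samples n m).
        real m * (mom n z w + t) \<le> (\<Sum>j<m. if cmod (herm n (a j) z) \<le> R then (ip n (a j) z w)\<^sup>2 else 0)}
      \<subseteq> {a \<in> space (gaussian_samples n m). real m * (l * (mom n z w + t)) \<le> (\<Sum>j<m. l * U (a j))}"
    proof safe
      fix a
      assume "real m * (mom n z w + t) \<le> (\<Sum>j<m. if cmod (herm n (a j) z) \<le> R then (ip n (a j) z w)\<^sup>2 else 0)"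
      then have "l * (real m * (mom n z w + t)) \<le> l * (\<Sum>j<m. U (a j))"
        using l unfolding U_def by (rule mult_left_mono)
      then show "real m * (l * (mom n z w + t)) \<le> (\<Sum>j<m. l * U (a j))"
        unfolding sum_distrib_left[symmetric] by (simp only: mult.left_commute)
    qed
  qed
qed

lemma tail_cmod_herm:
  assumes h: "nsq n h \<le> 1" and R: "0 \<le> R" and j: "j < m"
  shows "measure (gaussian_samples n m) {a \<in> space (gaussian_samples n m). R < cmod (herm n (a j) h)}
     \<le> 2 * exp (- (R\<^sup>2 / 4))"
proof -
  interpret C: prob_space "complex_gaussian_vec n" by (rule prob_space_complex_gaussian_vec)
  have d: "distr (gaussian_samples n m) (complex_gaussian_vec n) (\<lambda>a. a j) = complex_gaussian_vec n"
    unfolding gaussian_samples_def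
    by (rule distr_PiM_component[where M = "\<lambda>_. complex_gaussian_vec n"])
      (use j in \<open>simp_all add: C.prob_space_axioms\<close>)
  have comp: "(\<lambda>a. a j) \<in> measurable (gaussian_samples n m) (complex_gaussian_vec n)"
    unfolding gaussian_samples_def using j by (intro measurable_component_singleton) simp
  let ?A = "{x \<in> space (complex_gaussian_vec n). exp (R\<^sup>2 / 4) \<le> exp ((cmod (herm n x h))\<^sup>2 / 4)}"
  have A: "?A \<in> sets (complex_gaussian_vec n)" by measurable
  have "measure (gaussian_samples n m) {a \<in> space (gaussian_samples n m). R < cmod (herm n (a j) h)}
     \<le> measure (gaussian_samples n m) ((\<lambda>a. a j) -` ?A \<inter> space (gaussian_samples n m))"
  proof (rule finite_measure.finite_measure_mono)
    show "finite_measure (gaussian_samples n m)"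
      by (intro prob_space.finite_measure prob_space_gaussian_samples)
    show "(\<lambda>a. a j) -` ?A \<inter> space (gaussian_samples n m) \<in> sets (gaussian_samples n m)"
      by (rule measurable_sets[OF comp A])
    show "{a \<in> space (gaussian_samples n m). R < cmod (herm n (a j) h)}
        \<subseteq> (\<lambda>a. a j) -` ?A \<inter> space (gaussian_samples n m)"
    proof (rule subsetI)
      fix a assume "a \<in> {a \<in> space (gaussian_samples n m). R < cmod (herm n (a j) h)}"
      then have a: "a \<in> space (gaussian_samples n m)" "R < cmod (herm n (a j) h)" by simp_all
      have "R\<^sup>2 \<le> (cmod (herm n (a j) h))\<^sup>2" using a(2) R by (intro power_mono) auto
      then have "exp (R\<^sup>2 / 4) \<le> exp ((cmod (herm n (a j) h))\<^sup>2 / 4)" by simp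
      then have "a j \<in> ?A" using measurable_space[OF comp a(1)] by (simp only: mem_Collect_eq simp_thms)
      then show "a \<in> (\<lambda>a. a j) -` ?A \<inter> space (gaussian_samples n m)"
        using a(1) by (intro IntI vimageI2)
    qed
  qed
  also have "\<dots> = measure (complex_gaussian_vec n) ?A"
    using measure_distr[OF comp A] unfolding d by (rule sym)
  also have "\<dots> \<le> (LINT x|complex_gaussian_vec n. exp ((cmod (herm n x h))\<^sup>2 / 4)) / exp (R\<^sup>2 / 4)"
    by (rule integral_Markov_inequality_measure[OF cmod_herm_exp_moment(1)[OF h] sets.empty_sets]) auto
  also have "\<dots> \<le> 2 / exp (R\<^sup>2 / 4)"
    using cmod_herm_exp_moment(2)[OF h] by (intro divide_right_mono) auto
  also have "\<dots> = 2 * exp (- (R\<^sup>2 / 4))" by (simp only: exp_minus divide_inverse)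
  finally show ?thesis .
qed

section \<open>From a finite net to all vectors\<close>

text \<open>
  Rounding towards zero keeps rounded vectors inside the unit ball, where the tail bounds hold.
\<close>

lemma round_towards_zero:
  fixes t :: real
  assumes t: "\<bar>t\<bar> \<le> 1" and N: "0 < N"
  shows "\<exists>i\<in>{- int N..int N}. \<bar>of_int i / real N\<bar> \<le> \<bar>t\<bar> \<and> \<bar>t - of_int i / real N\<bar> \<le> 1 / real N"
proof -
  define i where "i = \<lfloor>\<bar>t\<bar> * real N\<rfloor>"
  have N': "0 < real N" using N by simp
  have i: "of_int i \<le> \<bar>t\<bar> * real N" "\<bar>t\<bar> * real N < of_int i + 1"
    unfolding i_def by linarith+
  have i0: "0 \<le> i" unfolding i_def by simp
  have "\<bar>t\<bar> * real N \<le> 1 * real N" using t by (intro mult_right_mono) auto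
  then have "real_of_int i \<le> real_of_int (int N)" using i(1) by simp
  then have iN: "i \<le> int N" by (simp only: of_int_le_iff)
  have lo: "of_int i / real N \<le> \<bar>t\<bar>" using i(1) N' by (simp add: pos_divide_le_eq)
  have hi: "\<bar>t\<bar> \<le> of_int i / real N + 1 / real N"
    using i(2) N' unfolding add_divide_distrib[symmetric] by (simp add: pos_le_divide_eq)
  have nn: "0 \<le> of_int i / real N" using i0 by simp
  show ?thesis
  proof (cases "0 \<le> t")
    case True
    then show ?thesis using i0 iN lo hi nn by (intro bexI[of _ i]) auto
  next
    case False
    have "of_int (- i) / real N = - (of_int i / real N)" by simp
    then show ?thesis using False i0 iN lo hi nn by (intro bexI[of _ "- i"]) auto
  qed
qed

text \<open>
  Grid points of mesh \<open>1/N\<close> in the unit ball. They are extensional functions, so that the set is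
  finite.
\<close>

definition net :: "nat \<Rightarrow> nat \<Rightarrow> (nat \<Rightarrow> complex) set" where
  "net n N = {z \<in> {..<n} \<rightarrow>\<^sub>E (\<lambda>(i, j). Complex (of_int i / real N) (of_int j / real N))
       ` ({- int N..int N} \<times> {- int N..int N}). nsq n z \<le> 1}"

lemma finite_net: "finite (net n N)"
proof (rule finite_subset)
  let ?S = "(\<lambda>(i, j). Complex (of_int i / real N) (of_int j / real N)) ` ({- int N..int N} \<times> {- int N..int N})"
  show "net n N \<subseteq> {..<n} \<rightarrow>\<^sub>E ?S" unfolding net_def by (rule Collect_restrict)
  show "finite ({..<n} \<rightarrow>\<^sub>E ?S)" by (intro finite_PiE) auto
qed

lemma card_net: "card (net n N) \<le> ((2 * N + 1)\<^sup>2) ^ n"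
proof -
  let ?S = "(\<lambda>(i, j). Complex (of_int i / real N) (of_int j / real N)) ` ({- int N..int N} \<times> {- int N..int N})"
  have "card (net n N) \<le> card ({..<n} \<rightarrow>\<^sub>E ?S)"
    unfolding net_def by (intro card_mono finite_PiE) auto
  also have "\<dots> = card ?S ^ n" by (simp add: card_PiE)
  also have "\<dots> \<le> ((2 * N + 1)\<^sup>2) ^ n"
  proof (intro power_mono)
    have "card ?S \<le> card ({- int N..int N} \<times> {- int N..int N})" by (intro card_image_le) auto
    also have "\<dots> = (2 * N + 1)\<^sup>2"
    proof -
      have "card {- int N..int N} = 2 * N + 1" by (simp add: nat_add_distrib)
      then show ?thesis by (simp add: card_cartesian_product power2_eq_square)
    qed
    finally show "card ?S \<le> (2 * N + 1)\<^sup>2" .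
  qed simp
  finally show ?thesis .
qed

lemma cmod_le_of_nsq: "nsq n z \<le> 1 \<Longrightarrow> k < n \<Longrightarrow> cmod (z k) \<le> 1"
proof -
  assume z: "nsq n z \<le> 1" and k: "k < n"
  have "(cmod (z k))\<^sup>2 \<le> nsq n z"
    unfolding nsq_def using k by (intro member_le_sum) auto
  then have "(cmod (z k))\<^sup>2 \<le> 1\<^sup>2" using z by simp
  then show "cmod (z k) \<le> 1" by (rule power2_le_imp_le) simp
qed

lemma net_approx:
  assumes z: "nsq n z \<le> 1" and N: "0 < N"
  obtains z' where "z' \<in> net n N" "\<And>k. k < n \<Longrightarrow> cmod (z k - z' k) \<le> 2 / real N"
proof -
  have "\<exists>c\<in>(\<lambda>(i, j). Complex (of_int i / real N) (of_int j / real N)) ` ({- int N..int N} \<times> {- int N..int N}).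
      cmod c \<le> cmod (z k) \<and> cmod (z k - c) \<le> 2 / real N" if k: "k < n" for k
  proof -
    have zk: "cmod (z k) \<le> 1" using z k by (rule cmod_le_of_nsq)
    have "\<bar>Re (z k)\<bar> \<le> 1" using abs_Re_le_cmod[of "z k"] zk by linarith
    then obtain i where i: "i \<in> {- int N..int N}" "\<bar>of_int i / real N\<bar> \<le> \<bar>Re (z k)\<bar>"
        "\<bar>Re (z k) - of_int i / real N\<bar> \<le> 1 / real N"
      using round_towards_zero[OF _ N] by blast
    have "\<bar>Im (z k)\<bar> \<le> 1" using abs_Im_le_cmod[of "z k"] zk by linarith
    then obtain j where j: "j \<in> {- int N..int N}" "\<bar>of_int j / real N\<bar> \<le> \<bar>Im (z k)\<bar>"
        "\<bar>Im (z k) - of_int j / real N\<bar> \<le> 1 / real N"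
      using round_towards_zero[OF _ N] by blast
    let ?c = "Complex (of_int i / real N) (of_int j / real N)"
    have "(of_int i / real N)\<^sup>2 + (of_int j / real N)\<^sup>2 \<le> (Re (z k))\<^sup>2 + (Im (z k))\<^sup>2"
      using i(2) j(2) by (intro add_mono) (simp_all only: abs_le_square_iff)
    then have "cmod ?c \<le> cmod (z k)" unfolding cmod_def complex.sel by (rule real_sqrt_le_mono)
    moreover have "cmod (z k - ?c) \<le> 1 / real N + 1 / real N"
      using cmod_le[of "z k - ?c"] i(3) j(3) by simp
    ultimately show ?thesis
      using i(1) j(1) by (intro bexI[of _ ?c] conjI) (auto intro!: image_eqI[of _ _ "(i, j)"])
  qed
  then obtain c where c: "\<And>k. k < n \<Longrightarrow> c k \<in> (\<lambda>(i, j). Complex (of_int i / real N) (of_int j / real N))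
        ` ({- int N..int N} \<times> {- int N..int N})"
      "\<And>k. k < n \<Longrightarrow> cmod (c k) \<le> cmod (z k)" "\<And>k. k < n \<Longrightarrow> cmod (z k - c k) \<le> 2 / real N"
    by metis
  let ?z = "restrict c {..<n}"
  have "nsq n ?z \<le> nsq n z" unfolding nsq_def using c(2) by (intro sum_mono power_mono) auto
  then have "?z \<in> net n N" unfolding net_def using c(1) z by auto
  then show thesis using c(3) by (intro that[of ?z]) auto
qed

lemma cmod_herm_le_sup:
  assumes "\<And>k. k < n \<Longrightarrow> cmod (a k) \<le> A" "\<And>k. k < n \<Longrightarrow> cmod (z k) \<le> B"
  shows "cmod (herm n a z) \<le> real n * (A * B)"
proof -
  have "cmod (herm n a z) \<le> (\<Sum>k<n. cmod (cnj (a k) * z k))" unfolding herm_def by (rule norm_sum)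
  also have "\<dots> \<le> (\<Sum>k<n. A * B)"
  proof (rule sum_mono)
    fix k assume k: "k \<in> {..<n}"
    have "0 \<le> A" using k by (intro order_trans[OF norm_ge_zero assms(1)]) simp
    then show "cmod (cnj (a k) * z k) \<le> A * B"
      unfolding norm_mult complex_mod_cnj using assms k by (intro mult_mono) auto
  qed
  finally show ?thesis by simp
qed

lemma square_perturb:
  fixes p q :: real
  assumes "\<bar>p\<bar> \<le> A" "\<bar>q\<bar> \<le> A" "\<bar>p - q\<bar> \<le> e"
  shows "\<bar>p\<^sup>2 - q\<^sup>2\<bar> \<le> 2 * A * e"
proof -
  have "\<bar>p\<^sup>2 - q\<^sup>2\<bar> = \<bar>p + q\<bar> * \<bar>p - q\<bar>"
    unfolding abs_mult[symmetric] by (simp add: power2_eq_square algebra_simps)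
  also have "\<dots> \<le> (2 * A) * e" using assms by (intro mult_mono) auto
  finally show ?thesis .
qed

lemma Re_product_perturb:
  fixes u v :: complex
  assumes B: "cmod u \<le> B" "cmod v \<le> B" "cmod u' \<le> B" "cmod v' \<le> B"
    and e: "cmod (u - u') \<le> e" "cmod (v - v') \<le> e"
  shows "\<bar>(Re (cnj u * v))\<^sup>2 - (Re (cnj u' * v'))\<^sup>2\<bar> \<le> 4 * B ^ 3 * e"
proof -
  have B0: "0 \<le> B" using B(1) norm_ge_zero[of u] by linarith
  have e0: "0 \<le> e" using e(1) norm_ge_zero[of "u - u'"] by linarith
  have b: "\<bar>Re (cnj x * y)\<bar> \<le> B\<^sup>2" if "cmod x \<le> B" "cmod y \<le> B" for x y
  proof -
    have "\<bar>Re (cnj x * y)\<bar> \<le> cmod x * cmod y"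
      using abs_Re_le_cmod[of "cnj x * y"] by (simp only: norm_mult complex_mod_cnj)
    also have "\<dots> \<le> B * B" using that B0 by (intro mult_mono) auto
    finally show ?thesis by (simp only: power2_eq_square)
  qed
  have "Re (cnj u * v) - Re (cnj u' * v') = Re (cnj (u - u') * v + cnj u' * (v - v'))"
    by (simp add: algebra_simps)
  also have "\<bar>\<dots>\<bar> \<le> cmod (cnj (u - u') * v + cnj u' * (v - v'))" by (rule abs_Re_le_cmod)
  also have "\<dots> \<le> cmod (cnj (u - u') * v) + cmod (cnj u' * (v - v'))" by (rule norm_triangle_ineq)
  also have "\<dots> \<le> e * B + B * e"
    unfolding norm_mult complex_mod_cnj using B e B0 e0 by (intro add_mono mult_mono) auto
  finally have d: "\<bar>Re (cnj u * v) - Re (cnj u' * v')\<bar> \<le> 2 * B * e" by simp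
  have "\<bar>(Re (cnj u * v))\<^sup>2 - (Re (cnj u' * v'))\<^sup>2\<bar> \<le> 2 * B\<^sup>2 * (2 * B * e)"
    using b[OF B(1,2)] b[OF B(3,4)] d by (rule square_perturb)
  then show ?thesis by (simp add: power2_eq_square power3_eq_cube mult.assoc)
qed

lemma herm_perturb:
  assumes "nsq n z \<le> 1" "nsq n w \<le> 1" "nsq n z' \<le> 1" "nsq n w' \<le> 1"
    and e: "\<And>k. k < n \<Longrightarrow> cmod (z k - z' k) \<le> e" "\<And>k. k < n \<Longrightarrow> cmod (w k - w' k) \<le> e"
  shows "cmod (herm n z w - herm n z' w') \<le> 2 * real n * e"
proof -
  have "herm n z w - herm n z' w' = herm n (\<lambda>k. z k - z' k) w + herm n z' (\<lambda>k. w k - w' k)"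
    by (simp add: herm_def sum.distrib[symmetric] sum_subtractf[symmetric] algebra_simps)
  also have "cmod \<dots> \<le> cmod (herm n (\<lambda>k. z k - z' k) w) + cmod (herm n z' (\<lambda>k. w k - w' k))"
    by (rule norm_triangle_ineq)
  also have "\<dots> \<le> real n * (e * 1) + real n * (1 * e)"
    using assms by (intro add_mono cmod_herm_le_sup cmod_le_of_nsq) auto
  also have "\<dots> = 2 * real n * e" by simp
  finally show ?thesis .
qed

text \<open>
  On the unit ball all quantities in \<open>mom\<close> are bounded by one and, by \<open>herm_perturb\<close>, change by at most
  \<open>2ne\<close>.
\<close>

lemma mom_perturb:
  assumes z: "nsq n z \<le> 1" and w: "nsq n w \<le> 1" and z': "nsq n z' \<le> 1" and w': "nsq n w' \<le> 1"
    and e: "\<And>k. k < n \<Longrightarrow> cmod (z k - z' k) \<le> e" "\<And>k. k < n \<Longrightarrow> cmod (w k - w' k) \<le> e"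
  shows "\<bar>mom n z w - mom n z' w'\<bar> \<le> 10 * real n * e"
proof -
  define d where "d = 2 * real n * e"
  have nd: "\<bar>nsq n y - nsq n y'\<bar> \<le> d"
    if "nsq n y \<le> 1" "nsq n y' \<le> 1" "\<And>k. k < n \<Longrightarrow> cmod (y k - y' k) \<le> e" for y y'
    using herm_perturb[OF that(1) that(1) that(2) that(2) that(3) that(3)]
    unfolding herm_self of_real_diff[symmetric] norm_of_real d_def .
  have hd: "cmod (herm n z w - herm n z' w') \<le> d" unfolding d_def by (rule herm_perturb) fact+
  have h1: "cmod (herm n y v) \<le> 1" if "nsq n y \<le> 1" "nsq n v \<le> 1" for y v
  proof -
    have "(cmod (herm n y v))\<^sup>2 \<le> nsq n y * nsq n v" by (rule cmod_herm_le)
    also have "\<dots> \<le> 1 * 1" using that by (intro mult_mono) auto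
    finally show ?thesis using power2_le_imp_le[of "cmod (herm n y v)" 1] by simp
  qed
  have re: "\<bar>(Re (herm n z w))\<^sup>2 - (Re (herm n z' w'))\<^sup>2\<bar> \<le> 2 * 1 * d"
  proof (rule square_perturb)
    show "\<bar>Re (herm n z w)\<bar> \<le> 1" using abs_Re_le_cmod h1[OF z w] by (rule order_trans)
    show "\<bar>Re (herm n z' w')\<bar> \<le> 1" using abs_Re_le_cmod h1[OF z' w'] by (rule order_trans)
    show "\<bar>Re (herm n z w) - Re (herm n z' w')\<bar> \<le> d"
      unfolding minus_complex.sel[symmetric] using abs_Re_le_cmod hd by (rule order_trans)
  qed
  have im: "\<bar>(Im (herm n z w))\<^sup>2 - (Im (herm n z' w'))\<^sup>2\<bar> \<le> 2 * 1 * d"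
  proof (rule square_perturb)
    show "\<bar>Im (herm n z w)\<bar> \<le> 1" using abs_Im_le_cmod h1[OF z w] by (rule order_trans)
    show "\<bar>Im (herm n z' w')\<bar> \<le> 1" using abs_Im_le_cmod h1[OF z' w'] by (rule order_trans)
    show "\<bar>Im (herm n z w) - Im (herm n z' w')\<bar> \<le> d"
      unfolding minus_complex.sel[symmetric] using abs_Im_le_cmod hd by (rule order_trans)
  qed
  have "nsq n z * nsq n w - nsq n z' * nsq n w'
      = (nsq n z - nsq n z') * nsq n w + nsq n z' * (nsq n w - nsq n w')"
    by (simp add: algebra_simps)
  also have "\<bar>\<dots>\<bar> \<le> \<bar>(nsq n z - nsq n z') * nsq n w\<bar> + \<bar>nsq n z' * (nsq n w - nsq n w')\<bar>"
    by (rule abs_triangle_ineq)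
  also have "\<dots> \<le> d * 1 + 1 * d"
    unfolding abs_mult using z w z' w' nd[OF z z' e(1)] nd[OF w w' e(2)]
    by (intro add_mono mult_mono) auto
  finally have nn: "\<bar>nsq n z * nsq n w - nsq n z' * nsq n w'\<bar> \<le> 2 * d" by simp
  have "\<bar>mom n z w - mom n z' w'\<bar> \<le> 5 * d"
    using nn re im unfolding mom_def by linarith
  then show ?thesis by (simp add: d_def)
qed

lemma ip_scale:
  "ip n a (\<lambda>k. of_real c * z k) (\<lambda>k. of_real d * w k) = c * d * ip n a z w"
  unfolding ip_def herm_scale by (simp add: algebra_simps)

lemma mom_scale:
  "mom n (\<lambda>k. of_real c * z k) (\<lambda>k. of_real d * w k) = c\<^sup>2 * d\<^sup>2 * mom n z w"
  unfolding mom_def herm_scale herm_scale_left nsq_scale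
  by (simp add: power_mult_distrib algebra_simps)

lemma normalize:
  assumes "0 < nsq n z"
  obtains c z' where "0 < c" "c\<^sup>2 = nsq n z" "nsq n z' = 1" "z = (\<lambda>k. of_real c * z' k)"
proof -
  define c where "c = sqrt (nsq n z)"
  have c: "0 < c" "c\<^sup>2 = nsq n z" using assms by (simp_all add: c_def)
  have "nsq n (\<lambda>k. of_real (1 / c) * z k) = 1"
    unfolding nsq_scale norm_of_real power2_abs power_divide c(2) using assms by simp
  moreover have "z = (\<lambda>k. of_real c * (of_real (1 / c) * z k))" using c(1) by (simp add: fun_eq_iff)
  ultimately show thesis using c that by blast
qed

lemma avg_mono: "(\<And>j. j < m \<Longrightarrow> f j \<le> g j) \<Longrightarrow> avg m f \<le> avg m g"
  unfolding avg_def by (intro divide_right_mono sum_mono) auto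

lemma avg_const: "0 < m \<Longrightarrow> avg m (\<lambda>j. c) = c"
  by (simp add: avg_def)

text \<open>
  The constant is polynomial in \<open>n\<close> and in the bound \<open>R\<close> on the entries. That is crude, but the mesh of
  the net is a high negative power of the sample size.
\<close>

lemma ip_perturb:
  assumes a: "\<And>k. k < n \<Longrightarrow> cmod (a k) \<le> R"
    and z: "nsq n z \<le> 1" and w: "nsq n w \<le> 1" and z': "nsq n z' \<le> 1" and w': "nsq n w' \<le> 1"
    and e: "\<And>k. k < n \<Longrightarrow> cmod (z k - z' k) \<le> e" "\<And>k. k < n \<Longrightarrow> cmod (w k - w' k) \<le> e"
  shows "\<bar>(ip n a z w)\<^sup>2 - (ip n a z' w')\<^sup>2\<bar> \<le> 4 * (real n * R) ^ 4 * e"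
proof -
  have b: "cmod (herm n a y) \<le> real n * R" if "nsq n y \<le> 1" for y
    using cmod_herm_le_sup[of n a R y 1] a cmod_le_of_nsq[OF that] by simp
  have d: "cmod (herm n a y - herm n a y') \<le> real n * R * e"
    if "\<And>k. k < n \<Longrightarrow> cmod (y k - y' k) \<le> e" for y y'
    using cmod_herm_le_sup[of n a R "\<lambda>k. y k - y' k" e] a that unfolding herm_diff by (simp add: mult.assoc)
  have "\<bar>(ip n a z w)\<^sup>2 - (ip n a z' w')\<^sup>2\<bar> \<le> 4 * (real n * R) ^ 3 * (real n * R * e)"
    unfolding ip_def by (intro Re_product_perturb b d z w z' w' e)
  also have "\<dots> = 4 * (real n * R) ^ 4 * e"
    by (simp only: power4_eq_xxxx power3_eq_cube mult.assoc)
  finally show ?thesis .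
qed

text \<open>
  Both sides are homogeneous, so it suffices to treat the unit ball, where the nearest grid points
  replace the vectors. The three summands of the bound on \<open>\<delta>\<close> are the deviation on the net and the
  perturbations of the average and of its expectation.
\<close>

lemma lower_regular_from_net:
  assumes m: "0 < m" and N: "0 < N"
    and a: "\<And>j k. j < m \<Longrightarrow> k < n \<Longrightarrow> cmod (a j k) \<le> R"
    and net: "\<And>z w. z \<in> net n N \<Longrightarrow> w \<in> net n N \<Longrightarrow> mom n z w - t \<le> avg m (\<lambda>j. (ip n (a j) z w)\<^sup>2)"
    and \<delta>: "t + 4 * (real n * R) ^ 4 * (2 / real N) + 10 * real n * (2 / real N) \<le> \<delta>"
  shows "lower_regular n m a \<delta>"
  unfolding lower_regular_def
proof (intro allI)
  fix z w
  have unit: "mom n z w - \<delta> \<le> avg m (\<lambda>j. (ip n (a j) z w)\<^sup>2)" if z: "nsq n z \<le> 1" and w: "nsq n w \<le> 1" for z w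
  proof -
    obtain z' where z': "z' \<in> net n N" "\<And>k. k < n \<Longrightarrow> cmod (z k - z' k) \<le> 2 / real N"
      using net_approx[OF z N] by blast
    obtain w' where w': "w' \<in> net n N" "\<And>k. k < n \<Longrightarrow> cmod (w k - w' k) \<le> 2 / real N"
      using net_approx[OF w N] by blast
    have n': "nsq n z' \<le> 1" "nsq n w' \<le> 1" using z'(1) w'(1) by (simp_all add: net_def)
    have "avg m (\<lambda>j. (ip n (a j) z' w')\<^sup>2 - 4 * (real n * R) ^ 4 * (2 / real N)) \<le> avg m (\<lambda>j. (ip n (a j) z w)\<^sup>2)"
    proof (rule avg_mono)
      fix j assume "j < m"
      then have "\<bar>(ip n (a j) z w)\<^sup>2 - (ip n (a j) z' w')\<^sup>2\<bar> \<le> 4 * (real n * R) ^ 4 * (2 / real N)"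
        by (intro ip_perturb a z w n' z'(2) w'(2))
      then show "(ip n (a j) z' w')\<^sup>2 - 4 * (real n * R) ^ 4 * (2 / real N) \<le> (ip n (a j) z w)\<^sup>2" by linarith
    qed
    moreover have "\<bar>mom n z w - mom n z' w'\<bar> \<le> 10 * real n * (2 / real N)"
      by (rule mom_perturb[OF z w n' z'(2) w'(2)])
    moreover have "mom n z' w' - t \<le> avg m (\<lambda>j. (ip n (a j) z' w')\<^sup>2)" by (rule net[OF z'(1) w'(1)])
    ultimately show ?thesis using \<delta> unfolding avg_diff avg_const[OF m] by linarith
  qed
  show "mom n z w - \<delta> * nsq n z * nsq n w \<le> avg m (\<lambda>j. (ip n (a j) z w)\<^sup>2)"
  proof (cases "nsq n z = 0 \<or> nsq n w = 0")
    case True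
    then have zw: "nsq n z * nsq n w = 0" by auto
    then have "herm n z w = 0" using cmod_herm_le[of n z w] unfolding zw by simp
    then have "mom n z w - \<delta> * nsq n z * nsq n w = 0" using True by (auto simp: mom_def)
    also have "0 \<le> avg m (\<lambda>j. (ip n (a j) z w)\<^sup>2)" unfolding avg_def by (intro divide_nonneg_nonneg sum_nonneg) auto
    finally show ?thesis .
  next
    case False
    then have "0 < nsq n z" "0 < nsq n w" using nsq_nonneg[of n z] nsq_nonneg[of n w] by linarith+
    then obtain c z' d w' where c: "c\<^sup>2 = nsq n z" "nsq n z' = 1" "z = (\<lambda>k. of_real c * z' k)"
      and d: "d\<^sup>2 = nsq n w" "nsq n w' = 1" "w = (\<lambda>k. of_real d * w' k)"
      by (metis normalize)
    have "c\<^sup>2 * d\<^sup>2 * (mom n z' w' - \<delta>) \<le> c\<^sup>2 * d\<^sup>2 * avg m (\<lambda>j. (ip n (a j) z' w')\<^sup>2)"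
      using unit[of z' w'] c(2) d(2) by (intro mult_left_mono) auto
    also have "\<dots> = avg m (\<lambda>j. (ip n (a j) z w)\<^sup>2)"
      unfolding avg_cmult[symmetric] c(3) d(3) ip_scale by (simp add: power_mult_distrib)
    also have "c\<^sup>2 * d\<^sup>2 * (mom n z' w' - \<delta>) = mom n z w - \<delta> * nsq n z * nsq n w"
      unfolding c(3) d(3) mom_scale nsq_scale c(2) d(2) norm_of_real power2_abs by (simp add: algebra_simps)
    finally show ?thesis .
  qed
qed

text \<open>
  The vector \<open>x\<close> is kept; only the second argument is moved to the grid.
\<close>

lemma upper_regular_from_net:
  assumes m: "0 < m" and N: "0 < N"
    and a: "\<And>j k. j < m \<Longrightarrow> k < n \<Longrightarrow> cmod (a j k) \<le> R"
    and x: "nsq n x = 1"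
    and net: "\<And>w. w \<in> net n N \<Longrightarrow> avg m (\<lambda>j. (ip n (a j) x w)\<^sup>2) \<le> mom n x w + t"
    and \<delta>: "t + 4 * (real n * R) ^ 4 * (2 / real N) + 10 * real n * (2 / real N) \<le> \<delta>"
  shows "upper_regular n m a x \<delta>"
  unfolding upper_regular_def
proof (intro allI)
  fix w
  have unit: "avg m (\<lambda>j. (ip n (a j) x w)\<^sup>2) \<le> mom n x w + \<delta>" if w: "nsq n w \<le> 1" for w
  proof -
    obtain w' where w': "w' \<in> net n N" "\<And>k. k < n \<Longrightarrow> cmod (w k - w' k) \<le> 2 / real N"
      using net_approx[OF w N] by blast
    have x1: "nsq n x \<le> 1" and n': "nsq n w' \<le> 1" using x w'(1) by (simp_all add: net_def)
    have xx: "cmod (x k - x k) \<le> 2 / real N" for k by simp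
    have "avg m (\<lambda>j. (ip n (a j) x w)\<^sup>2) \<le> avg m (\<lambda>j. (ip n (a j) x w')\<^sup>2 + 4 * (real n * R) ^ 4 * (2 / real N))"
    proof (rule avg_mono)
      fix j assume "j < m"
      then have "\<bar>(ip n (a j) x w)\<^sup>2 - (ip n (a j) x w')\<^sup>2\<bar> \<le> 4 * (real n * R) ^ 4 * (2 / real N)"
        by (intro ip_perturb a x1 w n' xx w'(2))
      then show "(ip n (a j) x w)\<^sup>2 \<le> (ip n (a j) x w')\<^sup>2 + 4 * (real n * R) ^ 4 * (2 / real N)" by linarith
    qed
    moreover have "\<bar>mom n x w - mom n x w'\<bar> \<le> 10 * real n * (2 / real N)"
      by (rule mom_perturb[OF x1 w x1 n' xx w'(2)])
    moreover have "avg m (\<lambda>j. (ip n (a j) x w')\<^sup>2) \<le> mom n x w' + t" by (rule net[OF w'(1)])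
    ultimately show ?thesis using \<delta> unfolding avg_add avg_const[OF m] by linarith
  qed
  show "avg m (\<lambda>j. (ip n (a j) x w)\<^sup>2) \<le> mom n x w + \<delta> * nsq n x * nsq n w"
  proof (cases "nsq n w = 0")
    case True
    have "herm n v w = 0" for v using cmod_herm_le[of n v w] True by simp
    then show ?thesis using True by (simp add: mom_def ip_def avg_def)
  next
    case False
    then have "0 < nsq n w" using nsq_nonneg[of n w] by linarith
    then obtain d w' where d: "d\<^sup>2 = nsq n w" "nsq n w' = 1" "w = (\<lambda>k. of_real d * w' k)"
      by (metis normalize)
    have s: "ip n b x w = d * ip n b x w'" for b
      using ip_scale[of n b 1 x d w'] unfolding d(3) by simp
    have ms: "mom n x w = d\<^sup>2 * mom n x w'"
      using mom_scale[of n 1 x d w'] unfolding d(3) by simp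
    have "d\<^sup>2 * avg m (\<lambda>j. (ip n (a j) x w')\<^sup>2) \<le> d\<^sup>2 * (mom n x w' + \<delta>)"
      using unit[of w'] d(2) by (intro mult_left_mono) auto
    then show ?thesis
      unfolding s ms power_mult_distrib avg_cmult x d(1)[symmetric] by (simp add: algebra_simps)
  qed
qed

lemma upper_regular_scale:
  assumes "upper_regular n m a x \<delta>"
  shows "upper_regular n m a (\<lambda>k. of_real c * x k) \<delta>"
  unfolding upper_regular_def
proof
  fix h
  have s: "ip n b (\<lambda>k. of_real c * x k) h = c * ip n b x h" for b
    using ip_scale[of n b c x 1 h] by simp
  have ms: "mom n (\<lambda>k. of_real c * x k) h = c\<^sup>2 * mom n x h"
    using mom_scale[of n c x 1 h] by simp
  have "c\<^sup>2 * avg m (\<lambda>j. (ip n (a j) x h)\<^sup>2) \<le> c\<^sup>2 * (mom n x h + \<delta> * nsq n x * nsq n h)"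
    using assms unfolding upper_regular_def by (intro mult_left_mono) auto
  then show "avg m (\<lambda>j. (ip n (a j) (\<lambda>k. of_real c * x k) h)\<^sup>2)
      \<le> mom n (\<lambda>k. of_real c * x k) h + \<delta> * nsq n (\<lambda>k. of_real c * x k) * nsq n h"
    unfolding s ms power_mult_distrib avg_cmult nsq_scale norm_of_real power2_abs
    by (simp add: algebra_simps)
qed

section \<open>The union bound\<close>

lemma measure_UN_le_card:
  assumes "finite_measure M" "finite I" "\<And>i. i \<in> I \<Longrightarrow> A i \<in> sets M" "\<And>i. i \<in> I \<Longrightarrow> measure M (A i) \<le> c"
  shows "measure M (\<Union>i\<in>I. A i) \<le> real (card I) * c"
proof -
  have "measure M (\<Union>i\<in>I. A i) \<le> (\<Sum>i\<in>I. measure M (A i))"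
    using assms by (intro finite_measure.finite_measure_subadditive_finite) auto
  also have "\<dots> \<le> real (card I) * c"
    using sum_bounded_above[of I "\<lambda>i. measure M (A i)" c] assms(4) by simp
  finally show ?thesis .
qed

lemma measurable_herm_sample:
  "j < m \<Longrightarrow> (\<lambda>a. herm n (a j) z) \<in> borel_measurable (gaussian_samples n m)"
  unfolding gaussian_samples_def
  by (rule measurable_compose[OF measurable_component_singleton[of j "{..<m}" "\<lambda>_. complex_gaussian_vec n"]
        measurable_herm]) simp

lemma measurable_ip_sample:
  "j < m \<Longrightarrow> (\<lambda>a. ip n (a j) z w) \<in> borel_measurable (gaussian_samples n m)"
  unfolding gaussian_samples_def
  by (rule measurable_compose[OF measurable_component_singleton[of j "{..<m}" "\<lambda>_. complex_gaussian_vec n"]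
        measurable_ip]) simp

text \<open>
  The exceptional set collects four events: an entry of a sample exceeds \<open>R\<close>, or \<open>|a\<^sup>Hx|\<close> does, or the
  lower or the upper deviation is too large at some point of the net. With \<open>R\<^sup>2 = 16 L\<close> the first two have
  tails of order \<open>m\<close> to the power \<open>-4\<close> for each of at most \<open>2m\<^sup>2\<close> events. Outside of it no truncation takes
  place, so the truncated upper bound is a bound for the full average. The exponent \<open>41 n L\<close> in the
  deviation bounds exceeds the entropy \<open>40 n L\<close> of the pairs of grid points by \<open>n L\<close>.
\<close>

lemma regularity_with_high_probability:
  fixes n m :: nat
  defines "M \<equiv> gaussian_samples n m" and "L \<equiv> ln (real m)"
  assumes m: "0 < m" and L: "1 \<le> L" and nm: "n \<le> m" and n: "1 \<le> n" and N: "0 < N"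
    and x: "nsq n x = 1"
    and card: "real (card (net n N)) \<le> exp (20 * real n * L)"
    and t: "0 < t" "t \<le> 1"
    and sample: "real m * t\<^sup>2 \<ge> 41 * 524288 * real n * L ^ 3"
    and \<delta>: "t + 4 * (real n * (4 * sqrt L)) ^ 4 * (2 / real N) + 10 * real n * (2 / real N) \<le> \<delta>"
  shows "\<exists>B\<in>sets M. measure M B \<le> 6 / real m \<and>
     (\<forall>a\<in>space M - B. lower_regular n m a \<delta> \<and> upper_regular n m a x \<delta>)"
proof -
  define R where "R = 4 * sqrt L"
  have "1 \<le> sqrt L" using L by simp
  then have R: "1 \<le> R" "0 \<le> R" unfolding R_def by linarith+
  have R2: "R\<^sup>2 / 4 = 4 * L" using L by (simp add: R_def power_mult_distrib)
  have R4: "R ^ 4 = 256 * L\<^sup>2"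
  proof -
    have "R ^ 4 = (R\<^sup>2)\<^sup>2" by (simp only: power_mult[symmetric]) simp
    also have "R\<^sup>2 = 16 * L" using L by (simp add: R_def power_mult_distrib)
    finally show ?thesis by (simp add: power_mult_distrib)
  qed
  have expL: "exp L = real m" using m by (simp add: L_def)
  have fin: "finite_measure M"
    unfolding M_def by (intro prob_space.finite_measure prob_space_gaussian_samples)
  (* An entry of a sample is, up to conjugation, its Hermitian product with a unit vector. *)
  define e where "e k = (\<lambda>i. if i = k then 1 else (0 :: complex))" for k :: nat
  have ek: "herm n a (e k) = cnj (a k)" "nsq n (e k) = 1" if "k < n" for a k
  proof -
    have "herm n a (e k) = (\<Sum>i<n. if i = k then cnj (a k) else 0)"
      unfolding herm_def e_def by (intro sum.cong) auto
    then show "herm n a (e k) = cnj (a k)" using that by simp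
    have "nsq n (e k) = (\<Sum>i<n. if i = k then 1 else 0)"
      unfolding nsq_def e_def by (intro sum.cong) auto
    then show "nsq n (e k) = 1" using that by simp
  qed
  define T where "T j h = {a \<in> space M. R < cmod (herm n (a j) h)}" for j h
  define B1 where "B1 = (\<Union>(j, k)\<in>{..<m} \<times> {..<n}. T j (e k))"
  define B2 where "B2 = (\<Union>j\<in>{..<m}. T j x)"
  define A3 where "A3 z w = {a \<in> space M. (\<Sum>j<m. (ip n (a j) z w)\<^sup>2) \<le> real m * (mom n z w - t)}" for z w
  define B3 where "B3 = (\<Union>(z, w)\<in>net n N \<times> net n N. A3 z w)"
  define A4 where "A4 w = {a \<in> space M. real m * (mom n x w + t)
      \<le> (\<Sum>j<m. if cmod (herm n (a j) x) \<le> R then (ip n (a j) x w)\<^sup>2 else 0)}" for w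
  define B4 where "B4 = (\<Union>w\<in>net n N. A4 w)"
  have T_sets: "T j h \<in> sets M" if "j < m" for j h
    unfolding T_def M_def using measurable_herm_sample[OF that, of n h] by measurable
  have A3_sets: "A3 z w \<in> sets M" for z w
  proof -
    have [measurable]: "(\<lambda>a. \<Sum>j<m. (ip n (a j) z w)\<^sup>2) \<in> borel_measurable M"
      unfolding M_def by (intro borel_measurable_sum borel_measurable_power measurable_ip_sample) simp
    show ?thesis unfolding A3_def by measurable
  qed
  have A4_sets: "A4 w \<in> sets M" for w
  proof -
    have "(\<lambda>a. if cmod (herm n (a j) x) \<le> R then (ip n (a j) x w)\<^sup>2 else 0) \<in> borel_measurable M"
      if j: "j < m" for j
    proof -
      note [measurable] = measurable_herm_sample[OF j, of n x] measurable_ip_sample[OF j, of n x w]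
      show ?thesis unfolding M_def by measurable
    qed
    then have [measurable]: "(\<lambda>a. \<Sum>j<m. if cmod (herm n (a j) x) \<le> R then (ip n (a j) x w)\<^sup>2 else 0) \<in> borel_measurable M"
      by (intro borel_measurable_sum) simp
    show ?thesis unfolding A4_def by measurable
  qed
  have net1: "nsq n z \<le> 1" if "z \<in> net n N" for z using that by (simp add: net_def)
  have T_le: "measure M (T j h) \<le> 2 / real m ^ 4" if "j < m" "nsq n h \<le> 1" for j h
  proof -
    have "measure M (T j h) \<le> 2 * exp (- (4 * L))"
      using tail_cmod_herm[OF that(2) R(2) that(1)] unfolding T_def M_def R2 .
    also have "exp (- (4 * L)) = 1 / real m ^ 4"
      unfolding exp_minus using exp_of_nat_mult[of 4 L] by (simp add: expL inverse_eq_divide)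
    finally show ?thesis by simp
  qed
  have b1: "measure M B1 \<le> 2 / real m"
  proof -
    have "measure M B1 \<le> real (card ({..<m} \<times> {..<n})) * (2 / real m ^ 4)"
      unfolding B1_def by (rule measure_UN_le_card[OF fin]) (auto intro!: T_sets T_le simp: ek(2))
    also have "\<dots> \<le> real m ^ 3 * (2 / real m ^ 4)"
    proof (intro mult_right_mono)
      have "real m * real n \<le> real m * real m" using nm by (intro mult_left_mono) auto
      also have "\<dots> \<le> real m ^ 3" using m by (simp add: power3_eq_cube)
      finally show "real (card ({..<m} \<times> {..<n})) \<le> real m ^ 3" by (simp add: card_cartesian_product)
    qed simp
    also have "\<dots> = 2 / real m" using m by (simp add: power4_eq_xxxx power3_eq_cube)
    finally show ?thesis .
  qed
  have b2: "measure M B2 \<le> 2 / real m"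
  proof -
    have "measure M B2 \<le> real (card {..<m}) * (2 / real m ^ 4)"
      unfolding B2_def by (rule measure_UN_le_card[OF fin]) (auto intro!: T_sets T_le simp: x)
    also have "\<dots> \<le> real m ^ 3 * (2 / real m ^ 4)"
      using m self_le_power[of "real m" 3] by (intro mult_right_mono) auto
    also have "\<dots> = 2 / real m" using m by (simp add: power4_eq_xxxx power3_eq_cube)
    finally show ?thesis .
  qed
  have L13: "L \<le> L ^ 3" using L by (intro self_le_power) auto
  have nL: "L \<le> real n * L" using n L by simp
  have inv: "exp (- L) = 1 / real m" by (simp add: exp_minus expL inverse_eq_divide)
  have b3: "measure M B3 \<le> 1 / real m"
  proof -
    have s: "real m * t\<^sup>2 / 524288 \<ge> 41 * (real n * L)"
    proof -
      have "real n * L \<le> real n * L ^ 3" using L13 by (intro mult_left_mono) auto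
      then show ?thesis using sample by simp
    qed
    have "measure M B3 \<le> real (card (net n N \<times> net n N)) * exp (- (real m * t\<^sup>2 / 524288))"
      unfolding B3_def
    proof (rule measure_UN_le_card[OF fin])
      show "finite (net n N \<times> net n N)" using finite_net by simp
      fix p assume p: "p \<in> net n N \<times> net n N"
      then show "(case p of (z, w) \<Rightarrow> A3 z w) \<in> sets M" using A3_sets by (simp add: case_prod_beta')
      show "measure M (case p of (z, w) \<Rightarrow> A3 z w) \<le> exp (- (real m * t\<^sup>2 / 524288))"
        using p lower_tail_ip[OF net1 net1 less_imp_le[OF t(1)]] unfolding A3_def M_def by (auto simp: case_prod_beta')
    qed
    also have "\<dots> \<le> (exp (20 * real n * L) * exp (20 * real n * L)) * exp (- (41 * (real n * L)))"
    proof (intro mult_mono)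
      show "real (card (net n N \<times> net n N)) \<le> exp (20 * real n * L) * exp (20 * real n * L)"
        unfolding card_cartesian_product of_nat_mult using card by (intro mult_mono) auto
      show "exp (- (real m * t\<^sup>2 / 524288)) \<le> exp (- (41 * (real n * L)))" using s by simp
    qed auto
    also have "\<dots> = exp (- (real n * L))" unfolding exp_add[symmetric] by simp
    also have "\<dots> \<le> exp (- L)" using nL by simp
    finally show ?thesis unfolding inv .
  qed
  have b4: "measure M B4 \<le> 1 / real m"
  proof -
    have s: "real m * t\<^sup>2 / (2048 * R ^ 4) \<ge> 41 * (real n * L)"
    proof -
      have "41 * (real n * L) * (524288 * L\<^sup>2) \<le> real m * t\<^sup>2"
        using sample by (simp add: power2_eq_square power3_eq_cube algebra_simps)
      then show ?thesis unfolding R4 using L by (simp add: pos_le_divide_eq)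
    qed
    have "measure M B4 \<le> real (card (net n N)) * exp (- (real m * t\<^sup>2 / (2048 * R ^ 4)))"
      unfolding B4_def
    proof (rule measure_UN_le_card[OF fin finite_net A4_sets])
      fix w assume w: "w \<in> net n N"
      show "measure M (A4 w) \<le> exp (- (real m * t\<^sup>2 / (2048 * R ^ 4)))"
        unfolding A4_def M_def
        by (rule upper_tail_truncated_ip) (use x net1[OF w] R t in auto)
    qed
    also have "\<dots> \<le> exp (20 * real n * L) * exp (- (41 * (real n * L)))"
      using card s by (intro mult_mono) auto
    also have "\<dots> = exp (- (21 * (real n * L)))" unfolding exp_add[symmetric] by simp
    also have "\<dots> \<le> exp (- L)" using nL L n by simp
    finally show ?thesis unfolding inv .
  qed
  define B where "B = (B1 \<union> B2) \<union> (B3 \<union> B4)"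
  have sets: "B1 \<in> sets M" "B2 \<in> sets M" "B3 \<in> sets M" "B4 \<in> sets M"
    unfolding B1_def B2_def B3_def B4_def
    by (intro sets.finite_UN; auto simp: finite_net intro!: T_sets A3_sets A4_sets)+
  have "measure M B \<le> (measure M B1 + measure M B2) + (measure M B3 + measure M B4)"
    unfolding B_def using sets
    by (intro order_trans[OF measure_Un_le] add_mono measure_Un_le) auto
  then have Bm: "measure M B \<le> 6 / real m" using b1 b2 b3 b4 by simp
  have good: "lower_regular n m a \<delta> \<and> upper_regular n m a x \<delta>" if a: "a \<in> space M - B" for a
  proof
    have as: "a \<in> space M" "a \<notin> B1" "a \<notin> B2" "a \<notin> B3" "a \<notin> B4" using a by (auto simp: B_def)
    have entries: "cmod (a j k) \<le> R" if "j < m" "k < n" for j k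
    proof -
      have "a \<notin> T j (e k)" using as(2) that unfolding B1_def by blast
      then show ?thesis using as(1) ek(1)[OF that(2), of "a j"] by (simp add: T_def)
    qed
    have xs: "cmod (herm n (a j) x) \<le> R" if "j < m" for j
      using as(1,3) that by (force simp: B2_def T_def)
    have \<delta>': "t + 4 * (real n * R) ^ 4 * (2 / real N) + 10 * real n * (2 / real N) \<le> \<delta>"
      using \<delta> unfolding R_def .
    show "lower_regular n m a \<delta>"
    proof (rule lower_regular_from_net[OF m N entries _ \<delta>'])
      fix z w assume "z \<in> net n N" "w \<in> net n N"
      then have "a \<notin> A3 z w" using as(4) unfolding B3_def by blast
      then have "real m * (mom n z w - t) \<le> (\<Sum>j<m. (ip n (a j) z w)\<^sup>2)" using as(1) by (simp add: A3_def)
      then show "mom n z w - t \<le> avg m (\<lambda>j. (ip n (a j) z w)\<^sup>2)"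
        unfolding avg_def using m by (simp add: pos_le_divide_eq mult.commute)
    qed
    show "upper_regular n m a x \<delta>"
    proof (rule upper_regular_from_net[OF m N entries x _ \<delta>'])
      fix w assume "w \<in> net n N"
      then have "a \<notin> A4 w" using as(5) unfolding B4_def by blast
      moreover have "(\<Sum>j<m. if cmod (herm n (a j) x) \<le> R then (ip n (a j) x w)\<^sup>2 else 0)
          = (\<Sum>j<m. (ip n (a j) x w)\<^sup>2)"
        using xs by (intro sum.cong) auto
      ultimately have "(\<Sum>j<m. (ip n (a j) x w)\<^sup>2) \<le> real m * (mom n x w + t)"
        using as(1) by (simp add: A4_def)
      then show "avg m (\<lambda>j. (ip n (a j) x w)\<^sup>2) \<le> mom n x w + t"
        unfolding avg_def using m by (simp add: pos_divide_le_eq mult.commute)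
    qed
  qed
  have "B \<in> sets M" unfolding B_def using sets by (intro sets.Un)
  then show ?thesis using Bm good by blast
qed

section \<open>The sample size and the theorem\<close>

text \<open>
  The union bound needs \<open>log m\<close> where the theorem has \<open>log n\<close>. If \<open>n\<^sup>2 > m\<close>, then \<open>log m < 2 log n\<close>, which
  costs the factor \<open>8\<close>. Otherwise \<open>n \<le> \<surd>m\<close>, and the claim holds for all large \<open>m\<close>; this also covers
  \<open>n = 1\<close>, where \<open>log n = 0\<close>.
\<close>

lemma sample_size_in_terms_of_m:
  fixes C :: real
  assumes C: "0 < C"
  shows "\<exists>M0. \<forall>n m :: nat. 1 \<le> n \<longrightarrow> M0 \<le> real m \<longrightarrow> 8 * C * real n * ln (real n) ^ 3 \<le> real m
     \<longrightarrow> C * real n * ln (real m) ^ 3 \<le> real m"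
proof -
  have "eventually (\<lambda>y::real. C * sqrt y * ln y ^ 3 \<le> y) at_top" using C by real_asymp
  then obtain M0 where M0: "\<And>y. M0 \<le> y \<Longrightarrow> C * sqrt y * ln y ^ 3 \<le> y"
    by (auto simp: eventually_at_top_linorder)
  have "C * real n * ln (real m) ^ 3 \<le> real m"
    if n: "1 \<le> n" and m: "max M0 1 \<le> real m" and s: "8 * C * real n * ln (real n) ^ 3 \<le> real m" for n m :: nat
  proof -
    have m1: "1 \<le> real m" using m by simp
    have lm: "0 \<le> ln (real m)" using m1 by simp
    show ?thesis
    proof (cases "(real n)\<^sup>2 \<le> real m")
      case True
      then have "real n \<le> sqrt (real m)" by (rule real_le_rsqrt)
      then have "C * real n * ln (real m) ^ 3 \<le> C * sqrt (real m) * ln (real m) ^ 3"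
        using C lm by (intro mult_right_mono mult_left_mono) auto
      also have "\<dots> \<le> real m" using m by (intro M0) simp
      finally show ?thesis .
    next
      case False
      have "ln (real m) \<le> ln ((real n)\<^sup>2)" using False m1 n by (subst ln_le_cancel_iff) auto
      also have "\<dots> = 2 * ln (real n)" using n by (simp add: ln_realpow)
      finally have "ln (real m) ^ 3 \<le> (2 * ln (real n)) ^ 3" using lm by (rule power_mono)
      then have "C * real n * ln (real m) ^ 3 \<le> C * real n * (2 * ln (real n)) ^ 3"
        using C by (intro mult_left_mono) auto
      also have "\<dots> = 8 * C * real n * ln (real n) ^ 3" by (simp add: power_mult_distrib)
      finally show ?thesis using s by linarith
    qed
  qed
  then show ?thesis by blast
qed

text \<open>
  The condition of \<open>regularity_with_high_probability\<close> for the deviation \<open>t = 1/20000\<close>, which is half of the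
  tolerance \<open>1/10000\<close>. The other half is left to the rounding errors.
\<close>

definition sample_constant :: real where
  "sample_constant = 41 * 524288 * 20000\<^sup>2"

text \<open>
  The mesh \<open>1/N\<close> with \<open>N = m\<^sup>9\<close> makes the rounding errors at most \<open>28/m\<close>, because \<open>n (4 \<surd>L) \<le> m\<^sup>2\<close>. The net has
  at most \<open>(2N + 1)\<close> to the power \<open>2n\<close> points, and \<open>2N + 1\<close> is at most the tenth power of \<open>m\<close>.
\<close>

lemma regularity_for_large_samples:
  fixes n m :: nat
  assumes n: "1 \<le> n" and m: "1000000 \<le> real m"
    and sample: "sample_constant * real n * ln (real m) ^ 3 \<le> real m" and x: "0 < nsq n x"
  shows "\<exists>B\<in>sets (gaussian_samples n m). measure (gaussian_samples n m) B \<le> 6 / real m \<and>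
     (\<forall>a\<in>space (gaussian_samples n m) - B.
        lower_regular n m a (1 / 10000) \<and> upper_regular n m a x (1 / 10000))"
proof -
  define L where "L = ln (real m)"
  define N where "N = m ^ 9"
  define t where "t = (1 / 20000 :: real)"
  have m0: "0 < m" using m by (cases m) auto
  have m3: "3 \<le> real m" using m by simp
  have L1: "1 \<le> L"
  proof -
    have "exp 1 \<le> real m" using exp_le m3 by linarith
    then show ?thesis unfolding L_def using m0 by (subst ln_ge_iff) auto
  qed
  have Lm: "L \<le> real m"
    using ln_le_minus_one[of "real m"] m0 unfolding L_def by simp
  have nm: "real n \<le> real m"
  proof -
    have "1 \<le> L ^ 3" using L1 by (rule one_le_power)
    then have "1 * real n \<le> sample_constant * L ^ 3 * real n"
      unfolding sample_constant_def by (intro mult_right_mono) auto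
    then show ?thesis using sample unfolding L_def by (simp add: mult.commute mult.left_commute)
  qed
  have N0: "0 < N" using m0 by (simp add: N_def)
  obtain c x' where c: "0 < c" "nsq n x' = 1" "x = (\<lambda>k. of_real c * x' k)"
    using normalize[OF x] by metis
  have card: "real (card (net n N)) \<le> exp (20 * real n * L)"
  proof -
    have "real (card (net n N)) \<le> real (((2 * N + 1)\<^sup>2) ^ n)" using card_net of_nat_mono by blast
    also have "\<dots> = (real (2 * N + 1)) ^ (2 * n)" by (simp only: of_nat_power power_mult)
    also have "\<dots> \<le> (real m ^ 10) ^ (2 * n)"
    proof (rule power_mono)
      have "1 \<le> real m ^ 9" using m3 by (intro one_le_power) simp
      then have "real (2 * N + 1) \<le> 3 * real m ^ 9" by (simp add: N_def)
      also have "\<dots> \<le> real m * real m ^ 9" using m3 by (intro mult_right_mono) auto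
      also have "\<dots> = real m ^ 10" by (simp only: power_Suc[symmetric]) simp
      finally show "real (2 * N + 1) \<le> real m ^ 10" .
    qed simp
    also have "\<dots> = real m ^ (20 * n)" by (simp add: power_mult[symmetric])
    also have "\<dots> = exp (real (20 * n) * L)"
      unfolding exp_of_nat_mult using m0 by (simp add: L_def)
    finally show ?thesis by simp
  qed
  have small: "4 * (real n * (4 * sqrt L)) ^ 4 * (2 / real N) + 10 * real n * (2 / real N) \<le> t"
  proof -
    have "(real n * (4 * sqrt L)) ^ 4 \<le> ((real m)\<^sup>2) ^ 4"
    proof (rule power_mono)
      have "(4 * sqrt L)\<^sup>2 \<le> (real m)\<^sup>2"
      proof -
        have "(4 * sqrt L)\<^sup>2 = 16 * L" using L1 by (simp add: power_mult_distrib)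
        also have "\<dots> \<le> real m * real m" using Lm m L1 by (intro mult_mono) auto
        finally show ?thesis by (simp only: power2_eq_square)
      qed
      then have "4 * sqrt L \<le> real m" by (rule power2_le_imp_le) simp
      then have "real n * (4 * sqrt L) \<le> real m * real m" using nm L1 by (intro mult_mono) auto
      then show "real n * (4 * sqrt L) \<le> (real m)\<^sup>2" by (simp only: power2_eq_square)
    qed (use L1 in simp)
    also have "\<dots> = real m ^ 8" by (simp add: power_mult[symmetric])
    finally have a: "4 * (real n * (4 * sqrt L)) ^ 4 * (2 / real N) \<le> 4 * real m ^ 8 * (2 / real N)"
      by (intro mult_right_mono mult_left_mono) auto
    have "real m ^ 1 \<le> real m ^ 8" using m3 by (intro power_increasing) auto
    then have "real n \<le> real m ^ 8" using nm by simp
    then have "10 * real n * (2 / real N) \<le> 10 * real m ^ 8 * (2 / real N)"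
      by (intro mult_right_mono mult_left_mono) auto
    then have "4 * (real n * (4 * sqrt L)) ^ 4 * (2 / real N) + 10 * real n * (2 / real N) \<le> 28 * (real m ^ 8 / real N)"
      using a by simp
    also have "real m ^ 8 / real N = 1 / real m"
    proof -
      have "real N = real m * real m ^ 8" unfolding N_def of_nat_power by (simp only: power_Suc[symmetric]) simp
      then show ?thesis using m0 by simp
    qed
    also have "28 * (1 / real m) \<le> t" using m by (simp add: t_def field_simps)
    finally show ?thesis .
  qed
  have sample': "real m * t\<^sup>2 \<ge> 41 * 524288 * real n * L ^ 3"
    using sample unfolding sample_constant_def L_def t_def by (simp add: power_divide)
  have "\<exists>B\<in>sets (gaussian_samples n m). measure (gaussian_samples n m) B \<le> 6 / real m \<and>
     (\<forall>a\<in>space (gaussian_samples n m) - B.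
        lower_regular n m a (1 / 10000) \<and> upper_regular n m a x' (1 / 10000))"
  proof (rule regularity_with_high_probability[where t = t and N = N])
    show "n \<le> m" using nm by simp
    show "t + 4 * (real n * (4 * sqrt (ln (real m)))) ^ 4 * (2 / real N) + 10 * real n * (2 / real N) \<le> 1 / 10000"
      using small unfolding L_def t_def by linarith
  qed (use m0 L1 n N0 c(2) card sample' in \<open>simp_all add: L_def t_def\<close>)
  then show ?thesis unfolding c(3) using upper_regular_scale by blast
qed

theorem proposition3:
  "\<exists>c2 > (0::real). \<exists>c3 > (0::real). \<forall>(n::nat) (m::nat) (zs :: nat \<Rightarrow> complex).
     zs \<in> vecs n \<longrightarrow> (\<exists>k<n. zs k \<noteq> 0) \<longrightarrow> m \<ge> 1 \<longrightarrow>
     real m \<ge> c2 * real n * (ln (real n)) ^ 3 \<longrightarrow>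
     \<P>(a in gaussian_samples n m.
        let b = (\<lambda>j. cmod (herm n (a j) zs));
            f = phase_loss n m a b;
            X = solution_set n zs
        in X = second_order_critical_points (2 * n) f \<and>
           (\<forall>w \<in> vecs (2 * n).
              dist_to_set (2 * n) w X \<le> 1 / sqrt 7 * cnorm n zs \<longrightarrow>
              dist_to_set (2 * n) w X
                \<le> 4 / (cnorm n zs)\<^sup>2 * L2_set (grad (2 * n) f w) {..<2 * n}))
     \<ge> 1 - c3 / real m"
proof -
  have C: "0 < sample_constant" by (simp add: sample_constant_def)
  obtain M0 where M0: "\<And>n m :: nat. 1 \<le> n \<Longrightarrow> M0 \<le> real m
      \<Longrightarrow> 8 * sample_constant * real n * ln (real n) ^ 3 \<le> real m
      \<Longrightarrow> sample_constant * real n * ln (real m) ^ 3 \<le> real m"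
    using sample_size_in_terms_of_m[OF C] by blast
  (* For m < c3 the asserted bound is at most zero, so c3 also serves as the threshold for large m. *)
  define c3 where "c3 = max M0 1000000"
  show ?thesis
  proof (rule exI[of _ "8 * sample_constant"], rule conjI[rotated], rule exI[of _ c3], intro conjI allI impI)
    show "0 < 8 * sample_constant" using C by simp
    show "0 < c3" by (simp add: c3_def)
    fix n m :: nat and zs :: "nat \<Rightarrow> complex"
    assume nz: "\<exists>k<n. zs k \<noteq> 0" and m: "1 \<le> m"
      and s: "8 * sample_constant * real n * ln (real n) ^ 3 \<le> real m"
    let ?M = "gaussian_samples n m"
    let ?f = "\<lambda>a. phase_loss n m a (\<lambda>j. cmod (herm n (a j) zs))"
    let ?good = "\<lambda>a. solution_set n zs = second_order_critical_points (2 * n) (?f a) \<and>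
       (\<forall>w \<in> vecs (2 * n).
          dist_to_set (2 * n) w (solution_set n zs) \<le> 1 / sqrt 7 * cnorm n zs \<longrightarrow>
          dist_to_set (2 * n) w (solution_set n zs)
            \<le> 4 / (cnorm n zs)\<^sup>2 * L2_set (grad (2 * n) (?f a) w) {..<2 * n})"
    interpret prob_space ?M by (rule prob_space_gaussian_samples)
    have "1 - c3 / real m \<le> measure ?M {a \<in> space ?M. ?good a}"
    proof (cases "c3 \<le> real m")
      case False
      then have "1 - c3 / real m \<le> 0" using m by (simp add: field_simps)
      then show ?thesis using measure_nonneg by (rule order_trans)
    next
      case True
      obtain k where k: "k < n" "zs k \<noteq> 0" using nz by blast
      have "0 < (cmod (zs k))\<^sup>2" using k(2) by simp
      also have "\<dots> \<le> nsq n zs" unfolding nsq_def using k(1) by (intro member_le_sum) auto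
      finally have x: "0 < nsq n zs" .
      have n1: "1 \<le> n" using k(1) by simp
      have big: "1000000 \<le> real m" "M0 \<le> real m" using True by (simp_all add: c3_def)
      obtain B where B: "B \<in> sets ?M" "measure ?M B \<le> 6 / real m"
        and reg: "\<And>a. a \<in> space ?M - B \<Longrightarrow>
           lower_regular n m a (1 / 10000) \<and> upper_regular n m a zs (1 / 10000)"
        using regularity_for_large_samples[OF n1 big(1) M0[OF n1 big(2) s] x] by blast
      have good: "?good a" if a: "a \<in> space ?M - B" for a
      proof -
        note low = reg[OF a, THEN conjunct1] and up = reg[OF a, THEN conjunct2]
        have "solution_set n zs = second_order_critical_points (2 * n) (?f a)"
          using orbit_points_are_critical critical_points_in_orbit[OF low up refl x] by blast
        then show ?thesis
          using error_bound_near_orbit[OF low up _ _ x] by simp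
      qed
      have event: "{a \<in> space ?M. ?good a} \<in> sets ?M"
      proof (rule sets_good_event)
        fix j k assume "j < m" "k < n"
        then have "(\<lambda>a. a j) \<in> measurable ?M (complex_gaussian_vec n)"
          "(\<lambda>a. a k) \<in> measurable (complex_gaussian_vec n) complex_gaussian"
          unfolding gaussian_samples_def complex_gaussian_vec_def
          by (auto intro!: measurable_component_singleton)
        from measurable_compose[OF this] show "(\<lambda>a. a j k) \<in> borel_measurable ?M"
          by (simp only: measurable_cong_sets[OF refl sets_complex_gaussian])
      qed (simp add: cnorm_eq)
      have "1 - c3 / real m \<le> 1 - 6 / real m"
        unfolding c3_def by (intro diff_left_mono divide_right_mono) auto
      also have "\<dots> \<le> 1 - measure ?M B" using B(2) by simp
      also have "\<dots> = measure ?M (space ?M - B)" using prob_compl[OF B(1)] by simp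
      also have "\<dots> \<le> measure ?M {a \<in> space ?M. ?good a}"
        using good by (intro finite_measure_mono event) blast
      finally show ?thesis .
    qed
    then show "1 - c3 / real m \<le> \<P>(a in gaussian_samples n m.
        let b = (\<lambda>j. cmod (herm n (a j) zs));
            f = phase_loss n m a b;
            X = solution_set n zs
        in X = second_order_critical_points (2 * n) f \<and>
           (\<forall>w \<in> vecs (2 * n).
              dist_to_set (2 * n) w X \<le> 1 / sqrt 7 * cnorm n zs \<longrightarrow>
              dist_to_set (2 * n) w X
                \<le> 4 / (cnorm n zs)\<^sup>2 * L2_set (grad (2 * n) f w) {..<2 * n}))"
      unfolding Let_def .
  qed
qed

end
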